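(* Let $(A,\operatorname{dom}(A))$ be the string-network operator described in the context, $(T(t))_{t\ge0}$ the contraction semigroup it generates, and $\Psi_{i\omega,k}$ ($\omega\in\mathbb R$, $k\in\{\mathrm I,\mathrm{II},\mathrm{III}\}$) the fundamental solutions described in the context. If for all $\omega\in\mathbb R\setminus\{0\}$ we have $$|\Psi_{i\omega,\mathrm I}^{12}(b)\Psi_{i\omega,\mathrm{II}}^{11}(b)|+|\Psi_{i\omega,\mathrm I}^{12}(b)\Psi_{i\omega,\mathrm{III}}^{11}(b)|+|\Psi_{i\omega,\mathrm{II}}^{11}(b)\Psi_{i\omega,\mathrm{III}}^{11}(b)|>0,$$ then $(T(t))_{t\ge0}$ is semi-uniformly stable. If, on the other hand, $$|\Psi_{i\omega,\mathrm I}^{12}(b)\Psi_{i\omega,\mathrm{II}}^{11}(b)|+|\Psi_{i\omega,\mathrm I}^{12}(b)\Psi_{i\omega,\mathrm{III}}^{11}(b)|+|\Psi_{i\omega,\mathrm{II}}^{11}(b)\Psi_{i\omega,\mathrm{III}}^{11}(b)|=0$$ for one $\omega\in\mathbb R$, then $i\omega$ is an eigenvalue of $(A,\operatorname{dom}(A))$ and $(T(t))_{t\ge0}$ is not semi-uniformly stable.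
   Context: String network. Let $a<b$ be real and $\beta>0$. For $k\in\{\mathrm I,\mathrm{II},\mathrm{III}\}$ let $T_k,\rho_k\in L_\infty(a,b)$ with $T_k(\zeta),\rho_k(\zeta)\ge\varepsilon_0$ for a.e. $\zeta\in(a,b)$, for some $\varepsilon_0>0$. Let $P_1\in\mathbb C^{6\times 6}$ be block-diagonal with three diagonal blocks $\begin{bmatrix}0&1\\1&0\end{bmatrix}$, and $\mathcal H(\zeta)=\operatorname{diag}(\mathcal H_{\mathrm I}(\zeta),\mathcal H_{\mathrm{II}}(\zeta),\mathcal H_{\mathrm{III}}(\zeta))$ with $\mathcal H_k(\zeta)=\begin{bmatrix}1/\rho_k(\zeta)&0\\0&T_k(\zeta)\end{bmatrix}$. The space $X=L_{2,\mathcal H}((a,b);\mathbb C^6)$ is $L_2((a,b);\mathbb C^6)$ with inner product $\langle f,g\rangle_{\mathcal H}=\frac12\int_a^bg^*\mathcal Hf\,d\zeta$. Let $$W_B=\left[\begin{array}{cccccc|cccccc}1&0&-1&0&0&0&0&0&0&0&0&0\\1&0&0&0&-1&0&0&0&0&0&0&0\\ \beta&1&0&1&0&1&0&0&0&0&0&0\\0&0&0&0&0&0&1&0&0&0&0&0\\0&0&0&0&0&0&0&0&0&1&0&0\\0&0&0&0&0&0&0&0&0&0&0&1\end{array}\right].$$ $A=P_1\frac{d}{d\zeta}\mathcal H$ with $\operatorname{dom}(A)=\{x\in X\mid\mathcal Hx\in H^1((a,b);\mathbb C^6),\ W_B\begin{bmatrix}(\mathcal Hx)(b)\\(\mathcal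 Hx)(a)\end{bmatrix}=0\}$; $A$ generates a contraction semigroup $(T(t))_{t\ge0}$ on $X$. For $\omega\in\mathbb R$ and $k\in\{\mathrm I,\mathrm{II},\mathrm{III}\}$, $\Psi_{i\omega,k}=\begin{bmatrix}\Psi_{i\omega,k}^{11}&\Psi_{i\omega,k}^{12}\\\Psi_{i\omega,k}^{21}&\Psi_{i\omega,k}^{22}\end{bmatrix}\colon[a,b]\to\mathbb C^{2\times2}$ is the fundamental solution (continuous, $H^1$, equation holding a.e.) of $\frac{dv_k}{d\zeta}(\zeta)=i\omega\begin{bmatrix}0&T_k(\zeta)^{-1}\\\rho_k(\zeta)&0\end{bmatrix}v_k(\zeta)$ with $\Psi_{i\omega,k}(a)=I_2$. Semi-uniformly stable means: there is $f\colon[0,\infty)\to[0,\infty)$ with $f(t)\to0$ as $t\to\infty$ and $\|T(t)x\|_{\mathcal H}\le f(t)\|x\|_{\operatorname{dom}(A)}$ (graph norm) for all $x\in\operatorname{dom}(A)$, $t\ge0$. *)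

theory Defs
  imports "HOL-Analysis.Analysis"
begin

text \<open>
  Elements of the function spaces are represented by functions on \<open>real\<close>, of which only the
  behaviour almost everywhere on the open interval \<open>(a,b)\<close> matters. Equality in such a space
  is therefore \<open>ae_eq\<close>, and operators on it are maps between representatives.
\<close>

definition ae_eq :: "real \<Rightarrow> real \<Rightarrow> (real \<Rightarrow> 'v) \<Rightarrow> (real \<Rightarrow> 'v) \<Rightarrow> bool" where
  "ae_eq a b f g \<longleftrightarrow> (AE \<zeta> in lebesgue_on {a<..<b}. f \<zeta> = g \<zeta>)"

definition L_infty :: "real \<Rightarrow> real \<Rightarrow> (real \<Rightarrow> real) set" where
  "L_infty a b = {f \<in> borel_measurable (lebesgue_on {a<..<b}).
     \<exists>C. AE \<zeta> in lebesgue_on {a<..<b}. \<bar>f \<zeta>\<bar> \<le> C}"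

definition L2 :: "real \<Rightarrow> real \<Rightarrow> (real \<Rightarrow> 'v::euclidean_space) set" where
  "L2 a b = {f \<in> borel_measurable (lebesgue_on {a<..<b}).
     integrable (lebesgue_on {a<..<b}) (\<lambda>\<zeta>. (norm (f \<zeta>))\<^sup>2)}"

definition test_functions :: "real \<Rightarrow> real \<Rightarrow> (real \<Rightarrow> real) set" where
  "test_functions a b = {\<phi>. (\<forall>n x. (deriv ^^ n) \<phi> differentiable (at x)) \<and>
     (\<exists>c d. a < c \<and> d < b \<and> (\<forall>x. x \<notin> {c..d} \<longrightarrow> \<phi> x = 0))}"

definition has_weak_deriv ::
  "real \<Rightarrow> real \<Rightarrow> (real \<Rightarrow> 'v::euclidean_space) \<Rightarrow> (real \<Rightarrow> 'v) \<Rightarrow> bool" where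
  "has_weak_deriv a b f g \<longleftrightarrow> (\<forall>\<phi> \<in> test_functions a b.
     (\<integral>\<zeta>. deriv \<phi> \<zeta> *\<^sub>R f \<zeta> \<partial>(lebesgue_on {a<..<b})) =
     - (\<integral>\<zeta>. \<phi> \<zeta> *\<^sub>R g \<zeta> \<partial>(lebesgue_on {a<..<b})))"

definition H1 :: "real \<Rightarrow> real \<Rightarrow> (real \<Rightarrow> 'v::euclidean_space) set" where
  "H1 a b = {f \<in> L2 a b. \<exists>g \<in> L2 a b. has_weak_deriv a b f g}"

text \<open>For \<open>f\<close> in \<open>H1\<close>, the chosen weak derivative is unique up to \<open>ae_eq\<close>.\<close>

definition weak_deriv ::
  "real \<Rightarrow> real \<Rightarrow> (real \<Rightarrow> 'v::euclidean_space) \<Rightarrow> real \<Rightarrow> 'v" where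
  "weak_deriv a b f = (SOME g. g \<in> L2 a b \<and> has_weak_deriv a b f g)"

datatype string_label = S_I | S_II | S_III

definition block_diag3 ::
  "complex^2^2 \<Rightarrow> complex^2^2 \<Rightarrow> complex^2^2 \<Rightarrow> complex^6^6" where
  "block_diag3 A B C = vector [
     vector [A$1$1, A$1$2, 0, 0, 0, 0],
     vector [A$2$1, A$2$2, 0, 0, 0, 0],
     vector [0, 0, B$1$1, B$1$2, 0, 0],
     vector [0, 0, B$2$1, B$2$2, 0, 0],
     vector [0, 0, 0, 0, C$1$1, C$1$2],
     vector [0, 0, 0, 0, C$2$1, C$2$2]]"

definition P1 :: "complex^6^6" where
  "P1 = (let J = vector [vector [0, 1], vector [1, 0]] in block_diag3 J J J)"

text \<open>The tension \<open>T\<close> and the mass density \<open>\<rho>\<close> are indexed by the string.\<close>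

definition H_string ::
  "(string_label \<Rightarrow> real \<Rightarrow> real) \<Rightarrow> (string_label \<Rightarrow> real \<Rightarrow> real) \<Rightarrow>
   string_label \<Rightarrow> real \<Rightarrow> complex^2^2" where
  "H_string T \<rho> k \<zeta> = vector [
     vector [complex_of_real (1 / \<rho> k \<zeta>), 0],
     vector [0, complex_of_real (T k \<zeta>)]]"

definition hamiltonian ::
  "(string_label \<Rightarrow> real \<Rightarrow> real) \<Rightarrow> (string_label \<Rightarrow> real \<Rightarrow> real) \<Rightarrow>
   real \<Rightarrow> complex^6^6" where
  "hamiltonian T \<rho> \<zeta> =
     block_diag3 (H_string T \<rho> S_I \<zeta>) (H_string T \<rho> S_II \<zeta>) (H_string T \<rho> S_III \<zeta>)"

definition W_B :: "real \<Rightarrow> complex^12^6" where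
  "W_B \<beta> = vector [
     vector [1, 0, -1, 0,  0, 0,  0, 0, 0, 0, 0, 0],
     vector [1, 0,  0, 0, -1, 0,  0, 0, 0, 0, 0, 0],
     vector [complex_of_real \<beta>, 1, 0, 1, 0, 1,  0, 0, 0, 0, 0, 0],
     vector [0, 0,  0, 0,  0, 0,  1, 0, 0, 0, 0, 0],
     vector [0, 0,  0, 0,  0, 0,  0, 0, 0, 1, 0, 0],
     vector [0, 0,  0, 0,  0, 0,  0, 0, 0, 0, 0, 1]]"

definition stack :: "complex^6 \<Rightarrow> complex^6 \<Rightarrow> complex^12" where
  "stack u v = vector [u$1, u$2, u$3, u$4, u$5, u$6, v$1, v$2, v$3, v$4, v$5, v$6]"

text \<open>
  In the following, \<open>H\<close> is the Hamiltonian density. The state space is \<open>L2 a b\<close> as a set, with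
  the inner product \<open>inner_H\<close>.
\<close>

definition inner_H ::
  "real \<Rightarrow> real \<Rightarrow> (real \<Rightarrow> complex^6^6) \<Rightarrow> (real \<Rightarrow> complex^6) \<Rightarrow> (real \<Rightarrow> complex^6) \<Rightarrow> complex"
  where
  "inner_H a b H f g = 1/2 *
     (\<integral>\<zeta>. (\<Sum>i\<in>UNIV. cnj (g \<zeta> $ i) * (H \<zeta> *v f \<zeta>) $ i) \<partial>(lebesgue_on {a<..<b}))"

definition norm_H ::
  "real \<Rightarrow> real \<Rightarrow> (real \<Rightarrow> complex^6^6) \<Rightarrow> (real \<Rightarrow> complex^6) \<Rightarrow> real" where
  "norm_H a b H f = sqrt (Re (inner_H a b H f f))"

text \<open>
  Boundary values of an \<open>H1\<close> function are those of its continuous representative \<open>w\<close> on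
  \<open>[a,b]\<close>, which is unique if \<open>a < b\<close>.
\<close>

definition dom_A ::
  "real \<Rightarrow> real \<Rightarrow> real \<Rightarrow> (real \<Rightarrow> complex^6^6) \<Rightarrow> (real \<Rightarrow> complex^6) set" where
  "dom_A a b \<beta> H = {x \<in> L2 a b. (\<lambda>\<zeta>. H \<zeta> *v x \<zeta>) \<in> H1 a b \<and>
     (\<exists>w. continuous_on {a..b} w \<and> ae_eq a b w (\<lambda>\<zeta>. H \<zeta> *v x \<zeta>) \<and>
          W_B \<beta> *v stack (w b) (w a) = 0)}"

definition op_A ::
  "real \<Rightarrow> real \<Rightarrow> (real \<Rightarrow> complex^6^6) \<Rightarrow> (real \<Rightarrow> complex^6) \<Rightarrow> real \<Rightarrow> complex^6" where
  "op_A a b H x = (\<lambda>\<zeta>. P1 *v weak_deriv a b (\<lambda>\<xi>. H \<xi> *v x \<xi>) \<zeta>)"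

definition graph_norm ::
  "real \<Rightarrow> real \<Rightarrow> (real \<Rightarrow> complex^6^6) \<Rightarrow> (real \<Rightarrow> complex^6) \<Rightarrow> real" where
  "graph_norm a b H x = sqrt ((norm_H a b H x)\<^sup>2 + (norm_H a b H (op_A a b H x))\<^sup>2)"

definition eigenvalue_A ::
  "real \<Rightarrow> real \<Rightarrow> real \<Rightarrow> (real \<Rightarrow> complex^6^6) \<Rightarrow> complex \<Rightarrow> bool" where
  "eigenvalue_A a b \<beta> H \<mu> \<longleftrightarrow> (\<exists>x \<in> dom_A a b \<beta> H.
     \<not> ae_eq a b x (\<lambda>\<zeta>. 0) \<and> ae_eq a b (op_A a b H x) (\<lambda>\<zeta>. \<mu> *s x \<zeta>))"

definition contraction_semigroup ::
  "real \<Rightarrow> real \<Rightarrow> (real \<Rightarrow> complex^6^6) \<Rightarrow>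
   (real \<Rightarrow> (real \<Rightarrow> complex^6) \<Rightarrow> real \<Rightarrow> complex^6) \<Rightarrow> bool" where
  "contraction_semigroup a b H S \<longleftrightarrow>
     (\<forall>t\<ge>0. \<forall>x\<in>L2 a b. S t x \<in> L2 a b) \<and>
     (\<forall>t\<ge>0. \<forall>x\<in>L2 a b. \<forall>y\<in>L2 a b. ae_eq a b x y \<longrightarrow> ae_eq a b (S t x) (S t y)) \<and>
     (\<forall>t\<ge>0. \<forall>c d. \<forall>x\<in>L2 a b. \<forall>y\<in>L2 a b.
        ae_eq a b (S t (\<lambda>\<zeta>. c *s x \<zeta> + d *s y \<zeta>)) (\<lambda>\<zeta>. c *s S t x \<zeta> + d *s S t y \<zeta>)) \<and>
     (\<forall>t\<ge>0. \<forall>x\<in>L2 a b. norm_H a b H (S t x) \<le> norm_H a b H x) \<and>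
     (\<forall>x\<in>L2 a b. ae_eq a b (S 0 x) x) \<and>
     (\<forall>s\<ge>0. \<forall>t\<ge>0. \<forall>x\<in>L2 a b. ae_eq a b (S (s + t) x) (S s (S t x))) \<and>
     (\<forall>x\<in>L2 a b. ((\<lambda>t. norm_H a b H (\<lambda>\<zeta>. S t x \<zeta> - x \<zeta>)) \<longlongrightarrow> 0) (at_right 0))"

text \<open>The generator of \<open>S\<close> is the operator \<open>op_A\<close> with domain exactly \<open>dom_A\<close>.\<close>

definition generates ::
  "real \<Rightarrow> real \<Rightarrow> real \<Rightarrow> (real \<Rightarrow> complex^6^6) \<Rightarrow>
   (real \<Rightarrow> (real \<Rightarrow> complex^6) \<Rightarrow> real \<Rightarrow> complex^6) \<Rightarrow> bool" where
  "generates a b \<beta> H S \<longleftrightarrow> (\<forall>x\<in>L2 a b. \<forall>y\<in>L2 a b.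
     (x \<in> dom_A a b \<beta> H \<and> ae_eq a b (op_A a b H x) y) \<longleftrightarrow>
     ((\<lambda>t. norm_H a b H (\<lambda>\<zeta>. (1 / t) *\<^sub>R (S t x \<zeta> - x \<zeta>) - y \<zeta>)) \<longlongrightarrow> 0) (at_right 0))"

definition semi_uniformly_stable ::
  "real \<Rightarrow> real \<Rightarrow> real \<Rightarrow> (real \<Rightarrow> complex^6^6) \<Rightarrow>
   (real \<Rightarrow> (real \<Rightarrow> complex^6) \<Rightarrow> real \<Rightarrow> complex^6) \<Rightarrow> bool" where
  "semi_uniformly_stable a b \<beta> H S \<longleftrightarrow>
     (\<exists>f :: real \<Rightarrow> real. (\<forall>t\<ge>0. f t \<ge> 0) \<and> (f \<longlongrightarrow> 0) at_top \<and>
        (\<forall>x \<in> dom_A a b \<beta> H. \<forall>t\<ge>0. norm_H a b H (S t x) \<le> f t * graph_norm a b H x))"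

definition string_ode_matrix ::
  "(string_label \<Rightarrow> real \<Rightarrow> real) \<Rightarrow> (string_label \<Rightarrow> real \<Rightarrow> real) \<Rightarrow>
   real \<Rightarrow> string_label \<Rightarrow> real \<Rightarrow> complex^2^2" where
  "string_ode_matrix T \<rho> \<omega> k \<zeta> = vector [
     vector [0, \<i> * complex_of_real \<omega> * complex_of_real (inverse (T k \<zeta>))],
     vector [\<i> * complex_of_real \<omega> * complex_of_real (\<rho> k \<zeta>), 0]]"

definition fundamental_solution ::
  "real \<Rightarrow> real \<Rightarrow> (string_label \<Rightarrow> real \<Rightarrow> real) \<Rightarrow> (string_label \<Rightarrow> real \<Rightarrow> real) \<Rightarrow>
   real \<Rightarrow> string_label \<Rightarrow> (real \<Rightarrow> complex^2^2) \<Rightarrow> bool" where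
  "fundamental_solution a b T \<rho> \<omega> k \<Psi> \<longleftrightarrow>
     continuous_on {a..b} \<Psi> \<and> \<Psi> \<in> H1 a b \<and> \<Psi> a = mat 1 \<and>
     ae_eq a b (weak_deriv a b \<Psi>) (\<lambda>\<zeta>. string_ode_matrix T \<rho> \<omega> k \<zeta> ** \<Psi> \<zeta>)"

end

theory Submission
  imports Defs "HOL-Complex_Analysis.Great_Picard" "HOL-Library.Function_Algebras"
begin

text \<open>
  The unit ball of the graph norm of \<open>A\<close> is precompact in the state space, so stability of the
  individual orbits starting in the domain is automatically uniform on that ball. If some such orbit
  does not tend to \<open>0\<close>, its limit points lie in the closed invariant space on which the semigroup is
  isometric and \<open>A\<close> is skew-symmetric; minimising \<open>\<parallel>A y\<parallel> / \<parallel>y\<parallel>\<close> there yields \<open>y\<close> with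
  \<open>A\<^sup>2 y = - m\<^sup>2 y\<close> and hence an eigenvalue \<open>\<plusminus> i m\<close>. Thus semi-uniform stability is equivalent to
  the absence of imaginary eigenvalues. An eigenfunction for \<open>i \<omega>\<close> loses no energy, hence has zero
  displacement at the common end point; comparing it with the columns of \<open>\<Psi>\<close> by Wronskians, it exists
  precisely if two of the numbers \<open>\<Psi>\<^sub>I\<^sup>1\<^sup>2(b)\<close>, \<open>\<Psi>\<^sub>I\<^sub>I\<^sup>1\<^sup>1(b)\<close>, \<open>\<Psi>\<^sub>I\<^sub>I\<^sub>I\<^sup>1\<^sup>1(b)\<close> vanish.
\<close>

section \<open>Semi-inner product spaces\<close>

text \<open>Functions matter only almost everywhere, so the abstract part uses a positive
  semidefinite form, and two vectors agree when the norm of their difference is 0. No resolvent,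
  spectral theorem or vector-valued integral enters: orbits are compared by cutting
  \<open>[0, t]\<close> into equal steps and refining them. The scalars are real; multiplication by
  the imaginary unit is an operator \<open>J\<close>, and the factorisation of A^2 + m^2 into (A - m
  J)(A + m J) turns the minimiser into an eigenvector. The particular entries of
  \<open>\<Psi>\<close> come from the conditions at \<open>a\<close>. String I has first component 0
  there, so an eigenfunction restricted to it is a multiple of the second column; strings II and III
  have second component 0 there and use the first column. Once all first components vanish at
  \<open>b\<close>, a string carries a nonzero force at \<open>b\<close> only if its entry is 0, and
  the three forces must sum to 0, so at least two strings have to take part. At frequency 0 the
  coefficients of the equation vanish, so the entries of strings II and III are 1 and the sum of the
  three products is positive; this is why the first hypothesis can speak of nonzero frequencies
  only.\<close>

lemma quadratic_nonneg_imp_linear_coeff_zero: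
  fixes B C :: real
  assumes "\<And>s. 0 \<le> 2 * s * B + s\<^sup>2 * C"
  shows "B = 0"
proof (rule ccontr)
  assume "B \<noteq> 0"
  \<comment> \<open>The sign is opposite to that of \<open>B\<close>, and the size lets the linear
    term dominate; the \<open>+ 1\<close> covers \<open>C = 0\<close>. The lemma is the
    first-variation principle: a vector at which a nonnegative quadratic form vanishes is orthogonal
    to everything with respect to that form.\<close>
  define s where "s = - B / (\<bar>C\<bar> + 1)"
  have "s\<^sup>2 * C \<le> s\<^sup>2 * (\<bar>C\<bar> + 1)"
    by (intro mult_left_mono) auto
  also have "\<dots> = - s * B"
    by (simp add: s_def power2_eq_square divide_simps)
  finally have le: "s\<^sup>2 * C \<le> - (s * B)" by simp
  have "0 < B * B / (\<bar>C\<bar> + 1)"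
    using \<open>B \<noteq> 0\<close> by (intro divide_pos_pos) (auto simp: zero_less_mult_iff)
  then have "s * B < 0" by (simp add: s_def)
  with le assms[of s] show False by simp
qed

text \<open>Definiteness is left out on purpose: vectors will be representatives of classes modulo
  almost everywhere equality, and forming the quotient is avoided. Limits are therefore unique only
  up to vectors of norm 0.\<close>

locale semi_hilbert =
  fixes X :: "'a::real_vector set" and ip :: "'a \<Rightarrow> 'a \<Rightarrow> real"
  assumes X_subspace: "subspace X"
    and ip_commute: "x \<in> X \<Longrightarrow> y \<in> X \<Longrightarrow> ip x y = ip y x"
    and ip_add: "x \<in> X \<Longrightarrow> y \<in> X \<Longrightarrow> z \<in> X \<Longrightarrow> ip (x + y) z = ip x z + ip y z"
    and ip_scale: "x \<in> X \<Longrightarrow> z \<in> X \<Longrightarrow> ip (r *\<^sub>R x) z = r * ip x z"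
    and ip_ge0: "x \<in> X \<Longrightarrow> 0 \<le> ip x x"
    and complete: "(\<And>n. f n \<in> X) \<Longrightarrow>
      (\<And>e. 0 < e \<Longrightarrow> \<exists>N. \<forall>m\<ge>N. \<forall>n\<ge>N. ip (f m - f n) (f m - f n) < e) \<Longrightarrow>
      \<exists>l\<in>X. (\<lambda>n. ip (f n - l) (f n - l)) \<longlonglongrightarrow> (0::real)"
begin

definition nrm :: "'a \<Rightarrow> real" where "nrm x = sqrt (ip x x)"

lemma X_closed [simp]:
  "0 \<in> X" "x \<in> X \<Longrightarrow> y \<in> X \<Longrightarrow> x + y \<in> X" "x \<in> X \<Longrightarrow> y \<in> X \<Longrightarrow> x - y \<in> X"
  "x \<in> X \<Longrightarrow> r *\<^sub>R x \<in> X" "x \<in> X \<Longrightarrow> - x \<in> X"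
  using X_subspace by (auto simp: subspace_0 subspace_neg subspace_add subspace_diff subspace_scale)

lemma ip_diff: "x \<in> X \<Longrightarrow> y \<in> X \<Longrightarrow> z \<in> X \<Longrightarrow> ip (x - y) z = ip x z - ip y z"
  using ip_add[of x "(-1) *\<^sub>R y" z] ip_scale[of y z "-1"] subspace_neg[OF X_subspace, of y] by simp

lemma ip_add2: "x \<in> X \<Longrightarrow> y \<in> X \<Longrightarrow> z \<in> X \<Longrightarrow> ip z (x + y) = ip z x + ip z y"
  by (simp add: ip_add ip_commute[of z])

lemma ip_diff2: "x \<in> X \<Longrightarrow> y \<in> X \<Longrightarrow> z \<in> X \<Longrightarrow> ip z (x - y) = ip z x - ip z y"
  by (simp add: ip_diff ip_commute[of z])

lemma ip_scale2: "x \<in> X \<Longrightarrow> z \<in> X \<Longrightarrow> ip z (r *\<^sub>R x) = r * ip z x"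
  by (simp add: ip_scale ip_commute[of z])

lemmas ip_lin = ip_add ip_diff ip_scale ip_add2 ip_diff2 ip_scale2

lemma nrm_sq: "x \<in> X \<Longrightarrow> (nrm x)\<^sup>2 = ip x x"
  by (simp add: nrm_def ip_ge0)

lemma nrm_ge0 [simp]: "x \<in> X \<Longrightarrow> 0 \<le> nrm x"
  by (simp add: nrm_def ip_ge0)

lemma nrm_scale: "x \<in> X \<Longrightarrow> nrm (r *\<^sub>R x) = \<bar>r\<bar> * nrm x"
  by (simp add: nrm_def ip_lin real_sqrt_mult flip: mult.assoc)

lemma nrm_zero [simp]: "nrm 0 = 0"
  using nrm_scale[of 0 0] by simp

lemma nrm_diff_commute: "x \<in> X \<Longrightarrow> y \<in> X \<Longrightarrow> nrm (x - y) = nrm (y - x)"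
  using nrm_scale[of "y - x" "-1"] by simp

lemma cauchy_schwarz:
  assumes [simp]: "x \<in> X" "y \<in> X"
  shows "\<bar>ip x y\<bar> \<le> nrm x * nrm y"
proof -
  have q: "0 \<le> ip x x + 2 * s * ip x y + s\<^sup>2 * ip y y" for s
    using ip_ge0[of "x + s *\<^sub>R y"]
    by (simp add: ip_lin ip_commute[of y x] power2_eq_square algebra_simps)
  have "(ip x y)\<^sup>2 \<le> ip x x * ip y y"
  proof (cases "ip y y = 0")
    \<comment> \<open>The form is only semidefinite, so \<open>y\<close> may be a nonzero null
      vector. The chosen \<open>s\<close> would give \<open>q\<close> the value -1.\<close>
    case True
    have "ip x y = 0"
    proof (rule ccontr)
      assume "ip x y \<noteq> 0"
      then show False
        using q[of "- (ip x x + 1) / (2 * ip x y)"] True by (simp add: field_simps)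
    qed
    then show ?thesis using True by simp
  next
    case False
    then have "ip y y > 0" using ip_ge0[of y] by simp
    then show ?thesis
      using q[of "- ip x y / ip y y"] by (simp add: field_simps power2_eq_square)
  qed
  then have "sqrt ((ip x y)\<^sup>2) \<le> sqrt (ip x x * ip y y)" by (rule real_sqrt_le_mono)
  then show ?thesis by (simp add: nrm_def real_sqrt_mult)
qed

lemma nrm_triangle:
  assumes [simp]: "x \<in> X" "y \<in> X"
  shows "nrm (x + y) \<le> nrm x + nrm y"
proof (rule power2_le_imp_le)
  have "(nrm (x + y))\<^sup>2 = (nrm x)\<^sup>2 + 2 * ip x y + (nrm y)\<^sup>2"
    by (simp add: nrm_sq ip_lin ip_commute[of y x])
  also have "\<dots> \<le> (nrm x + nrm y)\<^sup>2"
    using cauchy_schwarz[of x y] by (simp add: power2_sum)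
  finally show "(nrm (x + y))\<^sup>2 \<le> (nrm x + nrm y)\<^sup>2" .
qed simp

lemma nrm_triangle_diff:
  "x \<in> X \<Longrightarrow> y \<in> X \<Longrightarrow> z \<in> X \<Longrightarrow> nrm (x - z) \<le> nrm (x - y) + nrm (y - z)"
  using nrm_triangle[of "x - y" "y - z"] by simp

lemma nrm_le_add: "x \<in> X \<Longrightarrow> y \<in> X \<Longrightarrow> nrm x \<le> nrm y + nrm (x - y)"
  using nrm_triangle[of y "x - y"] by simp

lemma nrm_diff_le: "x \<in> X \<Longrightarrow> y \<in> X \<Longrightarrow> \<bar>nrm x - nrm y\<bar> \<le> nrm (x - y)"
  using nrm_le_add[of x y] nrm_le_add[of y x] nrm_diff_commute[of x y] by simp

lemma nrm_cong: "x \<in> X \<Longrightarrow> y \<in> X \<Longrightarrow> nrm (x - y) = 0 \<Longrightarrow> nrm x = nrm y"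
  using nrm_diff_le[of x y] by simp

lemma ip_cong:
  assumes [simp]: "x \<in> X" "y \<in> X" "z \<in> X" and "nrm (x - y) = 0"
  shows "ip x z = ip y z"
  using cauchy_schwarz[of "x - y" z] assms(4) by (simp add: ip_lin)

lemma parallelogram:
  "x \<in> X \<Longrightarrow> y \<in> X \<Longrightarrow> (nrm (x - y))\<^sup>2 = 2 * (nrm x)\<^sup>2 + 2 * (nrm y)\<^sup>2 - (nrm (x + y))\<^sup>2"
  by (simp add: nrm_sq ip_lin ip_commute[of y x])

lemma nrm_add_scale:
  "u \<in> X \<Longrightarrow> v \<in> X \<Longrightarrow> (nrm (u + s *\<^sub>R v))\<^sup>2 = (nrm u)\<^sup>2 + 2 * s * ip u v + s\<^sup>2 * (nrm v)\<^sup>2"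
  by (simp add: nrm_sq ip_lin ip_commute[of v u]) (simp add: power2_eq_square algebra_simps)

lemma tendsto_nrm:
  assumes [simp]: "l \<in> X" and "\<forall>\<^sub>F n in F. f n \<in> X" and lim: "((\<lambda>n. nrm (f n - l)) \<longlongrightarrow> 0) F"
  shows "((\<lambda>n. nrm (f n)) \<longlongrightarrow> nrm l) F"
proof -
  have "((\<lambda>n. nrm (f n) - nrm l) \<longlongrightarrow> 0) F"
    by (rule Lim_null_comparison[OF _ lim])
       (use assms(2) in eventually_elim, simp add: nrm_diff_le)
  then show ?thesis by (simp add: LIM_zero_iff)
qed

lemma tendsto_ip:
  assumes [simp]: "l \<in> X" "z \<in> X" and "\<forall>\<^sub>F n in F. f n \<in> X"
    and lim: "((\<lambda>n. nrm (f n - l)) \<longlongrightarrow> 0) F"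
  shows "((\<lambda>n. ip (f n) z) \<longlongrightarrow> ip l z) F"
proof -
  have "((\<lambda>n. ip (f n) z - ip l z) \<longlongrightarrow> 0) F"
  proof (rule Lim_null_comparison)
    show "((\<lambda>n. nrm (f n - l) * nrm z) \<longlongrightarrow> 0) F"
      using tendsto_mult_right[OF lim, of "nrm z"] by (simp add: mult.commute)
    show "\<forall>\<^sub>F n in F. norm (ip (f n) z - ip l z) \<le> nrm (f n - l) * nrm z"
      using assms(3)
    proof eventually_elim
      case (elim n)
      then show ?case using cauchy_schwarz[of "f n - l" z] by (simp add: ip_lin)
    qed
  qed
  then show ?thesis by (simp add: LIM_zero_iff)
qed

lemma nrm_complete:
  assumes [simp]: "\<And>n. f n \<in> X"
    and "\<And>e. 0 < e \<Longrightarrow> \<exists>N. \<forall>m\<ge>N. \<forall>n\<ge>N. (nrm (f m - f n))\<^sup>2 < e"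
  obtains l where "l \<in> X" "(\<lambda>n. nrm (f n - l)) \<longlonglongrightarrow> 0"
proof -
  obtain l where l: "l \<in> X" "(\<lambda>n. ip (f n - l) (f n - l)) \<longlonglongrightarrow> 0"
    using complete[of f] assms by (auto simp: nrm_sq)
  have "(\<lambda>n. nrm (f n - l)) \<longlonglongrightarrow> 0"
    using tendsto_real_sqrt[OF l(2)] by (simp add: nrm_def)
  with l(1) that show ?thesis by blast
qed

end

section \<open>Contraction semigroups with precompact graph ball\<close>

text \<open>Every law of the semigroup is stated as a vanishing norm, because the operators act on
  representatives. \<open>gen\<close> characterises domain and value of the generator at once, so
  linearity, invariance and closedness of \<open>A\<close> are all derived from difference
  quotients.\<close>

locale compact_contraction_semigroup = semi_hilbert X ip
  for X :: "'a::real_vector set" and ip :: "'a \<Rightarrow> 'a \<Rightarrow> real" +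
  fixes T :: "real \<Rightarrow> 'a \<Rightarrow> 'a" and D :: "'a set" and A :: "'a \<Rightarrow> 'a"
  assumes T_in [simp]: "0 \<le> t \<Longrightarrow> x \<in> X \<Longrightarrow> T t x \<in> X"
    and T_lin: "0 \<le> t \<Longrightarrow> x \<in> X \<Longrightarrow> y \<in> X \<Longrightarrow>
      nrm (T t (c *\<^sub>R x + d *\<^sub>R y) - (c *\<^sub>R T t x + d *\<^sub>R T t y)) = 0"
    and T_contr: "0 \<le> t \<Longrightarrow> x \<in> X \<Longrightarrow> nrm (T t x) \<le> nrm x"
    and T_zero: "x \<in> X \<Longrightarrow> nrm (T 0 x - x) = 0"
    and T_plus: "0 \<le> s \<Longrightarrow> 0 \<le> t \<Longrightarrow> x \<in> X \<Longrightarrow> nrm (T (s + t) x - T s (T t x)) = 0"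
    and D_in [simp]: "x \<in> D \<Longrightarrow> x \<in> X"
    and A_in [simp]: "x \<in> D \<Longrightarrow> A x \<in> X"
    and gen: "x \<in> X \<Longrightarrow> y \<in> X \<Longrightarrow> x \<in> D \<and> nrm (A x - y) = 0 \<longleftrightarrow>
      ((\<lambda>t. nrm ((1 / t) *\<^sub>R (T t x - x) - y)) \<longlongrightarrow> 0) (at_right 0)"
    and compact: "(\<And>n::nat. f n \<in> D) \<Longrightarrow> (\<And>n. nrm (f n) \<le> C) \<Longrightarrow> (\<And>n. nrm (A (f n)) \<le> C) \<Longrightarrow>
      \<exists>l\<in>X. \<exists>r. strict_mono r \<and> (\<lambda>n::nat. nrm (f (r n) - l)) \<longlonglongrightarrow> 0"
begin

definition quot :: "real \<Rightarrow> 'a \<Rightarrow> 'a" where "quot t x = (1 / t) *\<^sub>R (T t x - x)"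

lemma quot_in [simp]: "0 \<le> t \<Longrightarrow> x \<in> X \<Longrightarrow> quot t x \<in> X"
  by (simp add: quot_def)

lemma genI: "x \<in> X \<Longrightarrow> y \<in> X \<Longrightarrow> ((\<lambda>t. nrm (quot t x - y)) \<longlongrightarrow> 0) (at_right 0) \<Longrightarrow>
    x \<in> D \<and> nrm (A x - y) = 0"
  using gen[of x y] by (simp add: quot_def)

lemma genD: "x \<in> D \<Longrightarrow> ((\<lambda>t. nrm (quot t x - A x)) \<longlongrightarrow> 0) (at_right 0)"
  using gen[of x "A x"] by (simp add: quot_def)

lemma T_diff: "0 \<le> t \<Longrightarrow> x \<in> X \<Longrightarrow> y \<in> X \<Longrightarrow> nrm (T t (x - y) - (T t x - T t y)) = 0"
  using T_lin[of t x y 1 "-1"] by simp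

lemma T_scale: "0 \<le> t \<Longrightarrow> x \<in> X \<Longrightarrow> nrm (T t (c *\<^sub>R x) - c *\<^sub>R T t x) = 0"
  using T_lin[of t x x c 0] by simp

lemma T_lipschitz:
  assumes "0 \<le> t" "x \<in> X" "y \<in> X"
  shows "nrm (T t x - T t y) \<le> nrm (x - y)"
  using nrm_cong[OF _ _ T_diff[of t x y]] T_contr[of t "x - y"] assms by simp

lemma nrm_T_plus: "0 \<le> s \<Longrightarrow> 0 \<le> t \<Longrightarrow> x \<in> X \<Longrightarrow> nrm (T (s + t) x) = nrm (T s (T t x))"
  by (rule nrm_cong) (simp_all add: T_plus)

lemma T_antimono:
  assumes "0 \<le> s" "s \<le> t" "x \<in> X"
  shows "nrm (T t x) \<le> nrm (T s x)"
  using nrm_T_plus[of "t - s" s x] T_contr[of "t - s" "T s x"] assms by simp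

text \<open>Linearity of \<open>A\<close> is read off \<open>gen\<close>: up to a null vector, the
  difference quotient of the combination is the combination of the difference quotients.\<close>

lemma D_lin:
  assumes x [simp]: "x \<in> D" and y [simp]: "y \<in> D"
  shows "c *\<^sub>R x + d *\<^sub>R y \<in> D \<and> nrm (A (c *\<^sub>R x + d *\<^sub>R y) - (c *\<^sub>R A x + d *\<^sub>R A y)) = 0"
proof (rule genI)
  show "((\<lambda>t. nrm (quot t (c *\<^sub>R x + d *\<^sub>R y) - (c *\<^sub>R A x + d *\<^sub>R A y))) \<longlongrightarrow> 0) (at_right 0)"
  proof (rule Lim_null_comparison)
    show "((\<lambda>t. \<bar>c\<bar> * nrm (quot t x - A x) + \<bar>d\<bar> * nrm (quot t y - A y)) \<longlongrightarrow> 0) (at_right 0)"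
      using tendsto_add[OF tendsto_mult_left[OF genD[OF x], of "\<bar>c\<bar>"]
          tendsto_mult_left[OF genD[OF y], of "\<bar>d\<bar>"]] by simp
    show "\<forall>\<^sub>F t in at_right 0. norm (nrm (quot t (c *\<^sub>R x + d *\<^sub>R y) - (c *\<^sub>R A x + d *\<^sub>R A y)))
        \<le> \<bar>c\<bar> * nrm (quot t x - A x) + \<bar>d\<bar> * nrm (quot t y - A y)"
      using eventually_at_right_less[of "0::real"]
    proof eventually_elim
      case (elim t)
      let ?u = "quot t (c *\<^sub>R x + d *\<^sub>R y) - (c *\<^sub>R A x + d *\<^sub>R A y)"
      let ?v = "c *\<^sub>R (quot t x - A x) + d *\<^sub>R (quot t y - A y)"
      have "?u - ?v = (1 / t) *\<^sub>R (T t (c *\<^sub>R x + d *\<^sub>R y) - (c *\<^sub>R T t x + d *\<^sub>R T t y))"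
        by (simp add: quot_def algebra_simps)
      then have "nrm (?u - ?v) = 0"
        using elim by (simp add: nrm_scale T_lin)
      then have "nrm ?u = nrm ?v"
        using elim by (intro nrm_cong) auto
      also have "\<dots> \<le> nrm (c *\<^sub>R (quot t x - A x)) + nrm (d *\<^sub>R (quot t y - A y))"
        using elim by (intro nrm_triangle) auto
      finally show ?case using elim by (simp add: nrm_scale)
    qed
  qed
qed auto

lemma D_add: "x \<in> D \<Longrightarrow> y \<in> D \<Longrightarrow> x + y \<in> D \<and> nrm (A (x + y) - (A x + A y)) = 0"
  using D_lin[of x y 1 1] by simp

lemma D_diff: "x \<in> D \<Longrightarrow> y \<in> D \<Longrightarrow> x - y \<in> D \<and> nrm (A (x - y) - (A x - A y)) = 0"
  using D_lin[of x y 1 "-1"] by simp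

lemma D_scale: "x \<in> D \<Longrightarrow> c *\<^sub>R x \<in> D \<and> nrm (A (c *\<^sub>R x) - c *\<^sub>R A x) = 0"
  using D_lin[of x x c 0] by simp

lemma nrm_A_scale: "x \<in> D \<Longrightarrow> nrm (A (c *\<^sub>R x)) = \<bar>c\<bar> * nrm (A x)"
  using D_scale[of x c] nrm_cong[of "A (c *\<^sub>R x)" "c *\<^sub>R A x"] by (simp add: nrm_scale)

text \<open>Up to null vectors, the difference quotient of \<open>T s x\<close> is the image under
  \<open>T s\<close> of that of \<open>x\<close>, and \<open>T s\<close> does not increase
  distances.\<close>

lemma T_D:
  assumes x [simp]: "x \<in> D" and s [simp]: "0 \<le> s"
  shows "T s x \<in> D \<and> nrm (A (T s x) - T s (A x)) = 0"
proof (rule genI)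
  show "((\<lambda>t. nrm (quot t (T s x) - T s (A x))) \<longlongrightarrow> 0) (at_right 0)"
  proof (rule Lim_null_comparison[OF _ genD[OF x]])
    show "\<forall>\<^sub>F t in at_right 0. norm (nrm (quot t (T s x) - T s (A x))) \<le> nrm (quot t x - A x)"
      using eventually_at_right_less[of "0::real"]
    proof eventually_elim
      case (elim t)
      have 1: "nrm (T t (T s x) - T s (T t x)) = 0"
      proof -
        have "nrm (T t (T s x) - T s (T t x)) \<le> nrm (T t (T s x) - T (t + s) x) + nrm (T (s + t) x - T s (T t x))"
          using elim nrm_triangle_diff[of "T t (T s x)" "T (t + s) x" "T s (T t x)"]
          by (simp add: add.commute)
        also have "\<dots> = 0"
          using elim T_plus[of t s x] T_plus[of s t x] nrm_diff_commute[of "T t (T s x)" "T (t + s) x"] by simp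
        finally show ?thesis using elim by (simp add: antisym)
      qed
      have 2: "nrm (T s (quot t x) - (1 / t) *\<^sub>R (T s (T t x) - T s x)) = 0"
      proof -
        have "nrm (T s (quot t x) - (1 / t) *\<^sub>R (T s (T t x) - T s x)) =
          nrm (T s ((1/t) *\<^sub>R T t x + (- (1/t)) *\<^sub>R x) - ((1/t) *\<^sub>R T s (T t x) + (- (1/t)) *\<^sub>R T s x))"
          by (simp add: quot_def scaleR_diff_right)
        also have "\<dots> = 0" using elim by (intro T_lin) auto
        finally show ?thesis .
      qed
      have "nrm (quot t (T s x) - T s (A x)) \<le> nrm (quot t (T s x) - (1 / t) *\<^sub>R (T s (T t x) - T s x))
          + (nrm ((1 / t) *\<^sub>R (T s (T t x) - T s x) - T s (quot t x)) + nrm (T s (quot t x) - T s (A x)))"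
        using elim nrm_triangle_diff[of "quot t (T s x)" "(1 / t) *\<^sub>R (T s (T t x) - T s x)" "T s (A x)"]
          nrm_triangle_diff[of "(1 / t) *\<^sub>R (T s (T t x) - T s x)" "T s (quot t x)" "T s (A x)"]
        by simp
      also have "quot t (T s x) - (1 / t) *\<^sub>R (T s (T t x) - T s x) = (1 / t) *\<^sub>R (T t (T s x) - T s (T t x))"
        by (simp add: quot_def algebra_simps)
      also have "nrm ((1 / t) *\<^sub>R (T s (T t x) - T s x) - T s (quot t x)) = 0"
        using 2 elim nrm_diff_commute[of "(1 / t) *\<^sub>R (T s (T t x) - T s x)" "T s (quot t x)"] by simp
      finally have "nrm (quot t (T s x) - T s (A x)) \<le> nrm (T s (quot t x) - T s (A x))"
        using 1 elim by (simp add: nrm_scale)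
      also have "\<dots> \<le> nrm (quot t x - A x)"
        using elim by (intro T_lipschitz) auto
      finally show ?case using elim by simp
    qed
  qed
qed auto

lemma nrm_A_T: "x \<in> D \<Longrightarrow> 0 \<le> s \<Longrightarrow> nrm (A (T s x)) = nrm (T s (A x))"
  using T_D[of x s] by (intro nrm_cong) auto

lemma at_right_divide: "0 < t \<Longrightarrow> filterlim (\<lambda>n. t / real (Suc n)) (at_right 0) sequentially"
proof -
  assume "0 < t"
  have "(\<lambda>n. t * (1 / real (Suc n))) \<longlonglongrightarrow> t * 0"
    by (intro tendsto_mult_left LIMSEQ_Suc[OF lim_1_over_n])
  then show ?thesis
    using \<open>0 < t\<close> by (auto simp: filterlim_at)
qed

text \<open>Telescoping replaces the integral formula \<open>T t x - x = \<integral>\<^sub>0\<^sup>t T s (A x) ds\<close>.\<close>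

lemma nrm_T_diff_le:
  assumes x [simp]: "x \<in> D" and t: "0 < t"
  shows "nrm (T t x - x) \<le> t * nrm (A x)"
proof -
  have step: "nrm (T (real n * h) x - x) \<le> real n * nrm (T h x - x)" if [simp]: "0 \<le> h" for h n
  proof (induction n)
    case 0
    then show ?case by (simp add: T_zero)
  next
    case (Suc n)
    let ?m = "real n * h"
    have "nrm (T (real (Suc n) * h) x - x) \<le> nrm (T (?m + h) x - T ?m (T h x)) + nrm (T ?m (T h x) - x)"
      using nrm_triangle_diff[of "T (?m + h) x" "T ?m (T h x)" x] by (simp add: algebra_simps)
    also have "\<dots> = nrm (T ?m (T h x) - x)" by (simp add: T_plus)
    also have "\<dots> \<le> nrm (T ?m (T h x) - T ?m x) + nrm (T ?m x - x)"
      by (intro nrm_triangle_diff) auto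
    also have "\<dots> \<le> nrm (T h x - x) + real n * nrm (T h x - x)"
      using T_lipschitz[of ?m "T h x" x] Suc by simp
    finally show ?case by (simp add: algebra_simps)
  qed
  \<comment> \<open>With steps of length \<open>t / Suc n\<close> the telescoped bound is
    \<open>t\<close> times the norm of one difference quotient, which tends to
    \<open>nrm (A x)\<close>.\<close>
  have le: "nrm (T t x - x) \<le> t * nrm (quot (t / real (Suc n)) x)" for n
    using step[of "t / real (Suc n)" "Suc n"] t by (simp add: quot_def nrm_scale)
  have "((\<lambda>h. nrm (quot h x)) \<longlongrightarrow> nrm (A x)) (at_right 0)"
    using eventually_at_right_less[of "0::real"]
    by (intro tendsto_nrm genD) (auto elim: eventually_mono)
  from filterlim_compose[OF this at_right_divide[OF t]]
  have "(\<lambda>n. t * nrm (quot (t / real (Suc n)) x)) \<longlonglongrightarrow> t * nrm (A x)"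
    by (rule tendsto_mult_left)
  then show ?thesis
    by (rule LIMSEQ_le_const) (use le in blast)
qed

text \<open>Closedness amounts to exchanging the limits of \<open>t\<close> and \<open>n\<close>.
  The estimate \<open>nrm_T_diff_le\<close>, applied to \<open>f m - f n\<close> and passed to the
  limit in \<open>m\<close>, provides the required uniformity.\<close>

lemma A_closed:
  assumes f [simp]: "\<And>n. f n \<in> D" and [simp]: "x \<in> X" "g \<in> X"
    and lim: "(\<lambda>n. nrm (f n - x)) \<longlonglongrightarrow> 0" "(\<lambda>n. nrm (A (f n) - g)) \<longlonglongrightarrow> 0"
  shows "x \<in> D \<and> nrm (A x - g) = 0"
proof (rule genI)
  \<comment> \<open>The right-hand side does not depend on \<open>t\<close>, which is what permits
    the exchange of limits.\<close>
  have est: "nrm (quot t x - quot t (f n)) \<le> nrm (A (f n) - g)" if t: "0 < t" for t n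
  proof -
    have 1: "nrm (T t (f m - f n) - (f m - f n)) \<le> t * nrm (A (f m) - A (f n))" for m
      using nrm_T_diff_le[of "f m - f n" t] D_diff[of "f m" "f n"] t
        nrm_cong[of "A (f m - f n)" "A (f m) - A (f n)"] by simp
    have 2: "nrm (T t (x - f n) - (x - f n)) \<le> t * nrm (A (f m) - A (f n)) + 2 * nrm (f m - x)" for m
    proof -
      have "nrm (T t (x - f n) - (x - f n)) \<le> nrm (T t (f m - f n) - (f m - f n))
          + nrm ((T t (x - f n) - (x - f n)) - (T t (f m - f n) - (f m - f n)))"
        using t by (intro nrm_le_add) auto
      also have "(T t (x - f n) - (x - f n)) - (T t (f m - f n) - (f m - f n))
          = (T t (x - f n) - T t (f m - f n)) + (f m - x)" by simp
      also have "nrm \<dots> \<le> nrm (T t (x - f n) - T t (f m - f n)) + nrm (f m - x)"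
        using t by (intro nrm_triangle) auto
      also have "nrm (T t (x - f n) - T t (f m - f n)) \<le> nrm (x - f m)"
        using T_lipschitz[of t "x - f n" "f m - f n"] t by simp
      also have "nrm (x - f m) = nrm (f m - x)" by (simp add: nrm_diff_commute)
      finally show ?thesis using 1[of m] by simp
    qed
    have "(\<lambda>m. nrm (A (f m) - A (f n))) \<longlonglongrightarrow> nrm (g - A (f n))"
    proof (rule tendsto_nrm)
      show "(\<lambda>m. nrm (A (f m) - A (f n) - (g - A (f n)))) \<longlonglongrightarrow> 0" using lim(2) by simp
    qed auto
    then have "(\<lambda>m. t * nrm (A (f m) - A (f n)) + 2 * nrm (f m - x)) \<longlonglongrightarrow> t * nrm (g - A (f n)) + 2 * 0"
      by (intro tendsto_intros lim)
    then have "nrm (T t (x - f n) - (x - f n)) \<le> t * nrm (g - A (f n)) + 2 * 0"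
      by (rule LIMSEQ_le_const) (use 2 in blast)
    then have 3: "nrm (T t (x - f n) - (x - f n)) \<le> t * nrm (A (f n) - g)"
      by (simp add: nrm_diff_commute)
    have "nrm (T t (x - f n) - (x - f n)) = nrm (T t x - T t (f n) - (x - f n))"
      using t T_diff[of t x "f n"] by (intro nrm_cong) auto
    with 3 have "nrm (T t x - T t (f n) - (x - f n)) \<le> t * nrm (A (f n) - g)" by simp
    moreover have "quot t x - quot t (f n) = (1 / t) *\<^sub>R (T t x - T t (f n) - (x - f n))"
      by (simp add: quot_def algebra_simps)
    ultimately show ?thesis using t by (simp add: nrm_scale pos_divide_le_eq mult.commute)
  qed
  show "((\<lambda>t. nrm (quot t x - g)) \<longlongrightarrow> 0) (at_right 0)"
  proof (rule tendstoI)
    fix e :: real assume e: "0 < e"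
    have "\<forall>\<^sub>F n in sequentially. nrm (A (f n) - g) < e / 4"
      using order_tendstoD(2)[OF lim(2), of "e / 4"] e by simp
    then obtain n where n: "nrm (A (f n) - g) < e / 4"
      using eventually_happens by force
    have "\<forall>\<^sub>F t in at_right 0. nrm (quot t (f n) - A (f n)) < e / 4"
      using order_tendstoD(2)[OF genD[OF f[of n]], of "e / 4"] e by simp
    then show "\<forall>\<^sub>F t in at_right 0. dist (nrm (quot t x - g)) 0 < e"
      using eventually_at_right_less[of "0::real"]
    proof eventually_elim
      case (elim t)
      then have "nrm (quot t x - g) \<le> nrm (quot t x - quot t (f n)) + (nrm (quot t (f n) - A (f n)) + nrm (A (f n) - g))"
        using nrm_triangle_diff[of "quot t x" "quot t (f n)" g]
          nrm_triangle_diff[of "quot t (f n)" "A (f n)" g] by simp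
      then show ?case using elim n est[of t n] e by simp
    qed
  qed
qed auto

end

context compact_contraction_semigroup
begin

text \<open>Among the elements of \<open>D\<close> near \<open>y\<close> pick ones whose images under \<open>A\<close> have almost minimal norm:
  by the parallelogram law these images form a Cauchy sequence. This replaces weak compactness.\<close>

lemma D_bounded_limit:
  assumes y [simp]: "y \<in> X" and ex: "\<And>e. 0 < e \<Longrightarrow> \<exists>z\<in>D. nrm (z - y) < e \<and> nrm (A z) \<le> C"
  shows "y \<in> D \<and> nrm (A y) \<le> C"
proof -
  \<comment> \<open>The sets \<open>K n\<close> shrink towards \<open>y\<close>, so the infima
    \<open>d n\<close> increase; they stay below \<open>C\<close> and converge to some
    \<open>L\<close>, the norm that a weak limit of least norm would have.\<close>
  define K where "K n = {z \<in> D. nrm (z - y) \<le> 1 / real (Suc n)}" for n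
  define d where "d n = Inf ((\<lambda>z. nrm (A z)) ` K n)" for n
  have K_ne: "\<exists>z\<in>K n. nrm (A z) \<le> C" for n
    using ex[of "1 / real (Suc n)"] unfolding K_def by force
  have bdd: "bdd_below ((\<lambda>z. nrm (A z)) ` K n)" for n
    by (rule bdd_belowI[of _ 0]) (auto simp: K_def)
  have d_le: "d n \<le> nrm (A z)" if "z \<in> K n" for n z
    unfolding d_def using that bdd by (intro cInf_lower) auto
  have d0: "0 \<le> d n" for n
    unfolding d_def using K_ne[of n] by (intro cInf_greatest) (auto simp: K_def)
  have dC: "d n \<le> C" for n
    using K_ne[of n] d_le by force
  have K_mono: "K n \<subseteq> K m" if "m \<le> n" for m n
    using that by (auto simp: K_def elim!: order_trans intro!: frac_le)
  have d_mono: "d m \<le> d n" if "m \<le> n" for m n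
    unfolding d_def using K_ne[of n] K_mono[OF that] bdd by (intro cInf_superset_mono) auto
  have conv: "convergent d"
    using d_mono dC d0 by (intro Bseq_monoseq_convergent BseqI'[of _ C]) (auto simp: monoseq_def)
  then obtain L where L: "d \<longlonglongrightarrow> L" by (auto simp: convergent_def)
  have dL: "d n \<le> L" for n
    using L by (rule incseq_le[rotated]) (auto simp: incseq_def d_mono)
  have "\<exists>z\<in>K n. nrm (A z) < d n + 1 / real (Suc n)" for n
    using cInf_lessD[of "(\<lambda>z. nrm (A z)) ` K n" "d n + 1 / real (Suc n)"] K_ne[of n]
    by (auto simp: d_def)
  then obtain z where zK: "\<And>n. z n \<in> K n" and zlt: "\<And>n. nrm (A (z n)) < d n + 1 / real (Suc n)"
    by metis
  have zD [simp]: "z n \<in> D" for n using zK[of n] by (simp add: K_def)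
  have ub: "nrm (A (z n)) \<le> L + 1 / real (Suc N)" if "N \<le> n" for n N
  proof -
    have "1 / real (Suc n) \<le> 1 / real (Suc N)" using that by (simp add: frac_le)
    then show ?thesis using zlt[of n] dL[of n] by linarith
  qed
  \<comment> \<open>By convexity the midpoint of \<open>z m\<close> and \<open>z n\<close> stays in
    \<open>K N\<close>, so its image under \<open>A\<close> has norm at least \<open>d N\<close>.
    The parallelogram law then bounds the difference of the two images by a quantity that tends to
    0.\<close>
  have est: "(nrm (A (z m) - A (z n)))\<^sup>2 \<le> 4 * (L + 1 / real (Suc N))\<^sup>2 - 4 * (d N)\<^sup>2"
    if mn: "N \<le> m" "N \<le> n" for m n N
  proof -
    have mid: "(1/2) *\<^sub>R z m + (1/2) *\<^sub>R z n \<in> D"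
      and A_mid: "nrm (A ((1/2) *\<^sub>R z m + (1/2) *\<^sub>R z n) - ((1/2) *\<^sub>R A (z m) + (1/2) *\<^sub>R A (z n))) = 0"
      using D_lin[of "z m" "z n" "1/2" "1/2"] by simp_all
    have "(1/2) *\<^sub>R z m + (1/2) *\<^sub>R z n - y = (1/2) *\<^sub>R (z m - y) + (1/2) *\<^sub>R (z n - y)"
      by (simp add: algebra_simps flip: scaleR_add_left)
    then have "nrm ((1/2) *\<^sub>R z m + (1/2) *\<^sub>R z n - y) \<le> (1/2) * nrm (z m - y) + (1/2) * nrm (z n - y)"
      using nrm_triangle[of "(1/2) *\<^sub>R (z m - y)" "(1/2) *\<^sub>R (z n - y)"] by (simp add: nrm_scale)
    also have "\<dots> \<le> 1 / real (Suc N)"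
      using subsetD[OF K_mono[OF mn(1)] zK[of m]] subsetD[OF K_mono[OF mn(2)] zK[of n]]
      by (simp add: K_def)
    finally have "(1/2) *\<^sub>R z m + (1/2) *\<^sub>R z n \<in> K N" using mid by (simp add: K_def)
    then have "d N \<le> nrm (A ((1/2) *\<^sub>R z m + (1/2) *\<^sub>R z n))" by (rule d_le)
    also have "\<dots> = nrm ((1/2) *\<^sub>R A (z m) + (1/2) *\<^sub>R A (z n))"
      using A_mid mid by (intro nrm_cong) auto
    also have "\<dots> = (1/2) * nrm (A (z m) + A (z n))"
      using nrm_scale[of "A (z m) + A (z n)" "1/2"] by (simp add: scaleR_add_right)
    finally have "(2 * d N)\<^sup>2 \<le> (nrm (A (z m) + A (z n)))\<^sup>2"
      using d0[of N] by (intro power_mono) auto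
    moreover have "(nrm (A (z m)))\<^sup>2 \<le> (L + 1 / real (Suc N))\<^sup>2" "(nrm (A (z n)))\<^sup>2 \<le> (L + 1 / real (Suc N))\<^sup>2"
      using ub mn by (auto intro!: power_mono)
    ultimately show ?thesis
      using parallelogram[of "A (z m)" "A (z n)"] by (simp add: power_mult_distrib)
  qed
  have "(\<lambda>N. 4 * (L + 1 / real (Suc N))\<^sup>2 - 4 * (d N)\<^sup>2) \<longlonglongrightarrow> 4 * (L + 0)\<^sup>2 - 4 * L\<^sup>2"
    by (intro tendsto_intros L LIMSEQ_Suc[OF lim_1_over_n])
  then have small: "(\<lambda>N. 4 * (L + 1 / real (Suc N))\<^sup>2 - 4 * (d N)\<^sup>2) \<longlonglongrightarrow> 0" by simp
  obtain g where g: "g \<in> X" "(\<lambda>n. nrm (A (z n) - g)) \<longlonglongrightarrow> 0"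
  proof (rule nrm_complete[of "\<lambda>n. A (z n)"])
    fix e :: real assume "0 < e"
    then obtain N where "4 * (L + 1 / real (Suc N))\<^sup>2 - 4 * (d N)\<^sup>2 < e"
      using eventually_happens[OF order_tendstoD(2)[OF small]] by auto
    then show "\<exists>N. \<forall>m\<ge>N. \<forall>n\<ge>N. (nrm (A (z m) - A (z n)))\<^sup>2 < e"
      using est by (meson le_less_trans)
  qed auto
  have lim: "(\<lambda>n. nrm (z n - y)) \<longlonglongrightarrow> 0"
  proof (rule Lim_null_comparison[OF _ LIMSEQ_Suc[OF lim_1_over_n]])
    show "\<forall>\<^sub>F n in sequentially. norm (nrm (z n - y)) \<le> 1 / real (Suc n)"
      using zK by (auto simp: K_def)
  qed
  have yD: "y \<in> D" and Ay: "nrm (A y - g) = 0"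
    using A_closed[OF zD y g(1) lim g(2)] by auto
  have "(\<lambda>n. nrm (A (z n))) \<longlonglongrightarrow> nrm g"
    using g by (intro tendsto_nrm) auto
  moreover have "(\<lambda>n. C + 1 / real (Suc n)) \<longlonglongrightarrow> C + 0"
    by (intro tendsto_intros LIMSEQ_Suc[OF lim_1_over_n])
  moreover have "nrm (A (z n)) \<le> C + 1 / real (Suc n)" for n
    using zlt[of n] dC[of n] by simp
  ultimately have "nrm g \<le> C" by (intro LIMSEQ_le[of "\<lambda>n. nrm (A (z n))"]) auto
  then show ?thesis using yD Ay nrm_cong[of "A y" g] g(1) by simp
qed

section \<open>The subspace on which the semigroup is isometric\<close>

definition V :: "'a set" where "V = {y \<in> X. \<forall>t\<ge>0. nrm (T t y) = nrm y}"

lemma V_I: "y \<in> X \<Longrightarrow> (\<And>t. 0 \<le> t \<Longrightarrow> nrm (T t y) = nrm y) \<Longrightarrow> y \<in> V"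
  by (simp add: V_def)

lemma V_isometric: "y \<in> V \<Longrightarrow> 0 \<le> t \<Longrightarrow> nrm (T t y) = nrm y"
  by (simp add: V_def)

lemma V_in [simp]: "y \<in> V \<Longrightarrow> y \<in> X"
  by (simp add: V_def)

text \<open>The loss of squared norm under \<open>T t\<close> is a nonnegative quadratic form that
  vanishes at \<open>y\<close>, so its polar form vanishes against every \<open>z\<close>, also
  outside \<open>V\<close>. This is what makes \<open>V\<close> linear, although its defining
  condition is quadratic.\<close>

lemma V_ip:
  assumes y: "y \<in> V" and z [simp]: "z \<in> X" and t [simp]: "0 \<le> t"
  shows "ip (T t y) (T t z) = ip y z"
proof -
  have [simp]: "y \<in> X" using y by simp
  have "0 \<le> 2 * s * (ip y z - ip (T t y) (T t z)) + s\<^sup>2 * (ip z z - ip (T t z) (T t z))" for s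
  proof -
    have "nrm (T t (y + s *\<^sub>R z)) = nrm (T t y + s *\<^sub>R T t z)"
      using T_lin[of t y z 1 s] by (intro nrm_cong) auto
    then have "(nrm (T t y + s *\<^sub>R T t z))\<^sup>2 \<le> (nrm (y + s *\<^sub>R z))\<^sup>2"
      using T_contr[of t "y + s *\<^sub>R z"] by (intro power_mono) auto
    moreover have "nrm (T t y) = nrm y" using y by (simp add: V_isometric)
    ultimately show ?thesis by (simp add: nrm_add_scale algebra_simps flip: nrm_sq)
  qed
  from quadratic_nonneg_imp_linear_coeff_zero[OF this] show ?thesis by simp
qed

lemma V_lin:
  assumes y: "y \<in> V" and z: "z \<in> V"
  shows "c *\<^sub>R y + d *\<^sub>R z \<in> V"
proof -
  have "nrm (T t (c *\<^sub>R y + d *\<^sub>R z)) = nrm (c *\<^sub>R y + d *\<^sub>R z)" if [simp]: "0 \<le> t" for t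
  proof -
    have [simp]: "y \<in> X" "z \<in> X" using y z by auto
    have "nrm (T t (c *\<^sub>R y + d *\<^sub>R z)) = nrm (c *\<^sub>R T t y + d *\<^sub>R T t z)"
      using T_lin[of t y z c d] by (intro nrm_cong) auto
    also have "\<dots> = nrm (c *\<^sub>R y + d *\<^sub>R z)"
      using V_ip[OF y, of y t] V_ip[OF y, of z t] V_ip[OF z, of y t] V_ip[OF z, of z t]
      by (simp add: nrm_def ip_lin)
    finally show ?thesis .
  qed
  then show ?thesis using y z by (intro V_I) auto
qed

lemma V_scale: "y \<in> V \<Longrightarrow> c *\<^sub>R y \<in> V"
  using V_lin[of y y c 0] by simp

text \<open>The filter is kept general because the lemma serves sequences as well as difference
  quotients for \<open>t\<close> tending to 0 from the right.\<close>

lemma V_limit: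
  assumes f: "\<forall>\<^sub>F n in F. f n \<in> V" and [simp]: "l \<in> X" and lim: "((\<lambda>n. nrm (f n - l)) \<longlongrightarrow> 0) F"
    and F: "F \<noteq> bot"
  shows "l \<in> V"
proof -
  have "nrm (T t l) = nrm l" if [simp]: "0 \<le> t" for t
  proof (rule tendsto_unique[OF F])
    show "((\<lambda>n. nrm (f n)) \<longlongrightarrow> nrm l) F"
      using f lim by (intro tendsto_nrm) (auto elim: eventually_mono)
    have "((\<lambda>n. nrm (T t (f n))) \<longlongrightarrow> nrm (T t l)) F"
    proof (rule tendsto_nrm)
      show "((\<lambda>n. nrm (T t (f n) - T t l)) \<longlongrightarrow> 0) F"
        using f by (intro Lim_null_comparison[OF _ lim]) (auto elim!: eventually_mono simp: T_lipschitz)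
    qed (use f in \<open>auto elim: eventually_mono\<close>)
    then show "((\<lambda>n. nrm (f n)) \<longlongrightarrow> nrm (T t l)) F"
      by (rule Lim_transform_eventually) (use f in \<open>auto elim!: eventually_mono simp: V_isometric\<close>)
  qed
  then show ?thesis by (intro V_I) auto
qed

lemma V_T:
  assumes "y \<in> V" "0 \<le> s"
  shows "T s y \<in> V"
proof -
  have "nrm (T t (T s y)) = nrm (T s y)" if "0 \<le> t" for t
    using nrm_T_plus[of t s y] V_isometric[of y "t + s"] assms that by (simp add: V_isometric)
  then show ?thesis using assms by (intro V_I) auto
qed

lemma V_quot:
  assumes "y \<in> V" "0 \<le> t"
  shows "quot t y \<in> V"
  using V_lin[OF V_T[OF assms] assms(1), of "1/t" "- (1/t)"] by (simp add: quot_def scaleR_diff_right)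

lemma V_A:
  assumes "y \<in> V" "y \<in> D"
  shows "A y \<in> V"
proof (rule V_limit[OF _ _ genD])
  show "\<forall>\<^sub>F t in at_right 0. quot t y \<in> V"
    using eventually_at_right_less[of "0::real"] by eventually_elim (simp add: V_quot assms)
qed (use assms in auto)

text \<open>Expand the squared norm of \<open>T t y = y + t *\<^sub>R quot t y\<close>, which equals
  that of \<open>y\<close>, divide by \<open>t\<close> and let \<open>t\<close> tend to 0.\<close>

lemma V_ip_A_self:
  assumes y: "y \<in> V" "y \<in> D"
  shows "ip (A y) y = 0"
proof -
  have [simp]: "y \<in> X" using y by simp
  have lim: "((\<lambda>t. 2 * ip (quot t y) y + t * (nrm (quot t y))\<^sup>2) \<longlongrightarrow> 2 * ip (A y) y + 0 * (nrm (A y))\<^sup>2) (at_right 0)"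
    by (intro tendsto_intros tendsto_ip tendsto_nrm genD y)
       (use y in \<open>auto intro: eventually_mono[OF eventually_at_right_less]\<close>)
  have "\<forall>\<^sub>F t in at_right 0. 2 * ip (quot t y) y + t * (nrm (quot t y))\<^sup>2 = 0"
    using eventually_at_right_less[of "0::real"]
  proof eventually_elim
    case (elim t)
    have eq: "T t y = y + t *\<^sub>R quot t y" using elim by (simp add: quot_def)
    have "(nrm (T t y))\<^sup>2 = (nrm y)\<^sup>2" using y elim by (simp add: V_isometric)
    then have "2 * t * ip (quot t y) y + t\<^sup>2 * (nrm (quot t y))\<^sup>2 = 0"
      using elim unfolding eq by (simp add: nrm_add_scale ip_commute[of y])
    then have "t * (2 * ip (quot t y) y + t * (nrm (quot t y))\<^sup>2) = 0"
      by algebra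
    then show ?case using elim by (metis less_irrefl mult_eq_0_iff)
  qed
  then have "((\<lambda>t. 2 * ip (quot t y) y + t * (nrm (quot t y))\<^sup>2) \<longlongrightarrow> 0) (at_right 0)"
    by (rule tendsto_eventually)
  from tendsto_unique[OF _ lim this] show ?thesis by simp
qed

text \<open>Polarisation of \<open>V_ip_A_self\<close>, applied to \<open>y + z\<close>.\<close>

lemma V_skew:
  assumes y: "y \<in> V" "y \<in> D" and z: "z \<in> V" "z \<in> D"
  shows "ip (A y) z = - ip y (A z)"
proof -
  have [simp]: "y \<in> X" "z \<in> X" using y z by auto
  have s: "y + z \<in> V" "y + z \<in> D"
    using V_lin[OF y(1) z(1), of 1 1] D_add[OF y(2) z(2)] by auto
  have "ip (A y + A z) (y + z) = ip (A (y + z)) (y + z)"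
    using D_add[OF y(2) z(2)] y z s by (intro ip_cong[symmetric]) auto
  then show ?thesis
    using V_ip_A_self[OF s] V_ip_A_self[OF y] V_ip_A_self[OF z] y z
    by (simp add: ip_lin ip_commute[of y])
qed

text \<open>The norm along the orbit decreases to a constant \<open>c\<close>, positive by
  assumption. A time shift does not change \<open>c\<close>, so a limit point \<open>l\<close> of
  the orbit satisfies \<open>nrm (T s l) = c\<close> for all \<open>s\<close>. It lies in
  \<open>D\<close> because \<open>nrm (A (T t x))\<close> stays bounded.\<close>

lemma exists_V_D:
  assumes x: "x \<in> D" and not: "\<not> ((\<lambda>t. nrm (T t x)) \<longlongrightarrow> 0) at_top"
  obtains y where "y \<in> V" "y \<in> D" "nrm y \<noteq> 0"
proof -
  have [simp]: "x \<in> X" using x by simp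
  define c where "c = (INF n. nrm (T (real n) x))"
  have bdd: "bdd_below (range (\<lambda>n. nrm (T (real n) x)))"
    by (rule bdd_belowI[of _ 0]) auto
  have dec: "decseq (\<lambda>n. nrm (T (real n) x))"
    by (auto simp: decseq_def intro: T_antimono)
  have lim: "(\<lambda>n. nrm (T (real n) x)) \<longlonglongrightarrow> c"
    unfolding c_def by (rule LIMSEQ_decseq_INF[OF bdd dec])
  have c_le: "c \<le> nrm (T t x)" if "0 \<le> t" for t
  proof -
    have "c \<le> nrm (T (real (nat \<lceil>t\<rceil>)) x)" unfolding c_def by (rule cINF_lower[OF bdd]) simp
    also have "\<dots> \<le> nrm (T t x)" using that by (intro T_antimono) (simp_all add: real_nat_ceiling_ge)
    finally show ?thesis .
  qed
  have c_ne: "c \<noteq> 0"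
  proof
    assume c: "c = 0"
    have "((\<lambda>t. nrm (T t x)) \<longlongrightarrow> 0) at_top"
    proof (rule tendstoI)
      fix e :: real assume "0 < e"
      then obtain n where n: "nrm (T (real n) x) < e"
        using eventually_happens[OF order_tendstoD(2)[OF lim]] c by auto
      show "\<forall>\<^sub>F t in at_top. dist (nrm (T t x)) 0 < e"
        using eventually_ge_at_top[of "real n"]
      proof eventually_elim
        case (elim t)
        then show ?case using T_antimono[of "real n" t x] n by simp
      qed
    qed
    with not show False by blast
  qed
  let ?C = "max (nrm x) (nrm (A x))"
  have fD: "T (real n) x \<in> D" for n using T_D[OF x, of "real n"] by simp
  have fA: "nrm (A (T (real n) x)) \<le> nrm (A x)" for n
    using T_contr[of "real n" "A x"] x by (simp add: nrm_A_T)
  obtain l r where l: "l \<in> X" "strict_mono r" "(\<lambda>n. nrm (T (real (r n)) x - l)) \<longlonglongrightarrow> 0"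
    using compact[of "\<lambda>n. T (real n) x" ?C] fD fA T_contr[of _ x]
    by (auto simp: le_max_iff_disj)
  \<comment> \<open>Squeezed between \<open>c\<close>, a lower bound for the whole orbit, and the
    unshifted norms, which tend to \<open>c\<close>.\<close>
  have shift: "(\<lambda>n. nrm (T s (T (real (r n)) x))) \<longlonglongrightarrow> c" if "0 \<le> s" for s
  proof (rule tendsto_sandwich[where f = "\<lambda>n. c" and h = "\<lambda>n. nrm (T (real (r n)) x)"])
    show "(\<lambda>n. nrm (T (real (r n)) x)) \<longlonglongrightarrow> c"
      using LIMSEQ_subseq_LIMSEQ[OF lim l(2)] by (simp add: o_def)
    show "(\<lambda>n. c) \<longlonglongrightarrow> c" by simp
    have "c \<le> nrm (T s (T (real (r n)) x))" for n
      using nrm_T_plus[OF that, of "real (r n)" x] c_le[of "s + real (r n)"] that by simp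
    then show "\<forall>\<^sub>F n in sequentially. c \<le> nrm (T s (T (real (r n)) x))" by simp
    show "\<forall>\<^sub>F n in sequentially. nrm (T s (T (real (r n)) x)) \<le> nrm (T (real (r n)) x)"
      using that by (simp add: T_contr)
  qed
  have nT: "nrm (T s l) = c" if "0 \<le> s" for s
  proof (rule LIMSEQ_unique[OF _ shift[OF that]])
    show "(\<lambda>n. nrm (T s (T (real (r n)) x))) \<longlonglongrightarrow> nrm (T s l)"
    proof (rule tendsto_nrm)
      show "(\<lambda>n. nrm (T s (T (real (r n)) x) - T s l)) \<longlonglongrightarrow> 0"
        using that l(1) fD by (intro Lim_null_comparison[OF _ l(3)]) (simp add: T_lipschitz)
    qed (use that l in auto)
  qed
  have nl: "nrm l = c"
  proof (rule LIMSEQ_unique)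
    show "(\<lambda>n. nrm (T (real (r n)) x)) \<longlonglongrightarrow> nrm l"
      using l by (intro tendsto_nrm) auto
    show "(\<lambda>n. nrm (T (real (r n)) x)) \<longlonglongrightarrow> c"
      using LIMSEQ_subseq_LIMSEQ[OF lim l(2)] by (simp add: o_def)
  qed
  have "l \<in> V" using nT nl l(1) by (intro V_I) auto
  moreover have "l \<in> D"
  proof -
    have "\<exists>z\<in>D. nrm (z - l) < e \<and> nrm (A z) \<le> nrm (A x)" if "0 < e" for e
      using eventually_happens[OF order_tendstoD(2)[OF l(3) that]] fD fA by auto
    with D_bounded_limit[OF l(1)] show ?thesis by blast
  qed
  ultimately show ?thesis using that nl c_ne by blast
qed

text \<open>A minimiser of \<open>nrm (A y) / nrm y\<close> on \<open>V \<inter> D\<close>; the minimisers form an \<open>A\<close>-invariant space on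
  which the skew-symmetric \<open>A\<close> satisfies \<open>A\<^sup>2 = - m\<^sup>2\<close>.\<close>

lemma exists_A_sq:
  assumes y0: "y0 \<in> V" "y0 \<in> D" "nrm y0 \<noteq> 0"
  obtains y m where "y \<in> D" "A y \<in> D" "nrm y \<noteq> 0" "nrm (A (A y) + m\<^sup>2 *\<^sub>R y) = 0"
proof -
  define K where "K = {y \<in> V \<inter> D. nrm y = 1}"
  define m where "m = (INF y\<in>K. nrm (A y))"
  have bdd: "bdd_below ((\<lambda>z. nrm (A z)) ` K)"
    by (rule bdd_belowI[of _ 0]) (auto simp: K_def)
  have norml: "(1 / nrm y) *\<^sub>R y \<in> K" if "y \<in> V" "y \<in> D" "nrm y \<noteq> 0" for y
    using that V_scale D_scale by (simp add: K_def nrm_scale)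
  have K_ne: "K \<noteq> {}" using norml[OF y0] by auto
  have m0: "0 \<le> m" unfolding m_def by (rule cINF_greatest[OF K_ne]) (simp add: K_def)
  have m_le: "m * nrm y \<le> nrm (A y)" if "y \<in> V" "y \<in> D" for y
  proof (cases "nrm y = 0")
    case False
    have "m \<le> nrm (A ((1 / nrm y) *\<^sub>R y))"
      unfolding m_def by (rule cINF_lower[OF bdd norml[OF that False]])
    moreover have "0 < nrm y" using False that nrm_ge0[of y] by (simp add: order_less_le del: nrm_ge0)
    ultimately show ?thesis using that by (simp add: nrm_A_scale field_simps)
  qed (use that in simp)
  have "\<exists>z\<in>K. nrm (A z) < m + 1 / real (Suc n)" for n
    using cInf_lessD[of "(\<lambda>z. nrm (A z)) ` K" "m + 1 / real (Suc n)"] K_ne by (auto simp: m_def)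
  then obtain z where zK: "\<And>n. z n \<in> K" and zlt: "\<And>n. nrm (A (z n)) < m + 1 / real (Suc n)"
    by metis
  have z1: "nrm (A (z n)) \<le> m + 1" for n
  proof -
    have "1 / real (Suc n) \<le> 1" by simp
    then show ?thesis using zlt[of n] by linarith
  qed
  obtain l r where l [simp]: "l \<in> X" and r: "strict_mono r" and lim: "(\<lambda>n. nrm (z (r n) - l)) \<longlonglongrightarrow> 0"
    using compact[of z "m + 1"] zK z1 m0 by (force simp: K_def)
  have "(\<lambda>n. nrm (z (r n))) \<longlonglongrightarrow> nrm l"
    using zK lim by (intro tendsto_nrm) (auto simp: K_def)
  then have nl: "nrm l = 1"
    using zK LIMSEQ_unique[of "\<lambda>n. nrm (z (r n))" "nrm l" 1] by (simp add: K_def)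
  have lV: "l \<in> V"
    using zK by (intro V_limit[OF _ l lim]) (auto simp: K_def)
  \<comment> \<open>Lower semicontinuity of the norm of \<open>A\<close>:
    \<open>D_bounded_limit\<close> wants one fixed bound, which late members of the minimising
    sequence satisfy for \<open>m + e\<close> but perhaps never for \<open>m\<close>.\<close>
  have lC: "l \<in> D \<and> nrm (A l) \<le> m + e" if e: "0 < e" for e
  proof (rule D_bounded_limit[OF l])
    fix e' :: real assume e': "0 < e'"
    have "(\<lambda>n. 1 / real (Suc (r n))) \<longlonglongrightarrow> 0"
      using LIMSEQ_subseq_LIMSEQ[OF LIMSEQ_Suc[OF lim_1_over_n] r] by (simp add: o_def)
    from eventually_happens[OF eventually_conj[OF order_tendstoD(2)[OF this e] order_tendstoD(2)[OF lim e']]]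
    obtain n where "1 / real (Suc (r n)) < e" "nrm (z (r n) - l) < e'" by auto
    then show "\<exists>z\<in>D. nrm (z - l) < e' \<and> nrm (A z) \<le> m + e"
      using zK[of "r n"] zlt[of "r n"] by (intro bexI[of _ "z (r n)"]) (auto simp: K_def)
  qed
  have lD: "l \<in> D" using lC[of 1] by simp
  have lm: "nrm (A l) \<le> m * nrm l"
    using lC nl by (simp add: field_le_epsilon)
  \<comment> \<open>The Euler-Lagrange equation in weak form: the squared norm of \<open>A u\<close>
    minus \<open>m\<^sup>2\<close> times that of \<open>u\<close> is nonnegative on
    \<open>V \<inter> D\<close> and not positive at the minimiser \<open>y\<close>. It also shows
    that minimisers form a linear space.\<close>
  have orth: "ip (A y) (A z) = m\<^sup>2 * ip y z"
    if y: "y \<in> V" "y \<in> D" "nrm (A y) \<le> m * nrm y" and z: "z \<in> V" "z \<in> D" for y z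
  proof -
    have [simp]: "y \<in> X" "z \<in> X" using y z by auto
    have "0 \<le> 2 * s * (ip (A y) (A z) - m\<^sup>2 * ip y z) + s\<^sup>2 * (ip (A z) (A z) - m\<^sup>2 * ip z z)" for s
    proof -
      have u: "y + s *\<^sub>R z \<in> V" "y + s *\<^sub>R z \<in> D" "nrm (A (y + s *\<^sub>R z) - (A y + s *\<^sub>R A z)) = 0"
        using V_lin[OF y(1) z(1), of 1 s] D_lin[OF y(2) z(2), of 1 s] by auto
      have "(m * nrm (y + s *\<^sub>R z))\<^sup>2 \<le> (nrm (A (y + s *\<^sub>R z)))\<^sup>2"
        using m_le[OF u(1,2)] m0 by (intro power_mono) auto
      also have "nrm (A (y + s *\<^sub>R z)) = nrm (A y + s *\<^sub>R A z)"
        using u y z by (intro nrm_cong) auto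
      finally have "m\<^sup>2 * ((nrm y)\<^sup>2 + 2 * s * ip y z + s\<^sup>2 * (nrm z)\<^sup>2)
          \<le> (nrm (A y))\<^sup>2 + 2 * s * ip (A y) (A z) + s\<^sup>2 * (nrm (A z))\<^sup>2"
        using y z by (simp add: power_mult_distrib nrm_add_scale)
      moreover have "ip (A y) (A y) \<le> m\<^sup>2 * ip y y"
        using power_mono[OF y(3), of 2] y by (simp add: power_mult_distrib nrm_sq)
      ultimately show ?thesis using y z by (simp add: nrm_sq) (simp add: algebra_simps)
    qed
    from quadratic_nonneg_imp_linear_coeff_zero[OF this] show ?thesis by simp
  qed
  \<comment> \<open>Since \<open>T t y\<close> is again a minimiser, \<open>orth\<close> makes
    \<open>quot t y\<close> one as well. \<open>A y\<close> is the limit of these, and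
    \<open>D_bounded_limit\<close> yields both its membership in \<open>D\<close> and its
    minimality, which is how \<open>A (A y)\<close> becomes available.\<close>
  have inv: "A y \<in> V \<and> A y \<in> D \<and> nrm (A (A y)) \<le> m * nrm (A y)"
    if y: "y \<in> V" "y \<in> D" "nrm (A y) \<le> m * nrm y" for y
  proof -
    have [simp]: "y \<in> X" using y by auto
    have AV: "A y \<in> V" using V_A y by blast
    have q: "quot t y \<in> D \<and> nrm (A (quot t y)) \<le> m * nrm (quot t y)" if t: "0 < t" for t
    proof -
      have Ty: "T t y \<in> V" "T t y \<in> D" using V_T[OF y(1)] T_D[OF y(2)] t by auto
      have "nrm (A (T t y)) = nrm (A y)"
        using nrm_A_T[OF y(2), of t] AV t by (simp add: V_isometric)
      moreover have "nrm (T t y) = nrm y" using y(1) t by (simp add: V_isometric)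
      ultimately have Tm: "nrm (A (T t y)) \<le> m * nrm (T t y)" using y by simp
      have d: "T t y - y \<in> V" "T t y - y \<in> D" "nrm (A (T t y - y) - (A (T t y) - A y)) = 0"
        using V_lin[OF Ty(1) y(1), of 1 "-1"] D_diff[OF Ty(2) y(2)] by auto
      have "(nrm (A (T t y - y)))\<^sup>2 = (nrm (A (T t y) - A y))\<^sup>2"
        using nrm_cong[OF _ _ d(3)] d(2) Ty y by simp
      also have "\<dots> = m\<^sup>2 * (nrm (T t y - y))\<^sup>2"
        using orth[OF Ty Tm Ty] orth[OF Ty Tm y(1,2)] orth[OF y Ty] orth[OF y y(1,2)] Ty y t
        by (simp add: nrm_sq ip_lin algebra_simps)
      finally have "nrm (A (T t y - y)) = m * nrm (T t y - y)"
        using m0 d t y by (simp flip: power_mult_distrib)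
      then show ?thesis using t D_scale[OF d(2)] d(2) by (simp add: quot_def nrm_A_scale nrm_scale)
    qed
    have bd: "A y \<in> D \<and> nrm (A (A y)) \<le> m * nrm (A y) + e" if e: "0 < e" for e
    proof (rule D_bounded_limit)
      fix e' :: real assume e': "0 < e'"
      have ev: "\<forall>\<^sub>F t in at_right 0. nrm (quot t y - A y) < min e' (e / (m + 1))"
        using e e' m0 by (intro order_tendstoD(2)[OF genD] y) auto
      obtain t where t: "0 < t" "nrm (quot t y - A y) < e'" "nrm (quot t y - A y) < e / (m + 1)"
        using eventually_happens[OF eventually_conj[OF ev eventually_at_right_less[of "0::real"]]] by auto
      have "nrm (A (quot t y)) \<le> m * nrm (quot t y)" using q t by simp
      also have "\<dots> \<le> m * (nrm (A y) + e / (m + 1))"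
        using nrm_le_add[of "quot t y" "A y"] t m0 y by (intro mult_left_mono) auto
      also have "m * (e / (m + 1)) \<le> e" using m0 e by (simp add: field_simps)
      then have "m * (nrm (A y) + e / (m + 1)) \<le> m * nrm (A y) + e" by (simp add: algebra_simps)
      finally show "\<exists>z\<in>D. nrm (z - A y) < e' \<and> nrm (A z) \<le> m * nrm (A y) + e"
        using q t by blast
    qed (use AV in simp)
    show ?thesis using AV bd[of 1] bd by (auto intro: field_le_epsilon)
  qed
  note i1 = inv[OF lV lD lm]
  note i2 = inv[OF conjunct1[OF i1] conjunct1[OF conjunct2[OF i1]] conjunct2[OF conjunct2[OF i1]]]
  define w where "w = A (A l) + m\<^sup>2 *\<^sub>R l"
  have w: "w \<in> V" "w \<in> D"
    using V_lin[of "A (A l)" l 1 "m\<^sup>2"] D_lin[of "A (A l)" l 1 "m\<^sup>2"] i2 lV lD by (auto simp: w_def)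
  \<comment> \<open>Skew-symmetry moves one \<open>A\<close> to \<open>w\<close>, and
    \<open>orth\<close> evaluates the result; hence \<open>w\<close> is orthogonal to
    itself.\<close>
  have "ip (A (A l)) w = - (m\<^sup>2 * ip l w)"
    using V_skew[of "A l" w] orth[OF lV lD lm w] i1 w by simp
  then have "ip w w = 0"
    using w i1 by (simp add: w_def ip_add ip_scale)
  then have "nrm w = 0" by (simp add: nrm_def)
  with that[of l m] lD i1 nl show ?thesis by (simp add: w_def)
qed

text \<open>If the decay were not uniform, there would be vectors \<open>x n\<close> in the graph
  ball that are still large at times \<open>t n\<close> tending to infinity. Along a subsequence
  they approach some \<open>l\<close> in \<open>D\<close>, and the contraction property bounds
  \<open>nrm (T (t n) (x n))\<close> by \<open>nrm (x n - l) + nrm (T (t n) l)\<close>, where both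
  terms tend to 0.\<close>

lemma uniformly_stable:
  assumes stable: "\<And>x. x \<in> D \<Longrightarrow> ((\<lambda>t. nrm (T t x)) \<longlongrightarrow> 0) at_top"
  obtains f :: "real \<Rightarrow> real" where "\<And>t. 0 \<le> t \<Longrightarrow> 0 \<le> f t" "(f \<longlongrightarrow> 0) at_top"
    "\<And>x t. x \<in> D \<Longrightarrow> 0 \<le> t \<Longrightarrow> nrm (T t x) \<le> f t * sqrt ((nrm x)\<^sup>2 + (nrm (A x))\<^sup>2)"
proof -
  define gn where "gn x = sqrt ((nrm x)\<^sup>2 + (nrm (A x))\<^sup>2)" for x
  have gn: "nrm x \<le> gn x" "nrm (A x) \<le> gn x" "0 \<le> gn x" for x
    by (auto simp: gn_def intro: real_le_rsqrt)
  define B where "B = {x \<in> D. gn x \<le> 1}"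
  \<comment> \<open>Inserting 0 keeps the supremum over a nonempty set and makes it
    nonnegative.\<close>
  define f where "f t = Sup (insert 0 ((\<lambda>x. nrm (T t x)) ` B))" for t
  have le1: "nrm (T t x) \<le> 1" if "x \<in> B" "0 \<le> t" for x t
    using T_contr[of t x] that gn(1)[of x] by (simp add: B_def)
  have bdd: "bdd_above (insert 0 ((\<lambda>x. nrm (T t x)) ` B))" if "0 \<le> t" for t
    using le1 that by (intro bdd_aboveI[of _ 1]) auto
  have f0: "0 \<le> f t" if "0 \<le> t" for t
    unfolding f_def using bdd[OF that] by (intro cSup_upper) auto
  have f_le: "nrm (T t x) \<le> f t" if "x \<in> B" "0 \<le> t" for x t
    unfolding f_def using bdd[OF that(2)] that(1) by (intro cSup_upper) auto
  have "(f \<longlongrightarrow> 0) at_top"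
  proof (rule tendstoI, rule ccontr)
    fix e :: real assume e: "0 < e" and not: "\<not> (\<forall>\<^sub>F t in at_top. dist (f t) 0 < e)"
    have "\<exists>t x. real n \<le> t \<and> x \<in> B \<and> e / 2 < nrm (T t x)" for n
    proof -
      obtain t where t: "real n \<le> t" "\<not> dist (f t) 0 < e"
        using not by (force simp: eventually_at_top_linorder)
      have t0: "0 \<le> t" using t(1) of_nat_0_le_iff[of n] by linarith
      then have "e \<le> f t" using t(2) f0 by simp
      then have "e / 2 < Sup (insert 0 ((\<lambda>x. nrm (T t x)) ` B))" using e by (simp add: f_def)
      then show ?thesis
        using less_cSupD[of "insert 0 ((\<lambda>x. nrm (T t x)) ` B)" "e / 2"] t e by auto
    qed
    then obtain t x where t: "\<And>n. real n \<le> t n" and x: "\<And>n. x n \<in> B" and ge: "\<And>n. e / 2 < nrm (T (t n) (x n))"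
      by metis
    have t0: "0 \<le> t n" for n using t[of n] of_nat_0_le_iff[of n] by linarith
    have xD: "x n \<in> D" and x1: "nrm (x n) \<le> 1" "nrm (A (x n)) \<le> 1" for n
      using x[of n] gn(1,2)[of "x n"] by (auto simp: B_def)
    obtain l r where l: "l \<in> X" "strict_mono r" and lim: "(\<lambda>n. nrm (x (r n) - l)) \<longlonglongrightarrow> 0"
      using compact[of x 1] xD x1 by blast
    have "l \<in> D"
    proof -
      have "\<exists>z\<in>D. nrm (z - l) < e \<and> nrm (A z) \<le> 1" if "0 < e" for e
        using eventually_happens[OF order_tendstoD(2)[OF lim that]] xD x1 by auto
      with D_bounded_limit[OF l(1)] show ?thesis by blast
    qed
    have "filterlim (\<lambda>n. t (r n)) at_top sequentially"
    proof (rule filterlim_at_top_mono)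
      show "filterlim (\<lambda>n. real (r n)) at_top sequentially"
        using filterlim_compose[OF filterlim_real_sequentially filterlim_subseq[OF l(2)]] .
    qed (use t in simp)
    from filterlim_compose[OF stable[OF \<open>l \<in> D\<close>] this]
    have "(\<lambda>n. nrm (x (r n) - l) + nrm (T (t (r n)) l)) \<longlonglongrightarrow> 0 + 0"
      by (intro tendsto_add lim)
    moreover have "e / 2 \<le> nrm (x (r n) - l) + nrm (T (t (r n)) l)" for n
      using ge[of "r n"] nrm_le_add[of "T (t (r n)) (x (r n))" "T (t (r n)) l"]
        T_lipschitz[of "t (r n)" "x (r n)" l] l(1) xD[of "r n"] t0[of "r n"] by simp
    ultimately have "e / 2 \<le> 0 + 0" by (intro LIMSEQ_le_const) auto
    then show False using e by simp
  qed
  moreover have "nrm (T t x) \<le> f t * gn x" if x: "x \<in> D" and t: "0 \<le> t" for x t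
  proof (cases "gn x = 0")
    case True
    then show ?thesis using gn(1)[of x] T_contr[of t x] x t by simp
  next
    case False
    then have pos: "0 < gn x" using gn(3)[of x] by simp
    let ?y = "(1 / gn x) *\<^sub>R x"
    have y: "?y \<in> D" using D_scale[OF x] by blast
    have "gn (c *\<^sub>R x) = \<bar>c\<bar> * gn x" for c
      using x by (simp add: gn_def nrm_scale nrm_A_scale power_mult_distrib real_sqrt_mult flip: distrib_left)
    then have "?y \<in> B" using y pos by (simp add: B_def)
    moreover have "nrm (T t ?y) = (1 / gn x) * nrm (T t x)"
      using nrm_cong[OF _ _ T_scale[of t x "1 / gn x"]] x t pos by (simp add: nrm_scale)
    ultimately have "nrm (T t x) = nrm (T t ?y) * gn x" "nrm (T t ?y) \<le> f t" using f_le[of ?y t] t pos by simp_all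
    then show ?thesis using pos by (simp add: mult_right_mono)
  qed
  ultimately show ?thesis using that f0 unfolding gn_def by blast
qed

end

text \<open>The complex structure is added as a real-linear isometry \<open>J\<close> of square -1
  that commutes with the semigroup, so the preceding real theory applies unchanged.\<close>

locale complex_contraction_semigroup = compact_contraction_semigroup X ip T D A
  for X :: "'a::real_vector set" and ip T D A +
  fixes J :: "'a \<Rightarrow> 'a"
  assumes J_linear: "linear J"
    and J_J: "J (J x) = - x"
    and J_in [simp]: "x \<in> X \<Longrightarrow> J x \<in> X"
    and nrm_J: "x \<in> X \<Longrightarrow> nrm (J x) = nrm x"
    and T_J: "0 \<le> t \<Longrightarrow> x \<in> X \<Longrightarrow> nrm (T t (J x) - J (T t x)) = 0"
begin

lemmas J_simps = linear_add[OF J_linear] linear_diff[OF J_linear] linear_scale[OF J_linear] J_J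

text \<open>\<open>J\<close> maps \<open>x + J x\<close> to \<open>J x - x\<close>; comparing the
  two squared norms leaves only a multiple of \<open>ip x (J x)\<close>.\<close>

lemma ip_J_self:
  assumes [simp]: "x \<in> X"
  shows "ip x (J x) = 0"
proof -
  have "(nrm (J (x + 1 *\<^sub>R J x)))\<^sup>2 = (nrm (x + 1 *\<^sub>R J x))\<^sup>2"
    by (simp add: nrm_J)
  moreover have "J (x + 1 *\<^sub>R J x) = J x + (-1) *\<^sub>R x" by (simp add: J_simps)
  ultimately have "(nrm (J x + (-1) *\<^sub>R x))\<^sup>2 = (nrm (x + 1 *\<^sub>R J x))\<^sup>2" by simp
  then show ?thesis
    unfolding nrm_add_scale[OF J_in[OF assms] assms] nrm_add_scale[OF assms J_in[OF assms]]
    by (simp add: nrm_J ip_commute[of "J x" x])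
qed

lemma J_D:
  assumes x [simp]: "x \<in> D"
  shows "J x \<in> D \<and> nrm (A (J x) - J (A x)) = 0"
proof (rule genI)
  show "((\<lambda>t. nrm (quot t (J x) - J (A x))) \<longlongrightarrow> 0) (at_right 0)"
  proof (rule Lim_null_comparison[OF _ genD[OF x]])
    show "\<forall>\<^sub>F t in at_right 0. norm (nrm (quot t (J x) - J (A x))) \<le> nrm (quot t x - A x)"
      using eventually_at_right_less[of "0::real"]
    proof eventually_elim
      case (elim t)
      have "quot t (J x) - J (A x) - J (quot t x - A x) = (1 / t) *\<^sub>R (T t (J x) - J (T t x))"
        by (simp add: quot_def J_simps algebra_simps)
      then have "nrm (quot t (J x) - J (A x) - J (quot t x - A x)) = 0"
        using elim by (simp add: nrm_scale T_J)
      then have "nrm (quot t (J x) - J (A x)) = nrm (J (quot t x - A x))"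
        using elim by (intro nrm_cong) auto
      then show ?case using elim by (simp add: nrm_J)
    qed
  qed
qed auto

text \<open>\<open>exists_A_sq\<close> gives (A - m J)(A + m J) y = 0 up to null vectors. If
  \<open>w\<close>, the image of \<open>y\<close> under the second factor, is null, then
  \<open>y\<close> is an eigenvector with frequency \<open>- m\<close>; otherwise \<open>w\<close>
  is one with frequency \<open>m\<close>.\<close>

lemma stable_or_imaginary_eigenvalue:
  assumes "x \<in> D" "\<not> ((\<lambda>t. nrm (T t x)) \<longlongrightarrow> 0) at_top"
  obtains z \<omega> where "z \<in> D" "nrm z \<noteq> 0" "nrm (A z - \<omega> *\<^sub>R J z) = 0"
proof -
  obtain y m where y [simp]: "y \<in> D" "A y \<in> D" and ne: "nrm y \<noteq> 0"
    and eq: "nrm (A (A y) + m\<^sup>2 *\<^sub>R y) = 0"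
    using exists_V_D[OF assms] exists_A_sq by metis
  have Jy [simp]: "J y \<in> D" using J_D by simp
  define w where "w = 1 *\<^sub>R A y + m *\<^sub>R J y"
  have w: "w \<in> D" "nrm (A w - (1 *\<^sub>R A (A y) + m *\<^sub>R A (J y))) = 0"
    using D_lin[of "A y" "J y" 1 m] by (simp_all add: w_def)
  show ?thesis
  proof (cases "nrm w = 0")
    case True
    have "nrm (A y - (- m) *\<^sub>R J y) = 0" using True by (simp add: w_def)
    then show ?thesis using that[of y "- m"] ne by simp
  next
    case False
    \<comment> \<open>Regrouped into vectors of norm 0: linearity of \<open>A\<close> at
      \<open>w\<close>, the equation for \<open>A (A y)\<close>, and the commutation of
      \<open>A\<close> with \<open>J\<close>.\<close>
    have eq': "A w - m *\<^sub>R J w = (A w - (1 *\<^sub>R A (A y) + m *\<^sub>R A (J y)))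
        + ((A (A y) + m\<^sup>2 *\<^sub>R y) + m *\<^sub>R (A (J y) - J (A y)))"
      by (simp add: w_def J_simps algebra_simps power2_eq_square)
    have "nrm (A w - m *\<^sub>R J w) \<le> nrm (A w - (1 *\<^sub>R A (A y) + m *\<^sub>R A (J y)))
        + (nrm (A (A y) + m\<^sup>2 *\<^sub>R y) + nrm (m *\<^sub>R (A (J y) - J (A y))))"
      unfolding eq' using w by (intro order_trans[OF nrm_triangle] add_left_mono nrm_triangle) auto
    also have "\<dots> = 0" using w eq J_D[of y] by (simp add: nrm_scale)
    finally have "nrm (A w - m *\<^sub>R J w) = 0" using w by (simp add: antisym)
    then show ?thesis using that[of w m] w False by simp
  qed
qed

text \<open>The orbit is exp(i \<omega> t) z. \<open>R s\<close> is the rotation by this phase; over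
  a short time \<open>h\<close> the vectors \<open>T h z\<close> and \<open>R h z\<close> differ by
  o(h), and these errors are summed over \<open>t / h\<close> steps.\<close>

lemma nrm_T_eigenvector:
  assumes z [simp]: "z \<in> D" and eig: "nrm (A z - \<omega> *\<^sub>R J z) = 0" and t: "0 < t"
  shows "nrm (T t z) = nrm z"
proof -
  define R where "R s x = cos (\<omega> * s) *\<^sub>R x + sin (\<omega> * s) *\<^sub>R J x" for s x
  have R_in [simp]: "R s x \<in> X" if "x \<in> X" for s x using that by (simp add: R_def)
  have nrm_R: "nrm (R s x) = nrm x" if [simp]: "x \<in> X" for s x
  proof -
    have "(nrm (R s x))\<^sup>2 = (nrm (cos (\<omega> * s) *\<^sub>R x))\<^sup>2 + (sin (\<omega> * s))\<^sup>2 * (nrm (J x))\<^sup>2"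
      unfolding R_def by (subst nrm_add_scale) (simp_all add: ip_scale ip_J_self)
    also have "\<dots> = ((cos (\<omega> * s))\<^sup>2 + (sin (\<omega> * s))\<^sup>2) * (nrm x)\<^sup>2"
      by (simp add: nrm_scale nrm_J power_mult_distrib algebra_simps del: sin_cos_squared_add sin_cos_squared_add2)
    finally show ?thesis by simp
  qed
  have R_diff: "R s (x - y) = R s x - R s y" for s x y
    by (simp add: R_def J_simps algebra_simps)
  have R_R: "R (s + t) x = R s (R t x)" for s t x
    by (simp add: R_def J_simps cos_add sin_add algebra_simps)
  have T_R: "nrm (T t (R s x) - R s (T t x)) = 0" if [simp]: "0 \<le> t" "x \<in> X" for s t x
  proof -
    have eq: "T t (R s x) - R s (T t x) = (T t (cos (\<omega> * s) *\<^sub>R x + sin (\<omega> * s) *\<^sub>R J x)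
        - (cos (\<omega> * s) *\<^sub>R T t x + sin (\<omega> * s) *\<^sub>R T t (J x))) + sin (\<omega> * s) *\<^sub>R (T t (J x) - J (T t x))"
      by (simp add: R_def algebra_simps)
    have "nrm (T t (R s x) - R s (T t x)) \<le> 0"
      unfolding eq by (rule order_trans[OF nrm_triangle]) (simp_all add: T_lin nrm_scale T_J)
    then show ?thesis by (simp add: antisym)
  qed
  \<comment> \<open>Errors merely add up, because \<open>T\<close> is contractive, \<open>R\<close>
    is isometric, and the two commute up to null vectors.\<close>
  have step: "nrm (T (real n * h) z - R (real n * h) z) \<le> real n * nrm (T h z - R h z)" if [simp]: "0 \<le> h" for n h
  proof (induction n)
    case 0
    then show ?case by (simp add: T_zero R_def)
  next
    case (Suc n)
    let ?m = "real n * h"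
    have "R (real (Suc n) * h) z = R h (R ?m z)"
      by (simp add: R_R[symmetric] algebra_simps)
    then have eq: "T (real (Suc n) * h) z - R (real (Suc n) * h) z = (T (?m + h) z - T ?m (T h z))
      + ((T ?m (T h z) - T ?m (R h z)) + ((T ?m (R h z) - R h (T ?m z)) + R h (T ?m z - R ?m z)))"
      by (simp add: R_diff algebra_simps)
    have "nrm (T (real (Suc n) * h) z - R (real (Suc n) * h) z) \<le> nrm (T (?m + h) z - T ?m (T h z))
      + (nrm (T ?m (T h z) - T ?m (R h z)) + (nrm (T ?m (R h z) - R h (T ?m z)) + nrm (R h (T ?m z - R ?m z))))"
      unfolding eq by (intro order_trans[OF nrm_triangle] add_left_mono nrm_triangle order_refl) auto
    also have "\<dots> \<le> 0 + (nrm (T h z - R h z) + (0 + real n * nrm (T h z - R h z)))"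
    proof (intro add_mono)
      show "nrm (T (?m + h) z - T ?m (T h z)) \<le> 0" by (simp add: T_plus)
      show "nrm (T ?m (T h z) - T ?m (R h z)) \<le> nrm (T h z - R h z)" by (rule T_lipschitz) auto
      show "nrm (T ?m (R h z) - R h (T ?m z)) \<le> 0" by (simp add: T_R)
      show "nrm (R h (T ?m z - R ?m z)) \<le> real n * nrm (T h z - R h z)"
        using Suc nrm_R[of "T ?m z - R ?m z" h] by simp
    qed
    finally show ?case by (simp add: algebra_simps)
  qed
  \<comment> \<open>Bounds the error per unit of time: the first two terms compare the rotation with
    its linearisation, the third compares the semigroup with its own.\<close>
  define q where "q h = \<bar>(cos (\<omega> * h) - 1) / h\<bar> * nrm z + \<bar>sin (\<omega> * h) / h - \<omega>\<bar> * nrm z + nrm (quot h z - A z)" for h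
  have q: "nrm (T h z - R h z) \<le> h * q h" if h: "0 < h" for h
  proof -
    have eq: "(1 / h) *\<^sub>R (T h z - R h z) = (- ((cos (\<omega> * h) - 1) / h)) *\<^sub>R z + ((- (sin (\<omega> * h) / h - \<omega>)) *\<^sub>R J z
        + ((quot h z - A z) + (A z - \<omega> *\<^sub>R J z)))"
      by (simp add: quot_def R_def algebra_simps diff_divide_distrib)
    have "nrm ((1 / h) *\<^sub>R (T h z - R h z)) \<le> nrm ((- ((cos (\<omega> * h) - 1) / h)) *\<^sub>R z) + (nrm ((- (sin (\<omega> * h) / h - \<omega>)) *\<^sub>R J z)
        + (nrm (quot h z - A z) + nrm (A z - \<omega> *\<^sub>R J z)))"
      unfolding eq using h by (intro order_trans[OF nrm_triangle] add_left_mono nrm_triangle order_refl) auto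
    also have "\<dots> = q h"
      using eig unfolding q_def by (simp only: nrm_scale nrm_J D_in[OF z] J_in abs_minus)
    finally show ?thesis using h by (simp add: nrm_scale pos_divide_le_eq mult.commute)
  qed
  have "((\<lambda>h. (cos (\<omega> * h) - 1) / h) \<longlongrightarrow> 0) (at_right 0)" "((\<lambda>h. sin (\<omega> * h) / h - \<omega>) \<longlongrightarrow> 0) (at_right 0)"
  proof -
    have "((\<lambda>h. cos (\<omega> * h)) has_real_derivative 0) (at 0)" "((\<lambda>h. sin (\<omega> * h)) has_real_derivative \<omega>) (at 0)"
      by (auto intro!: derivative_eq_intros)
    then have "((\<lambda>h. (cos (\<omega> * h) - 1) / h) \<longlongrightarrow> 0) (at 0)" "((\<lambda>h. sin (\<omega> * h) / h) \<longlongrightarrow> \<omega>) (at 0)"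
      by (simp_all add: DERIV_def)
    then show "((\<lambda>h. (cos (\<omega> * h) - 1) / h) \<longlongrightarrow> 0) (at_right 0)" "((\<lambda>h. sin (\<omega> * h) / h - \<omega>) \<longlongrightarrow> 0) (at_right 0)"
      by (auto simp: filterlim_at_split LIM_zero_iff)
  qed
  from tendsto_add[OF tendsto_add[OF tendsto_mult_right[OF tendsto_rabs[OF this(1)], of "nrm z"]
      tendsto_mult_right[OF tendsto_rabs[OF this(2)], of "nrm z"]] genD[OF z]]
  have "(q \<longlongrightarrow> 0) (at_right 0)" by (simp add: q_def[abs_def])
  from tendsto_mult_left[OF filterlim_compose[OF this at_right_divide[OF t]], of t]
  have lim: "(\<lambda>n. t * q (t / real (Suc n))) \<longlonglongrightarrow> 0" by simp
  have "nrm (T t z - R t z) \<le> t * q (t / real (Suc n))" for n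
  proof -
    have "nrm (T t z - R t z) \<le> real (Suc n) * nrm (T (t / real (Suc n)) z - R (t / real (Suc n)) z)"
      using step[of "t / real (Suc n)" "Suc n"] t by simp
    also have "\<dots> \<le> real (Suc n) * (t / real (Suc n) * q (t / real (Suc n)))"
      using t by (intro mult_left_mono q) auto
    finally show ?thesis by simp
  qed
  with lim have "nrm (T t z - R t z) \<le> 0" by (intro LIMSEQ_le_const) auto
  then have "nrm (T t z) = nrm (R t z)" using t by (intro nrm_cong) (auto simp: antisym)
  then show ?thesis by (simp add: nrm_R)
qed

end

section \<open>A smooth step function\<close>

text \<open>The power \<open>k\<close> is carried along because differentiating the flat function
  exp(-1/x) produces powers of 1/x; the whole family is closed under differentiation up to linear
  combinations.\<close>

definition exp_cutoff :: "nat \<Rightarrow> real \<Rightarrow> real" where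
  "exp_cutoff k x = (if x > 0 then (1 / x) ^ k * exp (- (1 / x)) else 0)"

lemma exp_cutoff_tendsto_0: "(exp_cutoff k \<longlongrightarrow> 0) (at 0)"
proof -
  have "((\<lambda>x. (1 / x) ^ k / exp (1 / x)) \<longlongrightarrow> 0) (at_right (0::real))"
  proof (rule filterlim_compose[OF tendsto_power_div_exp_0])
    show "filterlim (\<lambda>x. 1 / x) at_top (at_right (0::real))"
      using filterlim_inverse_at_top_right by (simp add: inverse_eq_divide)
  qed
  then have R: "(exp_cutoff k \<longlongrightarrow> 0) (at_right 0)"
    by (rule Lim_transform_eventually)
       (use eventually_at_right_less[of "0::real"] in eventually_elim, simp add: exp_cutoff_def exp_minus field_simps)
  have L: "(exp_cutoff k \<longlongrightarrow> 0) (at_left 0)"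
    by (rule tendsto_eventually) (auto simp: exp_cutoff_def eventually_at_filter)
  show ?thesis using L R by (simp add: filterlim_at_split)
qed

lemma exp_cutoff_derivative:
  "(exp_cutoff k has_real_derivative exp_cutoff (k + 2) x - real k * exp_cutoff (k + 1) x) (at x)"
proof (cases "x = 0")
  \<comment> \<open>At 0 the difference quotient of \<open>exp_cutoff k\<close> is exactly
    \<open>exp_cutoff (k + 1)\<close>, so the derivative is its limit 0.\<close>
  case True
  have "((\<lambda>h. (exp_cutoff k (0 + h) - exp_cutoff k 0) / h) \<longlongrightarrow> 0) (at 0)"
  proof (rule Lim_transform_eventually[OF exp_cutoff_tendsto_0[of "k + 1"]])
    show "\<forall>\<^sub>F h in at 0. exp_cutoff (k + 1) h = (exp_cutoff k (0 + h) - exp_cutoff k 0) / h"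
      by (rule eventually_at_filter[THEN iffD2], rule always_eventually)
         (auto simp: exp_cutoff_def field_simps)
  qed
  then show ?thesis using True by (simp add: DERIV_def exp_cutoff_def)
next
  case False
  show ?thesis
  proof (cases "x > 0")
    case True
    have "((\<lambda>x. (1 / x) ^ k * exp (- (1 / x))) has_real_derivative
        exp_cutoff (k + 2) x - real k * exp_cutoff (k + 1) x) (at x)"
    proof (cases k)
      case 0
      then show ?thesis
        using True by (auto intro!: derivative_eq_intros simp: exp_cutoff_def field_simps power2_eq_square)
    next
      case (Suc n)
      have "((\<lambda>x. (1 / x) ^ Suc n * exp (- (1 / x))) has_real_derivative
        (1 / x) ^ Suc n * (exp (- (1 / x)) * (1 / x)\<^sup>2) + (1 + real n) * (- ((1 / x)\<^sup>2) * (1 / x) ^ n) * exp (- (1 / x))) (at x)"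
      proof (intro DERIV_mult' DERIV_power_Suc)
        show "((\<lambda>x. 1 / x) has_real_derivative - ((1 / x)\<^sup>2)) (at x)"
          using True by (auto intro!: derivative_eq_intros simp: power2_eq_square)
        show "((\<lambda>x. exp (- (1 / x))) has_real_derivative exp (- (1 / x)) * (1 / x)\<^sup>2) (at x)"
          using True by (auto intro!: derivative_eq_intros simp: power2_eq_square)
      qed
      then show ?thesis
        using True Suc by (simp add: exp_cutoff_def power2_eq_square algebra_simps)
    qed
    then show ?thesis
      by (rule has_field_derivative_transform_within_open[of _ _ _ "{0<..}"])
         (use True in \<open>auto simp: exp_cutoff_def\<close>)
  next
    case neg: False
    have "((\<lambda>x. 0) has_real_derivative exp_cutoff (k + 2) x - real k * exp_cutoff (k + 1) x) (at x)"
      using neg by (simp add: exp_cutoff_def)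
    then show ?thesis
      by (rule has_field_derivative_transform_within_open[of _ _ _ "{..<0}"])
         (use neg False in \<open>auto simp: exp_cutoff_def\<close>)
  qed
qed

lemma affine_deriv: "((\<lambda>x. c * x + d) has_real_derivative c) (at x)" for c d x :: real
  by (auto intro!: derivative_eq_intros)

text \<open>An algebra of functions that is closed under differentiation, whence all its members are smooth.\<close>

inductive_set smooth_algebra :: "(real \<Rightarrow> real) set" where
  cutoff: "(\<lambda>x. exp_cutoff k (c * x + d)) \<in> smooth_algebra"
| const: "(\<lambda>x. c) \<in> smooth_algebra"
| add: "f \<in> smooth_algebra \<Longrightarrow> g \<in> smooth_algebra \<Longrightarrow> (\<lambda>x. f x + g x) \<in> smooth_algebra"
| mult: "f \<in> smooth_algebra \<Longrightarrow> g \<in> smooth_algebra \<Longrightarrow> (\<lambda>x. f x * g x) \<in> smooth_algebra"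
| inverse: "f \<in> smooth_algebra \<Longrightarrow> (\<And>x. f x \<noteq> 0) \<Longrightarrow> (\<lambda>x. inverse (f x)) \<in> smooth_algebra"

lemma smooth_algebra_scale: "f \<in> smooth_algebra \<Longrightarrow> (\<lambda>x. c * f x) \<in> smooth_algebra"
  by (rule smooth_algebra.mult[OF smooth_algebra.const])

lemma smooth_algebra_diff:
  assumes "f \<in> smooth_algebra" "g \<in> smooth_algebra"
  shows "(\<lambda>x. f x - g x) \<in> smooth_algebra"
  using smooth_algebra.add[OF assms(1) smooth_algebra_scale[OF assms(2), of "-1"]] by simp

lemma smooth_algebra_derivative:
  "f \<in> smooth_algebra \<Longrightarrow> \<exists>f'\<in>smooth_algebra. \<forall>x. (f has_real_derivative f' x) (at x)"
proof (induction rule: smooth_algebra.induct)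
  case (cutoff k c d)
  have "((\<lambda>x. exp_cutoff k (c * x + d)) has_real_derivative
      c * (exp_cutoff (k + 2) (c * x + d) - real k * exp_cutoff (k + 1) (c * x + d))) (at x)" for x
    using DERIV_chain'[of "\<lambda>x. c * x + d" c x UNIV "exp_cutoff k", OF _ exp_cutoff_derivative]
      affine_deriv[of c d x] by (simp add: mult.commute)
  moreover have "(\<lambda>x. c * (exp_cutoff (k + 2) (c * x + d) - real k * exp_cutoff (k + 1) (c * x + d))) \<in> smooth_algebra"
    by (intro smooth_algebra_scale smooth_algebra_diff smooth_algebra.cutoff)
  ultimately show ?case by (intro bexI[rotated] allI)
next
  case (const c)
  show ?case by (rule bexI[OF _ smooth_algebra.const[of 0]]) simp
next
  case (add f g)
  then obtain f' g' where *: "f' \<in> smooth_algebra" "g' \<in> smooth_algebra"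
    "\<And>x. (f has_real_derivative f' x) (at x)" "\<And>x. (g has_real_derivative g' x) (at x)" by blast
  have "(\<lambda>x. f' x + g' x) \<in> smooth_algebra" using * by (intro smooth_algebra.add)
  moreover have "((\<lambda>x. f x + g x) has_real_derivative f' x + g' x) (at x)" for x
    by (intro DERIV_add *)
  ultimately show ?case by (intro bexI[rotated] allI)
next
  case (mult f g)
  then obtain f' g' where *: "f' \<in> smooth_algebra" "g' \<in> smooth_algebra"
    "\<And>x. (f has_real_derivative f' x) (at x)" "\<And>x. (g has_real_derivative g' x) (at x)" by blast
  have "(\<lambda>x. f x * g' x + f' x * g x) \<in> smooth_algebra"
    using * mult by (intro smooth_algebra.add smooth_algebra.mult)
  moreover have "((\<lambda>x. f x * g x) has_real_derivative f x * g' x + f' x * g x) (at x)" for x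
    by (intro DERIV_mult' *)
  ultimately show ?case by (intro bexI[rotated] allI)
next
  case (inverse f)
  then obtain f' where *: "f' \<in> smooth_algebra" "\<And>x. (f has_real_derivative f' x) (at x)" by blast
  have "(\<lambda>x. (-1) * (inverse (f x) * f' x * inverse (f x))) \<in> smooth_algebra"
    using * inverse by (intro smooth_algebra_scale smooth_algebra.mult smooth_algebra.inverse)
  moreover have "((\<lambda>x. inverse (f x)) has_real_derivative (-1) * (inverse (f x) * f' x * inverse (f x))) (at x)" for x
    using DERIV_inverse'[OF *(2) inverse(2), of x] by simp
  ultimately show ?case by (intro bexI[rotated] allI)
qed

lemma smooth_algebra_deriv: "f \<in> smooth_algebra \<Longrightarrow> deriv f \<in> smooth_algebra"
  using smooth_algebra_derivative[of f] DERIV_imp_deriv[of f] by (metis ext)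

lemma smooth_algebra_DERIV: "f \<in> smooth_algebra \<Longrightarrow> (f has_real_derivative deriv f x) (at x)"
  using smooth_algebra_derivative[of f] DERIV_imp_deriv[of f] by metis

lemma smooth_algebra_smooth:
  assumes "f \<in> smooth_algebra"
  shows "(deriv ^^ n) f differentiable (at x)"
proof -
  have "(deriv ^^ n) f \<in> smooth_algebra"
    using assms by (induction n) (auto intro: smooth_algebra_deriv)
  then show ?thesis
    using smooth_algebra_DERIV real_differentiable_def by blast
qed

text \<open>The standard quotient e(x) / (e(x) + e(1 - x)), rising from 0 at 0 to 1 at 1, written
  with \<open>inverse\<close> so that it has the shape of the rules of
  \<open>smooth_algebra\<close>.\<close>

definition smooth_step :: "real \<Rightarrow> real" where
  "smooth_step x = exp_cutoff 0 x * inverse (exp_cutoff 0 x + exp_cutoff 0 (1 - x))"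

lemma exp_cutoff_0_nonneg: "0 \<le> exp_cutoff k x"
  by (simp add: exp_cutoff_def)

lemma smooth_step_denominator: "0 < exp_cutoff 0 x + exp_cutoff 0 (1 - x)"
  by (cases "x > 0") (simp_all add: exp_cutoff_def add_pos_nonneg)

lemma smooth_step_0: "x \<le> 0 \<Longrightarrow> smooth_step x = 0"
  by (simp add: smooth_step_def exp_cutoff_def)

lemma smooth_step_1: "1 \<le> x \<Longrightarrow> smooth_step x = 1"
  by (simp add: smooth_step_def exp_cutoff_def)

lemma smooth_step_range: "0 \<le> smooth_step x" "smooth_step x \<le> 1"
  using smooth_step_denominator[of x] exp_cutoff_0_nonneg[of 0 x] exp_cutoff_0_nonneg[of 0 "1 - x"]
  by (simp_all add: smooth_step_def field_simps)

lemma smooth_step_affine: "(\<lambda>x. smooth_step (c * x + d)) \<in> smooth_algebra"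
proof -
  have eq: "1 - (c * x + d) = (- c) * x + (1 - d)" for x by simp
  show ?thesis unfolding smooth_step_def eq
    by (intro smooth_algebra.mult smooth_algebra.inverse smooth_algebra.add smooth_algebra.cutoff)
       (metis eq less_irrefl smooth_step_denominator)
qed

text \<open>The sign makes the rescaled derivatives probability densities, so averages against them
  are estimated without absolute values.\<close>

lemma smooth_step_deriv_nonneg: 
  obtains \<theta> where "\<And>x. (smooth_step has_real_derivative \<theta> x) (at x)" "\<And>x. 0 \<le> \<theta> x"
proof -
  \<comment> \<open>For \<open>k = 0\<close> the second term of \<open>exp_cutoff_derivative\<close>
    drops out, so the derivative of \<open>e\<close> is \<open>exp_cutoff 2\<close>, which is
    nonnegative.\<close>
  define e e' E where "e = exp_cutoff 0" and "e' = exp_cutoff 2" and "E x = e x + e (1 - x)" for x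
  have d: "(e has_real_derivative e' x) (at x)" for x
    using exp_cutoff_derivative[of 0 x] by (simp add: e_def e'_def numeral_2_eq_2)
  have d1: "((\<lambda>x. e (1 - x)) has_real_derivative - e' (1 - x)) (at x)" for x
    using DERIV_chain'[of "\<lambda>x. -1 * x + 1" "-1" x UNIV e, OF affine_deriv d] by simp
  have pos: "E x > 0" for x using smooth_step_denominator[of x] by (simp add: E_def e_def)
  have "(smooth_step has_real_derivative
      (e' x * E x - e x * (e' x + - e' (1 - x))) / (E x * E x)) (at x)" for x
    using DERIV_divide[OF d DERIV_add[OF d d1], of x] pos[of x]
    by (simp add: smooth_step_def[abs_def] e_def E_def divide_inverse)
  moreover have "0 \<le> (e' x * E x - e x * (e' x + - e' (1 - x))) / (E x * E x)" for x
  proof -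
    have "e' x * E x - e x * (e' x + - e' (1 - x)) = e' x * e (1 - x) + e x * e' (1 - x)"
      by (simp add: E_def algebra_simps)
    also have "\<dots> \<ge> 0" by (simp add: e_def e'_def exp_cutoff_0_nonneg)
    finally show ?thesis using pos[of x] by simp
  qed
  ultimately show ?thesis by (rule that)
qed

section \<open>Weak derivatives on an interval\<close>

abbreviation Leb :: "real \<Rightarrow> real \<Rightarrow> real measure" where
  "Leb a b \<equiv> lebesgue_on {a<..<b}"

lemma finite_measure_Leb: "finite_measure (Leb a b)"
  by (rule finite_measureI, cases "a \<le> b") (simp_all add: emeasure_restrict_space)

lemma L2_measurable: "f \<in> L2 a b \<Longrightarrow> f \<in> borel_measurable (Leb a b)"
  by (simp add: L2_def)

lemma L2_sq_integrable: "f \<in> L2 a b \<Longrightarrow> integrable (Leb a b) (\<lambda>x. (norm (f x))\<^sup>2)"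
  by (simp add: L2_def)

lemma L2_integrable:
  assumes "f \<in> L2 a b"
  shows "integrable (Leb a b) f"
proof -
  interpret finite_measure "Leb a b" by (rule finite_measure_Leb)
  show ?thesis
  proof (rule Bochner_Integration.integrable_bound)
    show "integrable (Leb a b) (\<lambda>x. 1 + (norm (f x))\<^sup>2)"
      using L2_sq_integrable[OF assms] by simp
    have "norm u \<le> 1 + (norm u)\<^sup>2" for u :: 'a
      using sum_squares_bound[of 1 "norm u"] by (simp add: power2_eq_square) (smt (verit) norm_ge_zero)
    then show "AE x in Leb a b. norm (f x) \<le> norm (1 + (norm (f x))\<^sup>2)"
      by (simp add: order_trans[OF _ abs_ge_self])
  qed (rule L2_measurable[OF assms])
qed

lemma integrable_Leb_imp:
  fixes f :: "real \<Rightarrow> 'v::euclidean_space"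
  assumes "integrable (Leb a b) f"
  shows "f integrable_on {a..b}" "integral\<^sup>L (Leb a b) f = integral {a..b} f"
  using integrable_on_lebesgue_on[OF assms] lebesgue_integral_eq_integral[OF assms]
  by (auto simp: integrable_on_open_interval_real integral_open_interval_real)

lemma continuous_measurable_Leb:
  fixes f :: "real \<Rightarrow> 'v::euclidean_space"
  assumes "continuous_on {a..b} f"
  shows "f \<in> borel_measurable (Leb a b)"
  by (rule continuous_imp_measurable_on_sets_lebesgue)
     (auto intro: continuous_on_subset[OF assms])

lemma bounded_integrable_Leb:
  fixes f :: "real \<Rightarrow> 'v::euclidean_space"
  assumes "f \<in> borel_measurable (Leb a b)" "AE x in Leb a b. norm (f x) \<le> C"
  shows "integrable (Leb a b) f"
  by (rule finite_measure.integrable_const_bound[OF finite_measure_Leb assms(2,1)])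

lemma continuous_bounded_Icc:
  fixes f :: "real \<Rightarrow> 'v::euclidean_space"
  assumes "continuous_on {a..b} f"
  obtains C where "\<And>x. x \<in> {a..b} \<Longrightarrow> norm (f x) \<le> C"
proof -
  obtain C where "\<forall>x\<in>{a..b}. norm (f x) \<le> C"
    using compact_imp_bounded[OF compact_continuous_image[OF assms compact_Icc]]
    by (auto simp: bounded_iff)
  then show ?thesis by (intro that) blast
qed

lemma AE_LebI: "(\<And>x. a < x \<Longrightarrow> x < b \<Longrightarrow> P x) \<Longrightarrow> AE x in Leb a b. P x"
  by (rule AE_I2) (simp add: space_restrict_space)

lemma continuous_integrable_Leb:
  fixes f :: "real \<Rightarrow> 'v::euclidean_space"
  assumes "continuous_on {a..b} f"
  shows "integrable (Leb a b) f"
proof -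
  obtain C where "\<And>x. x \<in> {a..b} \<Longrightarrow> norm (f x) \<le> C"
    using continuous_bounded_Icc[OF assms] by blast
  then show ?thesis
    by (intro bounded_integrable_Leb[of _ _ _ C] continuous_measurable_Leb assms AE_LebI) auto
qed

lemma continuous_L2:
  fixes f :: "real \<Rightarrow> 'v::euclidean_space"
  assumes "continuous_on {a..b} f"
  shows "f \<in> L2 a b"
  using assms by (auto simp: L2_def intro!: continuous_measurable_Leb continuous_integrable_Leb continuous_intros)

text \<open>The rescaled derivatives of \<open>smooth_step\<close> form an approximate identity.\<close>

lemma smooth_step_mollifier:
  fixes w :: "real \<Rightarrow> 'v::euclidean_space"
  assumes c: "a < c" "c < b" and w: "continuous_on {a..b} w"
  shows "(\<lambda>m. \<integral>x. deriv (\<lambda>x. smooth_step (real m * x + - (real m * c))) x *\<^sub>R w x \<partial>Leb a b) \<longlonglongrightarrow> w c"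
proof (rule LIMSEQ_I)
  define S where "S m x = smooth_step (real m * x + - (real m * c))" for m x
  define k where "k m = deriv (S m)" for m
  have S: "S m \<in> smooth_algebra" for m unfolding S_def by (rule smooth_step_affine)
  have D: "(S m has_real_derivative k m x) (at x)" for m x
    unfolding k_def by (rule smooth_algebra_DERIV[OF S])
  have cont: "continuous_on {a..b} (k m)" for m
    using smooth_algebra_DERIV[OF smooth_algebra_deriv[OF S], of m]
    by (auto simp: k_def intro!: DERIV_isCont continuous_at_imp_continuous_on)
  have nonneg: "0 \<le> k m x" for m x
  proof -
    obtain \<theta> where t: "\<And>x. (smooth_step has_real_derivative \<theta> x) (at x)" "\<And>x. 0 \<le> \<theta> x"
      using smooth_step_deriv_nonneg by blast
    have "(S m has_real_derivative \<theta> (real m * x + - (real m * c)) * real m) (at x)"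
      unfolding S_def by (rule DERIV_chain'[OF affine_deriv t(1)])
    then have "k m x = \<theta> (real m * x + - (real m * c)) * real m" using D DERIV_unique by blast
    then show ?thesis using t by simp
  qed
  fix e :: real assume e: "0 < e"
  have "isCont w c"
    using continuous_on_interior[OF w, of c] c by simp
  then obtain d where d: "0 < d" "\<And>x. \<bar>x - c\<bar> < d \<Longrightarrow> norm (w x - w c) < e / 2"
    using e unfolding continuous_at_eps_delta dist_norm by (metis dist_norm dist_real_def half_gt_zero)
  \<comment> \<open>\<open>S m\<close> rises from 0 to 1 between \<open>c\<close> and
    \<open>c + 1 / m\<close>. Once \<open>1 / m\<close> is below \<open>d'\<close>, its derivative
    lives where \<open>w\<close> is close to \<open>w c\<close>, and its whole mass 1 lies inside
    the interval.\<close>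
  define d' where "d' = min d (b - c)"
  have d': "0 < d'" "d' \<le> d" "c + d' \<le> b" using d c by (auto simp: d'_def)
  obtain M where M: "0 < M" "1 < real M * d'"
    using reals_Archimedean3[OF d'(1)] by (metis gr0I mult_zero_left not_one_less_zero of_nat_0)
  have "norm ((\<integral>x. k m x *\<^sub>R w x \<partial>Leb a b) - w c) < e" if m: "M \<le> m" for m
  proof -
    have md: "1 < real m * d'"
      using M m d' by (smt (verit) mult_right_mono of_nat_mono)
    have m0: "0 < m" using m M by simp
    have zero: "k m x = 0" if "\<not> \<bar>x - c\<bar> < d" for x
    proof (cases "x < c")
      case True
      have "((\<lambda>x. 0) has_real_derivative k m x) (at x)"
        by (rule has_field_derivative_transform_within_open[OF D, of "{..<c}"])
           (use True in \<open>auto simp: S_def smooth_step_0 mult_left_mono\<close>)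
      then show ?thesis using DERIV_unique DERIV_const by blast
    next
      case False
      then have x: "c + d' \<le> x" using that d' by simp
      have one: "1 < real m * (y - c) \<longleftrightarrow> c + 1 / real m < y" for y
        using m0 by (simp add: field_simps)
      have "real m * d' \<le> real m * (x - c)" using x by (intro mult_left_mono) auto
      then have x': "c + 1 / real m < x" using md one[of x] by simp
      have "((\<lambda>x. 1) has_real_derivative k m x) (at x)"
      proof (rule has_field_derivative_transform_within_open[OF D, of "{c + 1 / real m<..}"])
        show "S m y = 1" if "y \<in> {c + 1 / real m<..}" for y
          using one[of y] that by (simp add: S_def smooth_step_1 algebra_simps)
      qed (use x' in auto)
      then show ?thesis using DERIV_unique DERIV_const by blast
    qed
    have int1: "(\<integral>x. k m x \<partial>Leb a b) = 1"
    proof -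
      have "(k m has_integral S m b - S m a) {a..b}"
        using c D by (intro fundamental_theorem_of_calculus)
          (auto simp flip: has_real_derivative_iff_has_vector_derivative intro: DERIV_subset)
      moreover have "S m b = 1"
      proof -
        have "real m * d' \<le> real m * (b - c)" using d' by (intro mult_left_mono) auto
        then have "1 \<le> real m * b + - (real m * c)" using md by (simp add: algebra_simps)
        then show ?thesis by (simp add: S_def smooth_step_1)
      qed
      moreover have "S m a = 0"
        using c by (simp add: S_def smooth_step_0 mult_left_mono)
      ultimately show ?thesis
        using integrable_Leb_imp(2)[OF continuous_integrable_Leb[OF cont, of m]] by (simp add: integral_unique)
    qed
    have "norm ((\<integral>x. k m x *\<^sub>R w x \<partial>Leb a b) - w c) = norm (\<integral>x. k m x *\<^sub>R (w x - w c) \<partial>Leb a b)"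
    proof -
      have "(\<integral>x. k m x *\<^sub>R (w x - w c) \<partial>Leb a b) = (\<integral>x. k m x *\<^sub>R w x \<partial>Leb a b) - (\<integral>x. k m x *\<^sub>R w c \<partial>Leb a b)"
        unfolding scaleR_diff_right
        by (intro Bochner_Integration.integral_diff continuous_integrable_Leb continuous_intros cont w)
      then show ?thesis
        using int1 Bochner_Integration.integral_scaleR_left[of "w c" "Leb a b" "k m"] continuous_integrable_Leb[OF cont, of m]
        by simp
    qed
    also have "\<dots> \<le> (\<integral>x. k m x * (e / 2) \<partial>Leb a b)"
    proof (rule Bochner_Integration.integral_norm_bound_integral)
      show "norm (k m x *\<^sub>R (w x - w c)) \<le> k m x * (e / 2)" for x
        using zero[of x] d(2)[of x] nonneg[of m x] mult_left_mono[of "norm (w x - w c)" "e / 2" "k m x"]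
        by (cases "\<bar>x - c\<bar> < d") auto
    qed (intro continuous_integrable_Leb continuous_intros cont w)+
    also have "\<dots> = e / 2" using int1 by simp
    also have "\<dots> < e" using e by simp
    finally show ?thesis .
  qed
  then show "\<exists>no. \<forall>m\<ge>no. norm ((\<integral>x. deriv (\<lambda>x. smooth_step (real m * x + - (real m * c))) x *\<^sub>R w x \<partial>Leb a b) - w c) < e"
    unfolding k_def S_def by blast
qed

text \<open>The definition is tested with the difference of two steep smooth steps at
  \<open>c\<close> and \<open>d\<close>, an approximation of the indicator of
  \<open>{c<..d}\<close>. Its derivative concentrates at \<open>c\<close> and, with opposite sign,
  at \<open>d\<close>.\<close>

lemma has_weak_deriv_ftc_interior:
  fixes f g w :: "real \<Rightarrow> 'v::euclidean_space"
  assumes weak: "has_weak_deriv a b f g" and f: "f \<in> borel_measurable (Leb a b)"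
    and g: "integrable (Leb a b) g"
    and w: "continuous_on {a..b} w" "ae_eq a b w f" and cd: "a < c" "c < d" "d < b"
  shows "w d - w c = integral {c..d} g"
proof -
  define S where "S m c x = smooth_step (real m * x + - (real m * c))" for m c x
  define \<phi> where "\<phi> m x = S m c x - S m d x" for m x
  have S: "S m c \<in> smooth_algebra" for m c unfolding S_def by (rule smooth_step_affine)
  have \<phi>: "\<phi> m \<in> smooth_algebra" for m unfolding \<phi>_def by (intro smooth_algebra_diff S)
  have cont: "continuous_on A F" if "F \<in> smooth_algebra" for A F
    using smooth_algebra_DERIV[OF that] by (auto intro!: DERIV_isCont continuous_at_imp_continuous_on)
  have deriv: "deriv (\<phi> m) x = deriv (S m c) x - deriv (S m d) x" for m x
    unfolding \<phi>_def by (intro DERIV_imp_deriv DERIV_diff smooth_algebra_DERIV S)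
  obtain M where M: "0 < M" "1 < real M * (b - d)"
    using reals_Archimedean3[of "b - d"] cd by (metis diff_gt_0_iff_gt gr0I mult_zero_left not_one_less_zero of_nat_0)
  have S0: "S m c x = 0" if "x \<le> c" for m c x
    using that by (simp add: S_def smooth_step_0 mult_left_mono)
  have S1: "S m c x = 1" if "1 \<le> real m * (x - c)" for m c x
    using that by (simp add: S_def smooth_step_1 algebra_simps)
  \<comment> \<open>The support reaches \<open>d + 1 / real m\<close>, which lies below
    \<open>b\<close> only for large \<open>m\<close>.\<close>
  have test: "\<phi> m \<in> test_functions a b" if m: "M \<le> m" for m
  proof -
    have md: "1 < real m * (b - d)"
      using M m cd by (smt (verit) mult_right_mono of_nat_mono)
    then have m0: "0 < real m" using cd by (cases "m = 0") auto
    have "\<phi> m x = 0" if "x \<notin> {c..d + 1 / real m}" for x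
    proof (cases "x < c")
      case True
      then show ?thesis using cd by (simp add: \<phi>_def S0)
    next
      case False
      then have x: "d + 1 / real m < x" using that by auto
      then have "1 \<le> real m * (x - d)" using m0 by (simp add: field_simps)
      moreover have "real m * (x - d) \<le> real m * (x - c)" using cd by (intro mult_left_mono) auto
      ultimately show ?thesis by (simp add: \<phi>_def S1)
    qed
    moreover have "d + 1 / real m < b" using md m0 by (simp add: field_simps)
    ultimately show ?thesis
      using smooth_algebra_smooth[OF \<phi>, of _ m] cd unfolding test_functions_def by blast
  qed
  have eq: "(\<integral>x. deriv (S m c) x *\<^sub>R w x \<partial>Leb a b) - (\<integral>x. deriv (S m d) x *\<^sub>R w x \<partial>Leb a b)
      = - (\<integral>x. \<phi> m x *\<^sub>R g x \<partial>Leb a b)" if m: "M \<le> m" for m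
  proof -
    have "(\<integral>x. deriv (S m c) x *\<^sub>R w x \<partial>Leb a b) - (\<integral>x. deriv (S m d) x *\<^sub>R w x \<partial>Leb a b)
      = (\<integral>x. deriv (S m c) x *\<^sub>R w x - deriv (S m d) x *\<^sub>R w x \<partial>Leb a b)"
      by (intro Bochner_Integration.integral_diff[symmetric] continuous_integrable_Leb continuous_intros w
          cont smooth_algebra_deriv S)
    also have "\<dots> = (\<integral>x. deriv (\<phi> m) x *\<^sub>R w x \<partial>Leb a b)"
      by (simp add: deriv scaleR_diff_left)
    also have "\<dots> = (\<integral>x. deriv (\<phi> m) x *\<^sub>R f x \<partial>Leb a b)"
    proof (rule integral_cong_AE)
      show "AE x in Leb a b. deriv (\<phi> m) x *\<^sub>R w x = deriv (\<phi> m) x *\<^sub>R f x"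
        using w(2) unfolding ae_eq_def by eventually_elim simp
    qed (intro borel_measurable_scaleR f continuous_measurable_Leb w cont smooth_algebra_deriv \<phi>)+
    also have "\<dots> = - (\<integral>x. \<phi> m x *\<^sub>R g x \<partial>Leb a b)"
      using weak test[OF m] unfolding has_weak_deriv_def by blast
    finally show ?thesis .
  qed
  have "(\<lambda>m. (\<integral>x. deriv (S m c) x *\<^sub>R w x \<partial>Leb a b) - (\<integral>x. deriv (S m d) x *\<^sub>R w x \<partial>Leb a b)) \<longlonglongrightarrow> w c - w d"
    unfolding S_def using cd by (intro tendsto_diff smooth_step_mollifier w) auto
  then have l1: "(\<lambda>m. - (\<integral>x. \<phi> m x *\<^sub>R g x \<partial>Leb a b)) \<longlonglongrightarrow> w c - w d"
    by (rule Lim_transform_eventually) (use eq in \<open>auto simp: eventually_sequentially\<close>)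
  have l2: "(\<lambda>m. \<integral>x. \<phi> m x *\<^sub>R g x \<partial>Leb a b) \<longlonglongrightarrow> (\<integral>x. indicator {c<..d} x *\<^sub>R g x \<partial>Leb a b)"
  proof (rule integral_dominated_convergence)
    show "integrable (Leb a b) (\<lambda>x. norm (g x))" using g by simp
    show "(\<lambda>x. indicat_real {c<..d} x *\<^sub>R g x) \<in> borel_measurable (Leb a b)"
      using borel_measurable_integrable[OF g] cd by (intro borel_measurable_scaleR borel_measurable_indicator)
        (auto simp: sets_restrict_space_iff)
    show "(\<lambda>x. \<phi> m x *\<^sub>R g x) \<in> borel_measurable (Leb a b)" for m
      by (intro borel_measurable_scaleR borel_measurable_integrable[OF g] continuous_measurable_Leb cont \<phi>)
    show "AE x in Leb a b. norm (\<phi> m x *\<^sub>R g x) \<le> norm (g x)" for m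
    proof (rule AE_LebI)
      fix x
      have "\<bar>\<phi> m x\<bar> \<le> 1"
        using smooth_step_range[of "real m * x + - (real m * c)"] smooth_step_range[of "real m * x + - (real m * d)"]
        unfolding \<phi>_def S_def by linarith
      then show "norm (\<phi> m x *\<^sub>R g x) \<le> norm (g x)" by (simp add: mult_left_le_one_le)
    qed
    show "AE x in Leb a b. (\<lambda>m. \<phi> m x *\<^sub>R g x) \<longlonglongrightarrow> indicat_real {c<..d} x *\<^sub>R g x"
    proof (rule AE_LebI)
      fix x
      have lim: "(\<lambda>m. S m c x) \<longlonglongrightarrow> indicat_real {c<..} x" for c
      proof (cases "c < x")
        case True
        obtain N where N: "1 < real N * (x - c)"
          using reals_Archimedean3[of "x - c"] True by auto
        have "S m c x = 1" if "N \<le> m" for m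
          using N that True by (intro S1) (smt (verit) mult_right_mono of_nat_mono)
        then show ?thesis
          using True by (intro tendsto_eventually) (auto simp: eventually_sequentially)
      next
        case False
        then show ?thesis by (simp add: S0)
      qed
      have "(\<lambda>m. \<phi> m x) \<longlonglongrightarrow> indicat_real {c<..} x - indicat_real {d<..} x"
        unfolding \<phi>_def by (intro tendsto_diff lim)
      also have "indicat_real {c<..} x - indicat_real {d<..} x = indicat_real {c<..d} x"
        using cd by (auto simp: indicator_def)
      finally show "(\<lambda>m. \<phi> m x *\<^sub>R g x) \<longlonglongrightarrow> indicat_real {c<..d} x *\<^sub>R g x"
        by (intro tendsto_intros)
    qed
  qed
  have "w c - w d = - (\<integral>x. indicator {c<..d} x *\<^sub>R g x \<partial>Leb a b)"
    by (rule LIMSEQ_unique[OF l1 tendsto_minus[OF l2]])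
  also have "(\<integral>x. indicator {c<..d} x *\<^sub>R g x \<partial>Leb a b) = integral {a..b} (\<lambda>x. indicator {c<..d} x *\<^sub>R g x)"
    by (rule integrable_Leb_imp(2), rule integrable_mult_indicator[OF _ g]) (use cd in \<open>auto simp: sets_restrict_space_iff\<close>)
  also have "\<dots> = integral {a..b} (\<lambda>x. if x \<in> {c..d} then g x else 0)"
    by (rule integral_spike[of "{c}"]) (auto simp: indicator_def)
  also have "\<dots> = integral {c..d} g"
    by (subst Henstock_Kurzweil_Integration.integral_restrict_Int) (use cd in \<open>simp add: Int_absorb2\<close>)
  finally show ?thesis by (simp add: algebra_simps)
qed

text \<open>The end points are reached by continuity: \<open>w\<close> minus the indefinite integral
  of \<open>g\<close> is continuous on the closed interval and constant on the open one.\<close>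

lemma has_weak_deriv_ftc:
  fixes f g w :: "real \<Rightarrow> 'v::euclidean_space"
  assumes weak: "has_weak_deriv a b f g" and f: "f \<in> borel_measurable (Leb a b)"
    and g: "integrable (Leb a b) g"
    and w: "continuous_on {a..b} w" "ae_eq a b w f" and cd: "a \<le> c" "c \<le> d" "d \<le> b"
  shows "(g has_integral (w d - w c)) {c..d}"
proof (cases "c = d")
  case True
  then show ?thesis using has_integral_refl(2)[of g c] by simp
next
  case False
  then have ab: "a < b" using cd by simp
  have gi: "g integrable_on {a..b}" by (rule integrable_Leb_imp(1)[OF g])
  have sub: "g integrable_on {u..v}" if "a \<le> u" "v \<le> b" for u v
    by (rule integrable_on_subinterval[OF gi]) (use that in auto)
  define G where "G x = w x - integral {a..x} g" for x
  have Gc: "continuous_on {a..b} G"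
    unfolding G_def by (intro continuous_intros w indefinite_integral_continuous_1 gi)
  have G_eq: "G d = G c" if "a < c" "c < d" "d < b" for c d
    using has_weak_deriv_ftc_interior[OF weak f g w that] that
      Henstock_Kurzweil_Integration.integral_combine[of a c d g] sub[of a d]
    by (simp add: G_def algebra_simps)
  obtain p where p: "a < p" "p < b" using dense[OF ab] by blast
  have "G x = G p" if "x \<in> {a..b}" for x
  proof (rule continuous_constant_on_closure[of "{a<..<b}"])
    show "continuous_on (closure {a<..<b}) G" using Gc ab by simp
    show "G y = G p" if "y \<in> {a<..<b}" for y
      using G_eq[of y p] G_eq[of p y] that p by (cases y p rule: linorder_cases) auto
    show "x \<in> closure {a<..<b}" using that ab by simp
  qed
  then have "G d = G c" using cd by simp
  then have "w d - w c = integral {a..d} g - integral {a..c} g"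
    by (simp add: G_def algebra_simps)
  also have "\<dots> = integral {c..d} g"
    using Henstock_Kurzweil_Integration.integral_combine[of a c d g] sub[of a d] cd
    by (simp add: diff_eq_eq add.commute)
  finally have "integral {c..d} g = w d - w c" by simp
  then show ?thesis using sub[of c d] cd by (simp add: has_integral_integrable_integral)
qed

text \<open>Lebesgue differentiation for the extension of \<open>g\<close> by 0: almost everywhere
  the value is the limit of averages, and all averages are 0.\<close>

lemma AE_zero_of_interval_integrals:
  fixes g :: "real \<Rightarrow> 'v::euclidean_space"
  assumes g: "integrable (Leb a b) g"
    and zero: "\<And>c d. a \<le> c \<Longrightarrow> c \<le> d \<Longrightarrow> d \<le> b \<Longrightarrow> (g has_integral 0) {c..d}"
  shows "AE x in Leb a b. g x = 0"
proof -
  define h where "h x = (if x \<in> {a..b} then g x else 0)" for x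
  have h: "(h has_integral 0) {c..d}" for c d
  proof -
    have "{a..b} \<inter> {c..d} = {max a c..min b d}" by auto
    moreover have "(g has_integral 0) {max a c..min b d}"
      using zero[of "max a c" "min b d"] by (cases "max a c \<le> min b d") auto
    ultimately show ?thesis
      unfolding h_def by (subst has_integral_restrict_Int) simp
  qed
  obtain N where N: "negligible N" and k: "\<And>x e. \<lbrakk>x \<notin> N; 0 < e\<rbrakk>
      \<Longrightarrow> \<exists>d>0. \<forall>\<delta>. 0 < \<delta> \<and> \<delta> < d \<longrightarrow>
        norm (integral (cbox x (x + \<delta> *\<^sub>R One)) h /\<^sub>R \<delta> ^ DIM(real) - h x) < e"
    using integrable_ccontinuous_explicit[of h] h by (metis box_real(2) has_integral_integrable)
  have "h x = 0" if x: "x \<notin> N" for x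
  proof (rule ccontr)
    assume "h x \<noteq> 0"
    then obtain d where "d > 0" "\<forall>\<delta>. 0 < \<delta> \<and> \<delta> < d \<longrightarrow>
        norm (integral (cbox x (x + \<delta> *\<^sub>R One)) h /\<^sub>R \<delta> ^ DIM(real) - h x) < norm (h x)"
      using k[OF x, of "norm (h x)"] by auto
    from this(2)[rule_format, of "d / 2"] this(1) show False
      using h[of x "x + d / 2"] by (simp add: integral_unique)
  qed
  moreover have "AE x in lebesgue. x \<notin> N"
    using N by (intro AE_not_in) (simp add: negligible_iff_null_sets)
  ultimately have "AE x in lebesgue. h x = 0" by (auto elim: eventually_mono)
  then have "AE x in Leb a b. h x = 0"
    by (simp add: AE_restrict_space_iff) (auto elim: eventually_mono)
  moreover have "AE x in Leb a b. a < x \<and> x < b" by (rule AE_LebI) simp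
  ultimately show ?thesis by eventually_elim (simp add: h_def)
qed

text \<open>Identifies the derivative that \<open>weak_deriv\<close> picks by \<open>SOME\<close>
  with an explicitly constructed one.\<close>

lemma has_weak_deriv_unique:
  fixes f g g' w :: "real \<Rightarrow> 'v::euclidean_space"
  assumes "has_weak_deriv a b f g" "has_weak_deriv a b f g'" and f: "f \<in> borel_measurable (Leb a b)"
    and g: "integrable (Leb a b) g" "integrable (Leb a b) g'"
    and w: "continuous_on {a..b} w" "ae_eq a b w f"
  shows "ae_eq a b g g'"
proof -
  have "AE x in Leb a b. g x - g' x = 0"
  proof (rule AE_zero_of_interval_integrals)
    fix c d assume cd: "a \<le> c" "c \<le> d" "d \<le> b"
    show "((\<lambda>x. g x - g' x) has_integral 0) {c..d}"
      using has_integral_diff[OF has_weak_deriv_ftc[OF assms(1) f g(1) w cd] has_weak_deriv_ftc[OF assms(2) f g(2) w cd]]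
      by simp
  qed (use g in auto)
  then show ?thesis by (simp add: ae_eq_def)
qed

section \<open>Wronskians of string equations\<close>

text \<open>Increments of second order force the derivative to be 0 at every point, so no
  exceptional null set has to be handled.\<close>

lemma constant_of_quadratic_modulus:
  fixes Q :: "real \<Rightarrow> 'v::real_normed_vector"
  assumes "\<And>x y. a \<le> x \<Longrightarrow> x \<le> y \<Longrightarrow> y \<le> b \<Longrightarrow> norm (Q y - Q x) \<le> K * (y - x)\<^sup>2"
    and x: "x \<in> {a..b}"
  shows "Q x = Q a"
proof -
  have bnd: "norm (Q y - Q x) \<le> K * (y - x)\<^sup>2" if "x \<in> {a..b}" "y \<in> {a..b}" for x y
    using assms(1)[of x y] assms(1)[of y x] that
    by (cases "x \<le> y") (auto simp: norm_minus_commute power2_commute)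
  have "(Q has_derivative (\<lambda>h. 0)) (at x within {a..b})" if x: "x \<in> {a..b}" for x
    unfolding has_derivative_within
  proof (rule conjI[OF _ Lim_null_comparison])
    show "\<forall>\<^sub>F y in at x within {a..b}. norm ((1 / norm (y - x)) *\<^sub>R (Q y - (Q x + 0))) \<le> K * \<bar>y - x\<bar>"
      unfolding eventually_at_filter
    proof (rule always_eventually, intro allI impI)
      fix y assume "y \<noteq> x" "y \<in> {a..b}"
      then show "norm ((1 / norm (y - x)) *\<^sub>R (Q y - (Q x + 0))) \<le> K * \<bar>y - x\<bar>"
        using bnd[OF x, of y] by (simp add: pos_divide_le_eq power2_eq_square mult.assoc)
    qed
    show "((\<lambda>y. K * \<bar>y - x\<bar>) \<longlongrightarrow> 0) (at x within {a..b})"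
      by (auto intro!: tendsto_eq_intros)
  qed simp
  then show ?thesis
    using has_derivative_zero_unique[of "{a..b}" Q a x] x by auto
qed

text \<open>A product rule for primitives that avoids differentiability almost everywhere: if the formal
  derivative of \<open>\<Sum>j. F j * G j\<close> vanishes, then the increments of this function are of second order.\<close>

lemma bilinear_conservation:
  fixes F G f g :: "'i \<Rightarrow> real \<Rightarrow> complex"
  assumes J: "finite J"
    and F: "\<And>j x y. j \<in> J \<Longrightarrow> a \<le> x \<Longrightarrow> x \<le> y \<Longrightarrow> y \<le> b \<Longrightarrow> (f j has_integral (F j y - F j x)) {x..y}"
    and G: "\<And>j x y. j \<in> J \<Longrightarrow> a \<le> x \<Longrightarrow> x \<le> y \<Longrightarrow> y \<le> b \<Longrightarrow> (g j has_integral (G j y - G j x)) {x..y}"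
    and f: "\<And>j x. j \<in> J \<Longrightarrow> x \<in> {a..b} \<Longrightarrow> cmod (f j x) \<le> C"
    and g: "\<And>j x. j \<in> J \<Longrightarrow> x \<in> {a..b} \<Longrightarrow> cmod (g j x) \<le> C"
    and zero: "\<And>s. s \<in> {a..b} \<Longrightarrow> (\<Sum>j\<in>J. f j s * G j s + F j s * g j s) = 0"
    and C: "0 \<le> C" and x: "x \<in> {a..b}"
  shows "(\<Sum>j\<in>J. F j x * G j x) = (\<Sum>j\<in>J. F j a * G j a)"
proof (rule constant_of_quadratic_modulus[OF _ x])
  fix x y assume xy: "a \<le> x" "x \<le> y" "y \<le> b"
  have lip: "cmod (H v - H u) \<le> C * (v - u)"
    if "(h has_integral (H v - H u)) {u..v}" "\<And>x. x \<in> {a..b} \<Longrightarrow> cmod (h x) \<le> C" "a \<le> u" "u \<le> v" "v \<le> b" for h H u v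
    using has_integral_bound_real[OF C finite.emptyI that(1)] that by simp
  \<comment> \<open>Its integral is the exact increment of the sum of products: \<open>G\<close> is
    frozen at the left end and \<open>F\<close> at the right end, which leaves no cross
    term.\<close>
  let ?e = "\<lambda>s. \<Sum>j\<in>J. f j s * G j x + F j y * g j s"
  have int: "(?e has_integral (\<Sum>j\<in>J. (F j y - F j x) * G j x + F j y * (G j y - G j x))) {x..y}"
    using F G xy by (intro has_integral_sum J has_integral_add has_integral_mult_left has_integral_mult_right) auto
  have "cmod (?e s) \<le> real (card J) * (2 * (C * C)) * (y - x)" if s: "s \<in> {x..y}" for s
  proof -
    \<comment> \<open>Subtracting the vanishing formal derivative leaves only increments of
      \<open>F\<close> and \<open>G\<close> over parts of \<open>{x..y}\<close>, each at most
      \<open>C * (y - x)\<close>.\<close>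
    have "?e s = ?e s - (\<Sum>j\<in>J. f j s * G j s + F j s * g j s)"
      using zero[of s] s xy by simp
    also have "\<dots> = (\<Sum>j\<in>J. f j s * (G j x - G j s) + (F j y - F j s) * g j s)"
      by (simp add: sum_subtractf[symmetric] algebra_simps)
    also have "cmod \<dots> \<le> (\<Sum>j\<in>J. 2 * (C * C) * (y - x))"
    proof (rule sum_norm_le)
      fix j assume j: "j \<in> J"
      have "cmod (G j s - G j x) \<le> C * (s - x)" "cmod (F j y - F j s) \<le> C * (y - s)"
        using s xy j by (auto intro!: lip F G f g)
      then have 1: "cmod (G j x - G j s) \<le> C * (y - x)" "cmod (F j y - F j s) \<le> C * (y - x)"
        using s C by (auto simp: norm_minus_commute elim!: order_trans intro!: mult_left_mono)
      have "cmod (f j s * (G j x - G j s) + (F j y - F j s) * g j s)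
          \<le> cmod (f j s) * cmod (G j x - G j s) + cmod (F j y - F j s) * cmod (g j s)"
        by (metis norm_mult norm_triangle_ineq)
      also have "\<dots> \<le> C * (C * (y - x)) + (C * (y - x)) * C"
        using 1 f[OF j, of s] g[OF j, of s] s xy C by (intro add_mono mult_mono) auto
      finally show "cmod (f j s * (G j x - G j s) + (F j y - F j s) * g j s) \<le> 2 * (C * C) * (y - x)"
        by (simp add: algebra_simps)
    qed
    finally show ?thesis by (simp add: mult.assoc)
  qed
  then have "cmod (\<Sum>j\<in>J. (F j y - F j x) * G j x + F j y * (G j y - G j x))
      \<le> real (card J) * (2 * (C * C)) * (y - x) * (y - x)"
    using has_integral_bound_real[OF _ finite.emptyI int, of "real (card J) * (2 * (C * C)) * (y - x)"] C xy by simp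
  also have "(\<Sum>j\<in>J. (F j y - F j x) * G j x + F j y * (G j y - G j x)) = (\<Sum>j\<in>J. F j y * G j y) - (\<Sum>j\<in>J. F j x * G j x)"
    by (simp add: sum_subtractf[symmetric] algebra_simps)
  finally show "cmod ((\<Sum>j\<in>J. F j y * G j y) - (\<Sum>j\<in>J. F j x * G j x)) \<le> (real (card J) * (2 * (C * C))) * (y - x)\<^sup>2"
    by (simp add: power2_eq_square mult.assoc)
qed

text \<open>The system u' = \<alpha> v, v' = \<gamma> u in integrated form, since coefficients that
  are only bounded and measurable do not give derivatives everywhere.\<close>

definition string_solution ::
  "real \<Rightarrow> real \<Rightarrow> (real \<Rightarrow> complex) \<Rightarrow> (real \<Rightarrow> complex) \<Rightarrow> (real \<Rightarrow> complex) \<Rightarrow> (real \<Rightarrow> complex) \<Rightarrow> bool" where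
  "string_solution a b \<alpha> \<gamma> u v \<longleftrightarrow> continuous_on {a..b} u \<and> continuous_on {a..b} v \<and>
     (\<forall>x y. a \<le> x \<and> x \<le> y \<and> y \<le> b \<longrightarrow>
        ((\<lambda>s. \<alpha> s * v s) has_integral (u y - u x)) {x..y} \<and>
        ((\<lambda>s. \<gamma> s * u s) has_integral (v y - v x)) {x..y})"

lemma string_solution_bounds:
  assumes "string_solution a b \<alpha> \<gamma> u v"
    and "\<And>x. x \<in> {a..b} \<Longrightarrow> cmod (\<alpha> x) \<le> B" "\<And>x. x \<in> {a..b} \<Longrightarrow> cmod (\<gamma> x) \<le> B" and B: "0 \<le> B"
  obtains C where "0 \<le> C" "\<And>x. x \<in> {a..b} \<Longrightarrow> cmod (\<alpha> x * v x) \<le> C" "\<And>x. x \<in> {a..b} \<Longrightarrow> cmod (\<gamma> x * u x) \<le> C"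
proof -
  obtain U V where UV: "\<And>x. x \<in> {a..b} \<Longrightarrow> cmod (u x) \<le> U" "\<And>x. x \<in> {a..b} \<Longrightarrow> cmod (v x) \<le> V"
    using continuous_bounded_Icc assms(1) unfolding string_solution_def by metis
  have le: "cmod (h x * w x) \<le> B * (\<bar>U\<bar> + \<bar>V\<bar>)" if "cmod (h x) \<le> B" "cmod (w x) \<le> \<bar>U\<bar> + \<bar>V\<bar>" for h w and x :: real
    using that B by (simp add: norm_mult mult_mono)
  show ?thesis
  proof (rule that[of "B * (\<bar>U\<bar> + \<bar>V\<bar>)"])
    show "cmod (\<alpha> x * v x) \<le> B * (\<bar>U\<bar> + \<bar>V\<bar>)" if "x \<in> {a..b}" for x
      using UV(2)[OF that] assms(2)[OF that] by (intro le) auto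
    show "cmod (\<gamma> x * u x) \<le> B * (\<bar>U\<bar> + \<bar>V\<bar>)" if "x \<in> {a..b}" for x
      using UV(1)[OF that] assms(3)[OF that] by (intro le) auto
  qed (use B in simp)
qed

lemma wronskian_constant:
  assumes 1: "string_solution a b \<alpha> \<gamma> u v" and 2: "string_solution a b \<alpha> \<gamma> p q"
    and \<alpha>: "\<And>x. x \<in> {a..b} \<Longrightarrow> cmod (\<alpha> x) \<le> B" and \<gamma>: "\<And>x. x \<in> {a..b} \<Longrightarrow> cmod (\<gamma> x) \<le> B"
    and B: "0 \<le> B" and x: "x \<in> {a..b}"
  shows "u x * q x - v x * p x = u a * q a - v a * p a"
proof -
  obtain C1 where C1: "0 \<le> C1" "\<And>x. x \<in> {a..b} \<Longrightarrow> cmod (\<alpha> x * v x) \<le> C1" "\<And>x. x \<in> {a..b} \<Longrightarrow> cmod (\<gamma> x * u x) \<le> C1"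
    using string_solution_bounds[OF 1 \<alpha> \<gamma> B] by blast
  obtain C2 where C2: "0 \<le> C2" "\<And>x. x \<in> {a..b} \<Longrightarrow> cmod (\<alpha> x * q x) \<le> C2" "\<And>x. x \<in> {a..b} \<Longrightarrow> cmod (\<gamma> x * p x) \<le> C2"
    using string_solution_bounds[OF 2 \<alpha> \<gamma> B] by blast
  have le: "cmod (\<alpha> x * v x) \<le> C1 + C2" "cmod (\<gamma> x * u x) \<le> C1 + C2"
    "cmod (\<alpha> x * q x) \<le> C1 + C2" "cmod (\<gamma> x * p x) \<le> C1 + C2" if "x \<in> {a..b}" for x
    using C1(2,3)[OF that] C2(2,3)[OF that] C1(1) C2(1) by linarith+
  \<comment> \<open>The Wronskian as a sum of two products indexed by \<open>bool\<close>:
    \<open>u * q\<close> for \<open>True\<close> and \<open>- v * p\<close> for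
    \<open>False\<close>. The four terms of its formal derivative cancel in pairs.\<close>
  have "(\<Sum>j\<in>UNIV. (if j then u x else - v x) * (if j then q x else p x))
      = (\<Sum>j\<in>UNIV. (if j then u a else - v a) * (if j then q a else p a))"
  proof (rule bilinear_conservation[of UNIV a b "\<lambda>j s. if j then \<alpha> s * v s else - (\<gamma> s * u s)"
        "\<lambda>j s. if j then u s else - v s" "\<lambda>j s. if j then \<gamma> s * p s else \<alpha> s * q s"
        "\<lambda>j s. if j then q s else p s" "C1 + C2"])
    fix j :: bool and x y assume "a \<le> x" "x \<le> y" "y \<le> b"
    then show "((\<lambda>s. if j then \<alpha> s * v s else - (\<gamma> s * u s)) has_integral
          (if j then u y else - v y) - (if j then u x else - v x)) {x..y}"
      "((\<lambda>s. if j then \<gamma> s * p s else \<alpha> s * q s) has_integral (if j then q y else p y) - (if j then q x else p x)) {x..y}"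
      using 1 2 has_integral_neg[of "\<lambda>s. \<gamma> s * u s" "v y - v x" "{x..y}"]
      by (auto simp: string_solution_def)
  qed (use le C1(1) C2(1) x in \<open>auto simp: UNIV_bool algebra_simps\<close>)
  then show ?thesis by (simp add: UNIV_bool algebra_simps)
qed

text \<open>For imaginary coefficients the pair with components \<open>- cnj (u x)\<close> and
  \<open>cnj (v x)\<close> solves the same system, and its Wronskian with the given solution is
  twice the claimed quantity.\<close>

lemma string_energy_flow_constant:
  assumes s: "string_solution a b \<alpha> \<gamma> u v"
    and \<alpha>: "\<And>x. x \<in> {a..b} \<Longrightarrow> cmod (\<alpha> x) \<le> B" and \<gamma>: "\<And>x. x \<in> {a..b} \<Longrightarrow> cmod (\<gamma> x) \<le> B"
    and im: "\<And>x. cnj (\<alpha> x) = - \<alpha> x" "\<And>x. cnj (\<gamma> x) = - \<gamma> x"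
    and B: "0 \<le> B" and x: "x \<in> {a..b}"
  shows "Re (cnj (u x) * v x) = Re (cnj (u a) * v a)"
proof -
  have s': "string_solution a b \<alpha> \<gamma> (\<lambda>x. - cnj (u x)) (\<lambda>x. cnj (v x))"
    unfolding string_solution_def
  proof (intro conjI allI impI)
    fix x y assume xy: "a \<le> x \<and> x \<le> y \<and> y \<le> b"
    have "((\<lambda>s. \<alpha> s * v s) has_integral u y - u x) {x..y}" "((\<lambda>s. \<gamma> s * u s) has_integral v y - v x) {x..y}"
      using s xy by (auto simp: string_solution_def)
    from has_integral_neg[OF has_integral_cnj[THEN iffD2, OF this(1)]] has_integral_cnj[THEN iffD2, OF this(2)]
    show "((\<lambda>s. \<alpha> s * cnj (v s)) has_integral - cnj (u y) - - cnj (u x)) {x..y}"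
      "((\<lambda>s. \<gamma> s * - cnj (u s)) has_integral cnj (v y) - cnj (v x)) {x..y}"
      by (simp_all add: im o_def)
  qed (use s in \<open>auto simp: string_solution_def intro!: continuous_intros\<close>)
  have "u x * cnj (v x) - v x * (- cnj (u x)) = u a * cnj (v a) - v a * (- cnj (u a))"
    by (rule wronskian_constant[OF s s' \<alpha> \<gamma> B x])
  from arg_cong[OF this, of Re] show ?thesis by (simp add: algebra_simps)
qed

section \<open>Completeness of the space of square integrable functions\<close>

lemma L2_I_bound:
  assumes g: "g \<in> borel_measurable (Leb a b)" and f: "f \<in> L2 a b"
    and le: "AE x in Leb a b. norm (g x) \<le> C * norm (f x)"
  shows "g \<in> L2 a b"
proof -
  have "integrable (Leb a b) (\<lambda>x. (norm (g x))\<^sup>2)"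
  proof (rule Bochner_Integration.integrable_bound)
    show "integrable (Leb a b) (\<lambda>x. C\<^sup>2 * (norm (f x))\<^sup>2)" using L2_sq_integrable[OF f] by simp
    show "AE x in Leb a b. norm ((norm (g x))\<^sup>2) \<le> norm (C\<^sup>2 * (norm (f x))\<^sup>2)"
      using le
    proof eventually_elim
      case (elim x)
      then show ?case using power_mono[OF elim, of 2] by (simp add: power_mult_distrib)
    qed
  qed (use g in measurable)
  then show ?thesis using g by (simp add: L2_def)
qed

lemma norm_add_sq_le: "(norm (u + v))\<^sup>2 \<le> 2 * (norm u)\<^sup>2 + 2 * (norm v)\<^sup>2"
  for u v :: "'v::real_normed_vector"
proof -
  have "(norm (u + v))\<^sup>2 \<le> (norm u + norm v)\<^sup>2" by (intro power_mono norm_triangle_ineq) simp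
  also have "\<dots> \<le> 2 * (norm u)\<^sup>2 + 2 * (norm v)\<^sup>2"
    using sum_squares_bound[of "norm u" "norm v"] by (simp add: power2_sum)
  finally show ?thesis .
qed

lemma L2_add:
  assumes f: "f \<in> L2 a b" and g: "g \<in> L2 a b"
  shows "(\<lambda>x. f x + g x) \<in> L2 a b"
proof -
  have m: "(\<lambda>x. f x + g x) \<in> borel_measurable (Leb a b)"
    using L2_measurable[OF f] L2_measurable[OF g] by measurable
  have "integrable (Leb a b) (\<lambda>x. (norm (f x + g x))\<^sup>2)"
  proof (rule Bochner_Integration.integrable_bound)
    show "integrable (Leb a b) (\<lambda>x. 2 * (norm (f x))\<^sup>2 + 2 * (norm (g x))\<^sup>2)"
      using L2_sq_integrable[OF f] L2_sq_integrable[OF g] by simp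
    show "AE x in Leb a b. norm ((norm (f x + g x))\<^sup>2) \<le> norm (2 * (norm (f x))\<^sup>2 + 2 * (norm (g x))\<^sup>2)"
      using norm_add_sq_le by (intro always_eventually) auto
  qed (use m in measurable)
  with m show ?thesis by (simp add: L2_def)
qed

lemma L2_bounded_linear:
  assumes L: "bounded_linear L" and f: "f \<in> L2 a b"
  shows "(\<lambda>x. L (f x)) \<in> L2 a b"
proof -
  obtain K where K: "\<And>x. norm (L x) \<le> norm x * K" using bounded_linear.bounded[OF L] by blast
  show ?thesis
    by (rule L2_I_bound[OF _ f, of _ K])
       (use K L2_measurable[OF f] in \<open>auto simp: mult.commute
          intro!: borel_measurable_continuous_on[of L] bounded_linear.continuous_on[OF L] continuous_intros\<close>)
qed

lemma L2_scaleR: "f \<in> L2 a b \<Longrightarrow> (\<lambda>x. c *\<^sub>R f x) \<in> L2 a b"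
  by (rule L2_bounded_linear[OF bounded_linear_scaleR_right])

lemma L2_zero: "(\<lambda>x. 0) \<in> L2 a b"
  by (simp add: continuous_L2)

lemma L2_diff:
  assumes f: "f \<in> L2 a b" and g: "g \<in> L2 a b"
  shows "(\<lambda>x. f x - g x) \<in> L2 a b"
  using L2_add[OF f L2_scaleR[OF g, of "-1"]] by simp

text \<open>A substitute for the Cauchy-Schwarz inequality of integrals, with a parameter
  \<open>s\<close> to be chosen at each use: it bounds first powers by squares in the completeness
  proof and in the equicontinuity estimate.\<close>

lemma le_add_sq_div: "0 < s \<Longrightarrow> u \<le> s + u\<^sup>2 / s" for u s :: real
proof (cases "u \<le> s")
  case False
  assume s: "0 < s"
  then have "s * u \<le> u * u" using False by (intro mult_right_mono) auto
  then have "u \<le> u\<^sup>2 / s" using s by (simp add: field_simps power2_eq_square)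
  then show ?thesis using s by simp
qed (simp add: add_increasing2)

lemma integral_le_of_sq_integral:
  fixes u :: "real \<Rightarrow> real"
  assumes ab: "a \<le> b" and s: "0 < s" and u: "u \<in> L2 a b"
  shows "(\<integral>x. u x \<partial>Leb a b) \<le> s * (b - a) + (\<integral>x. (norm (u x))\<^sup>2 \<partial>Leb a b) / s"
proof -
  interpret finite_measure "Leb a b" by (rule finite_measure_Leb)
  have le: "u x \<le> s + (norm (u x))\<^sup>2 / s" for x
    using le_add_sq_div[OF s, of "u x"] by simp
  have "(\<integral>x. u x \<partial>Leb a b) \<le> (\<integral>x. s + (norm (u x))\<^sup>2 / s \<partial>Leb a b)"
    using L2_integrable[OF u] L2_sq_integrable[OF u] le by (intro integral_mono) auto
  also have "\<dots> = s * (b - a) + (\<integral>x. (norm (u x))\<^sup>2 \<partial>Leb a b) / s"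
    using L2_sq_integrable[OF u] ab
    by (subst Bochner_Integration.integral_add) (auto simp: measure_restrict_space space_restrict_space)
  finally show ?thesis .
qed

text \<open>Riesz-Fischer: a rapidly converging subsequence has summable increments and hence
  converges almost everywhere. Fatou's lemma turns the Cauchy bound into a bound on the distance to
  the pointwise limit, which also shows that the limit is square integrable.\<close>

theorem L2_complete:
  fixes f :: "nat \<Rightarrow> real \<Rightarrow> 'v::euclidean_space"
  assumes ab: "a \<le> b" and f: "\<And>n. f n \<in> L2 a b"
    and cauchy: "\<And>e. 0 < e \<Longrightarrow> \<exists>N. \<forall>m\<ge>N. \<forall>n\<ge>N. (\<integral>x. (norm (f m x - f n x))\<^sup>2 \<partial>Leb a b) < e"
  obtains l where "l \<in> L2 a b" "(\<lambda>n. \<integral>x. (norm (f n x - l x))\<^sup>2 \<partial>Leb a b) \<longlonglongrightarrow> 0"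
proof -
  let ?M = "Leb a b"
  note [measurable] = L2_measurable[OF f]
  have "\<exists>N. \<forall>m\<ge>N. \<forall>n\<ge>N. (\<integral>x. (norm (f m x - f n x))\<^sup>2 \<partial>?M) < (1/4) ^ k" for k :: nat
    by (rule cauchy) simp
  then obtain N where N: "\<And>k m n. N k \<le> m \<Longrightarrow> N k \<le> n \<Longrightarrow> (\<integral>x. (norm (f m x - f n x))\<^sup>2 \<partial>?M) < (1/4) ^ k"
    by metis
  \<comment> \<open>Adding up all earlier thresholds puts \<open>r k\<close> beyond
    \<open>N j\<close> for every \<open>j \<le> k\<close>, without assuming that \<open>N\<close> is
    monotone.\<close>
  define r where "r k = (\<Sum>i\<le>k. N i) + k" for k
  have rN: "N j \<le> r k" if "j \<le> k" for j k
    using that member_le_sum[of j "{..k}" N] by (simp add: r_def trans_le_add1)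
  define u where "u k x = norm (f (r (Suc k)) x - f (r k) x)" for k x
  have [measurable]: "u k \<in> borel_measurable ?M" for k unfolding u_def by measurable
  have u_nonneg: "0 \<le> u k x" for k x by (simp add: u_def)
  have uL: "u k \<in> L2 a b" for k
    by (rule L2_I_bound[OF _ L2_diff[OF f f], where C = 1]) (auto simp: u_def)
  \<comment> \<open>The free parameter is \<open>(1/2) ^ k\<close>, which balances it against the
    squared bound \<open>(1/4) ^ k\<close> and leaves a summable sequence.\<close>
  have u_int: "(\<integral>x. u k x \<partial>?M) \<le> (1/2) ^ k * (b - a + 1)" for k
  proof -
    have "(\<integral>x. u k x \<partial>?M) \<le> (1/2) ^ k * (b - a) + (\<integral>x. (norm (u k x))\<^sup>2 \<partial>?M) / (1/2) ^ k"
      by (rule integral_le_of_sq_integral[OF ab _ uL]) simp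
    also have "(\<integral>x. (norm (u k x))\<^sup>2 \<partial>?M) \<le> (1/4) ^ k"
      using N[of k "r (Suc k)" "r k"] rN[of k k] rN[of k "Suc k"] by (simp add: u_def)
    then have "(\<integral>x. (norm (u k x))\<^sup>2 \<partial>?M) / (1/2) ^ k \<le> (1/4) ^ k / (1/2) ^ k"
      by (intro divide_right_mono) auto
    also have "(1/4) ^ k / (1/2) ^ k = ((1/2::real)) ^ k"
      by (simp flip: power_divide)
    finally show ?thesis by (simp add: algebra_simps)
  qed
  have "(\<integral>\<^sup>+x. (\<Sum>k. ennreal (u k x)) \<partial>?M) = (\<Sum>k. \<integral>\<^sup>+x. ennreal (u k x) \<partial>?M)"
    by (rule nn_integral_suminf) measurable
  also have "\<dots> \<le> (\<Sum>k. ennreal ((1/2) ^ k * (b - a + 1)))"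
  proof (rule suminf_le)
    show "(\<integral>\<^sup>+x. ennreal (u k x) \<partial>?M) \<le> ennreal ((1/2) ^ k * (b - a + 1))" for k
      using u_int[of k] L2_integrable[OF uL[of k]]
      by (subst nn_integral_eq_integral) (auto simp: u_nonneg intro!: ennreal_leI)
  qed auto
  also have "\<dots> < \<infinity>"
  proof -
    have "summable (\<lambda>k. (1/2::real) ^ k * (b - a + 1))"
      by (intro summable_mult2 summable_geometric) simp
    then show ?thesis using ab by (subst suminf_ennreal2) auto
  qed
  finally have "AE x in ?M. (\<Sum>k. ennreal (u k x)) \<noteq> \<infinity>"
    by (intro nn_integral_PInf_AE) auto
  then have conv: "AE x in ?M. (\<lambda>k. f (r k) x) \<longlonglongrightarrow> lim (\<lambda>k. f (r k) x)"
  proof eventually_elim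
    case (elim x)
    then have "summable (\<lambda>k. u k x)"
      by (intro summable_suminf_not_top) (auto simp: u_def top.not_eq_extremum less_top)
    then have "summable (\<lambda>k. f (r (Suc k)) x - f (r k) x)"
      unfolding u_def by (rule summable_norm_cancel)
    then have "(\<lambda>n. \<Sum>k<n. f (r (Suc k)) x - f (r k) x) \<longlonglongrightarrow> (\<Sum>k. f (r (Suc k)) x - f (r k) x)"
      by (rule summable_LIMSEQ)
    then have "(\<lambda>n. f (r n) x - f (r 0) x + f (r 0) x) \<longlonglongrightarrow> (\<Sum>k. f (r (Suc k)) x - f (r k) x) + f (r 0) x"
      unfolding sum_lessThan_telescope[of "\<lambda>k. f (r k) x"] by (intro tendsto_intros)
    then have "convergent (\<lambda>k. f (r k) x)" by (simp add: convergentI)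
    then show ?case by (simp only: convergent_LIMSEQ_iff)
  qed
  define l where "l x = lim (\<lambda>k. f (r k) x)" for x
  have [measurable]: "l \<in> borel_measurable ?M"
    unfolding l_def by (rule borel_measurable_lim_metric) simp
  have fatou: "(\<integral>\<^sup>+x. ennreal ((norm (f n x - l x))\<^sup>2) \<partial>?M) \<le> ennreal ((1/4) ^ k)" if n: "N k \<le> n" for n k
  proof -
    have "(\<integral>\<^sup>+x. ennreal ((norm (f n x - l x))\<^sup>2) \<partial>?M)
        = (\<integral>\<^sup>+x. liminf (\<lambda>j. ennreal ((norm (f n x - f (r j) x))\<^sup>2)) \<partial>?M)"
    proof (rule nn_integral_cong_AE)
      show "AE x in ?M. ennreal ((norm (f n x - l x))\<^sup>2) = liminf (\<lambda>j. ennreal ((norm (f n x - f (r j) x))\<^sup>2))"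
        using conv
      proof eventually_elim
        case (elim x)
        then have "(\<lambda>j. ennreal ((norm (f n x - f (r j) x))\<^sup>2)) \<longlonglongrightarrow> ennreal ((norm (f n x - l x))\<^sup>2)"
          unfolding l_def by (intro tendsto_intros)
        then show ?case by (intro lim_imp_Liminf[symmetric]) auto
      qed
    qed
    also have "\<dots> \<le> liminf (\<lambda>j. \<integral>\<^sup>+x. ennreal ((norm (f n x - f (r j) x))\<^sup>2) \<partial>?M)"
      by (rule nn_integral_liminf) measurable
    also have "\<dots> \<le> ennreal ((1/4) ^ k)"
    proof (rule Liminf_le)
      show "\<forall>\<^sub>F j in sequentially. (\<integral>\<^sup>+x. ennreal ((norm (f n x - f (r j) x))\<^sup>2) \<partial>?M) \<le> ennreal ((1/4) ^ k)"
        using eventually_ge_at_top[of k]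
      proof eventually_elim
        case (elim j)
        then show ?case
          using N[OF n rN[OF elim]] L2_sq_integrable[OF L2_diff[OF f f], of n "r j"]
          by (subst nn_integral_eq_integral) (auto intro!: ennreal_leI)
      qed
    qed simp
    finally show ?thesis .
  qed
  have int: "integrable ?M (\<lambda>x. (norm (f n x - l x))\<^sup>2)" if "N k \<le> n" for n k
    using fatou[OF that] by (intro integrableI_bounded) (auto intro: le_less_trans)
  have le: "(\<integral>x. (norm (f n x - l x))\<^sup>2 \<partial>?M) \<le> (1/4) ^ k" if "N k \<le> n" for n k
    using fatou[OF that] nn_integral_eq_integral[OF int[OF that]] by (simp add: ennreal_le_iff)
  have "(\<lambda>x. f (N 0) x - l x) \<in> L2 a b" using int[of 0 "N 0"] by (simp add: L2_def)
  from L2_diff[OF f[of "N 0"] this] have "l \<in> L2 a b" by simp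
  moreover have "(\<lambda>n. \<integral>x. (norm (f n x - l x))\<^sup>2 \<partial>?M) \<longlonglongrightarrow> 0"
  proof (rule LIMSEQ_I)
    fix e :: real assume "0 < e"
    then obtain k where "(1/4::real) ^ k < e" using real_arch_pow_inv[of e "1/4"] by auto
    then show "\<exists>no. \<forall>n\<ge>no. norm ((\<integral>x. (norm (f n x - l x))\<^sup>2 \<partial>?M) - 0) < e"
      using le[of k] by (intro exI[of _ "N k"]) (auto simp: abs_of_nonneg intro: le_less_trans)
  qed
  ultimately show ?thesis by (rule that)
qed

section \<open>The state space of the string network\<close>

lemma exhaust_6: "x = 1 \<or> x = 2 \<or> x = 3 \<or> x = 4 \<or> x = 5 \<or> x = 6" for x :: 6
proof (induct x)
  case (of_int z)
  then have "z = 0 \<or> z = 1 \<or> z = 2 \<or> z = 3 \<or> z = 4 \<or> z = 5" by fastforce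
  then show ?case by auto
qed

lemma exhaust_12:
  "x = 1 \<or> x = 2 \<or> x = 3 \<or> x = 4 \<or> x = 5 \<or> x = 6 \<or> x = 7 \<or> x = 8 \<or> x = 9 \<or> x = 10 \<or> x = 11 \<or> x = 12"
  for x :: 12
proof (induct x)
  case (of_int z)
  then have "0 \<le> z" "z < 12" by simp_all
  then have "z = 0 \<or> z = 1 \<or> z = 2 \<or> z = 3 \<or> z = 4 \<or> z = 5 \<or> z = 6 \<or> z = 7 \<or> z = 8 \<or> z = 9 \<or> z = 10 \<or> z = 11"
    by presburger
  then show ?case by auto
qed

lemma UNIV_6: "(UNIV :: 6 set) = {1, 2, 3, 4, 5, 6}"
  using exhaust_6 by auto

lemma UNIV_12: "(UNIV :: 12 set) = {1, 2, 3, 4, 5, 6, 7, 8, 9, 10, 11, 12}"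
  using exhaust_12 by auto

lemma forall_6: "(\<forall>i::6. P i) \<longleftrightarrow> P 1 \<and> P 2 \<and> P 3 \<and> P 4 \<and> P 5 \<and> P 6"
  by (metis exhaust_6)

lemma sum_6: "sum f (UNIV :: 6 set) = f 1 + f 2 + f 3 + f 4 + f 5 + f 6"
  unfolding UNIV_6 by (simp add: ac_simps)

lemma sum_12: "sum f (UNIV :: 12 set) =
    f 1 + f 2 + f 3 + f 4 + f 5 + f 6 + f 7 + f 8 + f 9 + f 10 + f 11 + f 12"
  unfolding UNIV_12 by (simp add: ac_simps)

lemma vector_6 [simp]:
  "(vector [x1,x2,x3,x4,x5,x6] :: 'a::zero^6) $ 1 = x1"
  "(vector [x1,x2,x3,x4,x5,x6] :: 'a::zero^6) $ 2 = x2"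
  "(vector [x1,x2,x3,x4,x5,x6] :: 'a::zero^6) $ 3 = x3"
  "(vector [x1,x2,x3,x4,x5,x6] :: 'a::zero^6) $ 4 = x4"
  "(vector [x1,x2,x3,x4,x5,x6] :: 'a::zero^6) $ 5 = x5"
  "(vector [x1,x2,x3,x4,x5,x6] :: 'a::zero^6) $ 6 = x6"
  unfolding vector_def by simp_all

lemma vector_12 [simp]:
  "(vector [x1,x2,x3,x4,x5,x6,x7,x8,x9,x10,x11,x12] :: 'a::zero^12) $ 1 = x1"
  "(vector [x1,x2,x3,x4,x5,x6,x7,x8,x9,x10,x11,x12] :: 'a::zero^12) $ 2 = x2"
  "(vector [x1,x2,x3,x4,x5,x6,x7,x8,x9,x10,x11,x12] :: 'a::zero^12) $ 3 = x3"
  "(vector [x1,x2,x3,x4,x5,x6,x7,x8,x9,x10,x11,x12] :: 'a::zero^12) $ 4 = x4"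
  "(vector [x1,x2,x3,x4,x5,x6,x7,x8,x9,x10,x11,x12] :: 'a::zero^12) $ 5 = x5"
  "(vector [x1,x2,x3,x4,x5,x6,x7,x8,x9,x10,x11,x12] :: 'a::zero^12) $ 6 = x6"
  "(vector [x1,x2,x3,x4,x5,x6,x7,x8,x9,x10,x11,x12] :: 'a::zero^12) $ 7 = x7"
  "(vector [x1,x2,x3,x4,x5,x6,x7,x8,x9,x10,x11,x12] :: 'a::zero^12) $ 8 = x8"
  "(vector [x1,x2,x3,x4,x5,x6,x7,x8,x9,x10,x11,x12] :: 'a::zero^12) $ 9 = x9"
  "(vector [x1,x2,x3,x4,x5,x6,x7,x8,x9,x10,x11,x12] :: 'a::zero^12) $ 10 = x10"
  "(vector [x1,x2,x3,x4,x5,x6,x7,x8,x9,x10,x11,x12] :: 'a::zero^12) $ 11 = x11"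
  "(vector [x1,x2,x3,x4,x5,x6,x7,x8,x9,x10,x11,x12] :: 'a::zero^12) $ 12 = x12"
  unfolding vector_def by simp_all

lemma P1_mult: "P1 *v u = vector [u $ 2, u $ 1, u $ 4, u $ 3, u $ 6, u $ 5]"
  by (simp add: vec_eq_iff forall_6 P1_def Let_def block_diag3_def matrix_vector_mult_def sum_6)

lemma P1_P1: "P1 *v (P1 *v u) = u"
  by (simp add: P1_mult vec_eq_iff forall_6)

lemma norm_sq_vec: "(norm u)\<^sup>2 = (\<Sum>i\<in>UNIV. (norm (u $ i))\<^sup>2)" for u :: "'a::real_normed_vector ^ 'n"
  by (simp add: norm_vec_def L2_set_def sum_nonneg)

lemma norm_P1: "norm (P1 *v u) = norm u"
  by (rule power2_eq_imp_eq) (simp_all add: norm_sq_vec sum_6 P1_mult)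

lemma W_B_iff:
  "W_B \<beta> *v stack u v = 0 \<longleftrightarrow> u $ 1 = u $ 3 \<and> u $ 1 = u $ 5 \<and>
     complex_of_real \<beta> * u $ 1 + u $ 2 + u $ 4 + u $ 6 = 0 \<and> v $ 1 = 0 \<and> v $ 4 = 0 \<and> v $ 6 = 0"
  by (simp add: vec_eq_iff forall_6 W_B_def stack_def matrix_vector_mult_def sum_12)

definition ham_diag ::
  "(string_label \<Rightarrow> real \<Rightarrow> real) \<Rightarrow> (string_label \<Rightarrow> real \<Rightarrow> real) \<Rightarrow> real \<Rightarrow> real^6" where
  "ham_diag T \<rho> \<zeta> = vector [1 / \<rho> S_I \<zeta>, T S_I \<zeta>, 1 / \<rho> S_II \<zeta>, T S_II \<zeta>, 1 / \<rho> S_III \<zeta>, T S_III \<zeta>]"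

lemma hamiltonian_mult: "hamiltonian T \<rho> \<zeta> *v u = (\<chi> i. complex_of_real (ham_diag T \<rho> \<zeta> $ i) * u $ i)"
  by (simp add: vec_eq_iff forall_6 hamiltonian_def H_string_def ham_diag_def block_diag3_def
      matrix_vector_mult_def sum_6)

text \<open>Pointwise operations turn the representatives themselves into vectors, so that
  \<open>semi_hilbert\<close> can be interpreted on them.\<close>

instantiation "fun" :: (type, real_vector) real_vector
begin

definition scaleR_fun :: "real \<Rightarrow> ('a \<Rightarrow> 'b) \<Rightarrow> 'a \<Rightarrow> 'b" where
  "scaleR_fun r f = (\<lambda>x. r *\<^sub>R f x)"

instance
  by standard (auto simp: fun_eq_iff scaleR_fun_def algebra_simps)

end

lemmas fun_ops = plus_fun_def fun_diff_def zero_fun_def fun_Compl_def scaleR_fun_def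

lemma borel_measurable_vec_nth:
  fixes f :: "'a \<Rightarrow> 'b::euclidean_space ^ 'n"
  assumes "f \<in> borel_measurable M"
  shows "(\<lambda>x. f x $ i) \<in> borel_measurable M"
  by (rule borel_measurable_continuous_on[OF _ assms]) (intro continuous_intros)

lemma borel_measurable_vec:
  fixes f :: "'a \<Rightarrow> 'b::euclidean_space ^ 'n"
  assumes "\<And>i. (\<lambda>x. f x $ i) \<in> borel_measurable M"
  shows "f \<in> borel_measurable M"
  by (subst borel_measurable_euclidean_space) (use assms in \<open>auto simp: Basis_vec_def inner_axis\<close>)

section \<open>The energy space as a complete semi-inner product space\<close>

locale string_network =
  fixes a b \<beta> \<epsilon>\<^sub>0 :: real and T \<rho> :: "string_label \<Rightarrow> real \<Rightarrow> real"
  assumes ab: "a < b" and \<beta>: "\<beta> > 0"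
    and T_Linf: "\<And>k. T k \<in> L_infty a b" and \<rho>_Linf: "\<And>k. \<rho> k \<in> L_infty a b"
    and \<epsilon>\<^sub>0: "\<epsilon>\<^sub>0 > 0"
    and lower: "\<And>k. AE \<zeta> in Leb a b. T k \<zeta> \<ge> \<epsilon>\<^sub>0 \<and> \<rho> k \<zeta> \<ge> \<epsilon>\<^sub>0"
begin

abbreviation H :: "real \<Rightarrow> complex^6^6" where "H \<equiv> hamiltonian T \<rho>"

abbreviation h :: "real \<Rightarrow> real^6" where "h \<equiv> ham_diag T \<rho>"

abbreviation X :: "(real \<Rightarrow> complex^6) set" where "X \<equiv> L2 a b"

text \<open>The real part induces the same norm as the complex inner product and fits the real
  theory.\<close>

definition ip :: "(real \<Rightarrow> complex^6) \<Rightarrow> (real \<Rightarrow> complex^6) \<Rightarrow> real" where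
  "ip f g = Re (inner_H a b H f g)"

lemma coefficient_bounds:
  obtains C where "0 < C" "C \<ge> \<epsilon>\<^sub>0"
    "AE \<zeta> in Leb a b. \<forall>k. \<epsilon>\<^sub>0 \<le> T k \<zeta> \<and> T k \<zeta> \<le> C \<and> \<epsilon>\<^sub>0 \<le> \<rho> k \<zeta> \<and> \<rho> k \<zeta> \<le> C"
proof -
  have "\<exists>C. AE \<zeta> in Leb a b. \<bar>T k \<zeta>\<bar> \<le> C" "\<exists>C. AE \<zeta> in Leb a b. \<bar>\<rho> k \<zeta>\<bar> \<le> C" for k
    using T_Linf[of k] \<rho>_Linf[of k] by (auto simp: L_infty_def)
  then obtain B B' where B: "\<And>k. AE \<zeta> in Leb a b. \<bar>T k \<zeta>\<bar> \<le> B k" "\<And>k. AE \<zeta> in Leb a b. \<bar>\<rho> k \<zeta>\<bar> \<le> B' k"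
    by metis
  define C where "C = \<epsilon>\<^sub>0 + (\<bar>B S_I\<bar> + \<bar>B S_II\<bar> + \<bar>B S_III\<bar>) + (\<bar>B' S_I\<bar> + \<bar>B' S_II\<bar> + \<bar>B' S_III\<bar>)"
  have C: "\<epsilon>\<^sub>0 \<le> C" "B k \<le> C" "B' k \<le> C" for k
    using \<epsilon>\<^sub>0 unfolding C_def by (cases k; simp)+
  have "AE \<zeta> in Leb a b. \<epsilon>\<^sub>0 \<le> T k \<zeta> \<and> T k \<zeta> \<le> C \<and> \<epsilon>\<^sub>0 \<le> \<rho> k \<zeta> \<and> \<rho> k \<zeta> \<le> C" for k
    using lower[of k] B(1)[of k] B(2)[of k]
  proof eventually_elim
    case (elim \<zeta>)
    then show ?case using C(2,3)[of k] by linarith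
  qed
  from this[of S_I] this[of S_II] this[of S_III]
  have "AE \<zeta> in Leb a b. \<forall>k. \<epsilon>\<^sub>0 \<le> T k \<zeta> \<and> T k \<zeta> \<le> C \<and> \<epsilon>\<^sub>0 \<le> \<rho> k \<zeta> \<and> \<rho> k \<zeta> \<le> C"
  proof eventually_elim
    case (elim \<zeta>)
    show ?case
    proof
      fix k
      show "\<epsilon>\<^sub>0 \<le> T k \<zeta> \<and> T k \<zeta> \<le> C \<and> \<epsilon>\<^sub>0 \<le> \<rho> k \<zeta> \<and> \<rho> k \<zeta> \<le> C"
        using elim by (cases k) simp_all
    qed
  qed
  then show ?thesis using C(1) \<epsilon>\<^sub>0 by (intro that[of C]) auto
qed

lemma h_bounds_ex:
  "\<exists>m M. 0 < m \<and> m \<le> M \<and> (AE \<zeta> in Leb a b. \<forall>i. m \<le> h \<zeta> $ i \<and> h \<zeta> $ i \<le> M)"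
proof -
  obtain C where C: "0 < C" "C \<ge> \<epsilon>\<^sub>0"
    and ae: "AE \<zeta> in Leb a b. \<forall>k. \<epsilon>\<^sub>0 \<le> T k \<zeta> \<and> T k \<zeta> \<le> C \<and> \<epsilon>\<^sub>0 \<le> \<rho> k \<zeta> \<and> \<rho> k \<zeta> \<le> C"
    using coefficient_bounds by blast
  \<comment> \<open>The diagonal of the Hamiltonian mixes \<open>T\<close> and
    \<open>1 / \<rho>\<close>, so both the coefficient bounds and their reciprocals occur.\<close>
  have "AE \<zeta> in Leb a b. \<forall>i. min \<epsilon>\<^sub>0 (1 / C) \<le> h \<zeta> $ i \<and> h \<zeta> $ i \<le> max C (1 / \<epsilon>\<^sub>0)"
    using ae
  proof eventually_elim
    case (elim \<zeta>)
    then have "1 / C \<le> 1 / \<rho> k \<zeta>" "1 / \<rho> k \<zeta> \<le> 1 / \<epsilon>\<^sub>0" for k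
      using \<epsilon>\<^sub>0 C by (auto intro!: frac_le intro: less_le_trans)
    then show ?case using elim by (simp add: forall_6 ham_diag_def min_le_iff_disj le_max_iff_disj)
  qed
  moreover have "0 < min \<epsilon>\<^sub>0 (1 / C)" "min \<epsilon>\<^sub>0 (1 / C) \<le> max C (1 / \<epsilon>\<^sub>0)"
    using C \<epsilon>\<^sub>0 by auto
  ultimately show ?thesis by blast
qed

text \<open>Fixed once by \<open>SOME\<close>, so that all later constants can refer to the same
  ellipticity bounds.\<close>

definition h_min :: real where
  "h_min = (SOME m. \<exists>M. 0 < m \<and> m \<le> M \<and> (AE \<zeta> in Leb a b. \<forall>i. m \<le> h \<zeta> $ i \<and> h \<zeta> $ i \<le> M))"

definition h_max :: real where
  "h_max = (SOME M. 0 < h_min \<and> h_min \<le> M \<and> (AE \<zeta> in Leb a b. \<forall>i. h_min \<le> h \<zeta> $ i \<and> h \<zeta> $ i \<le> M))"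

lemma h_min: "0 < h_min" and h_min_max: "h_min \<le> h_max"
  and h_bounds: "AE \<zeta> in Leb a b. \<forall>i. h_min \<le> h \<zeta> $ i \<and> h \<zeta> $ i \<le> h_max"
  using someI_ex[OF someI_ex[OF h_bounds_ex, folded h_min_def], folded h_max_def] by blast+

lemma h_max: "0 < h_max"
  using h_min h_min_max by simp

lemma h_measurable: "(\<lambda>\<zeta>. h \<zeta> $ i) \<in> borel_measurable (Leb a b)"
proof -
  have [measurable]: "T k \<in> borel_measurable (Leb a b)" "\<rho> k \<in> borel_measurable (Leb a b)" for k
    using T_Linf[of k] \<rho>_Linf[of k] by (auto simp: L_infty_def)
  show ?thesis
    using exhaust_6[of i] by (elim disjE) (simp_all add: ham_diag_def)
qed

lemma H_mult_measurable:
  assumes "f \<in> borel_measurable (Leb a b)"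
  shows "(\<lambda>\<zeta>. H \<zeta> *v f \<zeta>) \<in> borel_measurable (Leb a b)"
  using h_measurable borel_measurable_vec_nth[OF assms]
  by (intro borel_measurable_vec) (simp add: hamiltonian_mult)

lemma norm_diag_mult_le:
  fixes u :: "complex^'n"
  assumes "\<And>i. \<bar>c i\<bar> \<le> M"
  shows "norm (\<chi> i. complex_of_real (c i) * u $ i) \<le> M * norm u"
proof (rule power2_le_imp_le)
  have M: "0 \<le> M" using assms[of undefined] by linarith
  have "(norm (\<chi> i. complex_of_real (c i) * u $ i))\<^sup>2 = (\<Sum>i\<in>UNIV. \<bar>c i\<bar>\<^sup>2 * (cmod (u $ i))\<^sup>2)"
    by (simp add: norm_sq_vec norm_mult power_mult_distrib)
  also have "\<dots> \<le> (\<Sum>i\<in>UNIV. M\<^sup>2 * (cmod (u $ i))\<^sup>2)"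
    using assms by (intro sum_mono mult_right_mono power_mono) auto
  also have "\<dots> = (M * norm u)\<^sup>2" by (simp add: norm_sq_vec power_mult_distrib sum_distrib_left)
  finally show "(norm (\<chi> i. complex_of_real (c i) * u $ i))\<^sup>2 \<le> (M * norm u)\<^sup>2" .
  show "0 \<le> M * norm u" using M by simp
qed

lemma norm_H_mult_le: "AE \<zeta> in Leb a b. \<forall>u. norm (H \<zeta> *v u) \<le> h_max * norm u"
  using h_bounds
proof eventually_elim
  case (elim \<zeta>)
  then have "\<bar>h \<zeta> $ i\<bar> \<le> h_max" for i using h_min by (metis abs_of_nonneg less_le order_trans)
  then show ?case by (auto simp: hamiltonian_mult intro: norm_diag_mult_le)
qed

text \<open>Total because division by 0 yields 0; it inverts \<open>H\<close> only where the
  diagonal entries are nonzero, hence almost everywhere.\<close>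

definition H_inv :: "real \<Rightarrow> complex^6 \<Rightarrow> complex^6" where
  "H_inv \<zeta> u = (\<chi> i. complex_of_real (1 / h \<zeta> $ i) * u $ i)"

lemma H_inv_measurable:
  assumes "f \<in> borel_measurable (Leb a b)"
  shows "(\<lambda>\<zeta>. H_inv \<zeta> (f \<zeta>)) \<in> borel_measurable (Leb a b)"
  using h_measurable borel_measurable_vec_nth[OF assms]
  by (intro borel_measurable_vec) (simp add: H_inv_def)

lemma norm_H_inv_le: "AE \<zeta> in Leb a b. \<forall>u. norm (H_inv \<zeta> u) \<le> (1 / h_min) * norm u"
  using h_bounds
proof eventually_elim
  case (elim \<zeta>)
  have "\<bar>1 / h \<zeta> $ i\<bar> \<le> 1 / h_min" for i
  proof -
    have "0 < h \<zeta> $ i" using elim h_min by (metis less_le_trans)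
    then show ?thesis using elim h_min by (simp add: frac_le)
  qed
  then show ?case
    using norm_diag_mult_le[of "\<lambda>i. 1 / h \<zeta> $ i" "1 / h_min"] unfolding H_inv_def by blast
qed

lemma H_H_inv: "AE \<zeta> in Leb a b. \<forall>u. H \<zeta> *v H_inv \<zeta> u = u \<and> H_inv \<zeta> (H \<zeta> *v u) = u"
  using h_bounds
proof eventually_elim
  case (elim \<zeta>)
  then have "h \<zeta> $ i \<noteq> 0" for i using h_min by (metis not_less order.strict_iff_not)
  then show ?case
    by (simp add: H_inv_def hamiltonian_mult vec_eq_iff)
qed

lemma ip_integrand:
  "Re (\<Sum>i\<in>UNIV. cnj (g \<zeta> $ i) * (H \<zeta> *v f \<zeta>) $ i) = (\<Sum>i\<in>UNIV. h \<zeta> $ i * (f \<zeta> $ i \<bullet> g \<zeta> $ i))"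
  by (simp add: hamiltonian_mult inner_complex_def algebra_simps)

lemma ip_integrable:
  assumes f: "f \<in> X" and g: "g \<in> X"
  shows "integrable (Leb a b) (\<lambda>\<zeta>. \<Sum>i\<in>UNIV. cnj (g \<zeta> $ i) * (H \<zeta> *v f \<zeta>) $ i)"
proof (rule Bochner_Integration.integrable_sum)
  fix i :: 6
  note m = borel_measurable_vec_nth[OF L2_measurable[OF g], of i]
    borel_measurable_vec_nth[OF H_mult_measurable[OF L2_measurable[OF f]], of i]
  show "integrable (Leb a b) (\<lambda>\<zeta>. cnj (g \<zeta> $ i) * (H \<zeta> *v f \<zeta>) $ i)"
  proof (rule Bochner_Integration.integrable_bound)
    show "integrable (Leb a b) (\<lambda>\<zeta>. h_max * ((norm (f \<zeta>))\<^sup>2 + (norm (g \<zeta>))\<^sup>2))"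
      using L2_sq_integrable[OF f] L2_sq_integrable[OF g] by simp
    show "AE \<zeta> in Leb a b. norm (cnj (g \<zeta> $ i) * (H \<zeta> *v f \<zeta>) $ i) \<le> norm (h_max * ((norm (f \<zeta>))\<^sup>2 + (norm (g \<zeta>))\<^sup>2))"
      using norm_H_mult_le
    proof eventually_elim
      case (elim \<zeta>)
      have "norm (cnj (g \<zeta> $ i) * (H \<zeta> *v f \<zeta>) $ i) \<le> norm (g \<zeta>) * (h_max * norm (f \<zeta>))"
        unfolding norm_mult complex_mod_cnj using elim Finite_Cartesian_Product.norm_nth_le[of "H \<zeta> *v f \<zeta>" i]
        by (intro mult_mono Finite_Cartesian_Product.norm_nth_le) (auto intro: order_trans)
      also have "\<dots> \<le> h_max * ((norm (f \<zeta>))\<^sup>2 + (norm (g \<zeta>))\<^sup>2)"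
      proof -
        have "norm (g \<zeta>) * norm (f \<zeta>) \<le> (norm (f \<zeta>))\<^sup>2 + (norm (g \<zeta>))\<^sup>2"
          using sum_squares_bound[of "norm (g \<zeta>)" "norm (f \<zeta>)"]
            mult_nonneg_nonneg[OF norm_ge_zero[of "g \<zeta>"] norm_ge_zero[of "f \<zeta>"]]
          by linarith
        from mult_left_mono[OF this, of h_max] show ?thesis using h_max by (simp add: mult.left_commute)
      qed
      finally show ?case using h_max by simp
    qed
    show "(\<lambda>\<zeta>. cnj (g \<zeta> $ i) * (H \<zeta> *v f \<zeta>) $ i) \<in> borel_measurable (Leb a b)"
      by (intro borel_measurable_times m borel_measurable_continuous_on[OF _ m(1), of cnj] continuous_intros)
  qed
qed

lemma ip_eq:
  assumes "f \<in> X" "g \<in> X"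
  shows "ip f g = 1/2 * (\<integral>\<zeta>. (\<Sum>i\<in>UNIV. h \<zeta> $ i * (f \<zeta> $ i \<bullet> g \<zeta> $ i)) \<partial>Leb a b)"
  using integral_Re[OF ip_integrable[OF assms], unfolded ip_integrand] by (simp add: ip_def inner_H_def)

lemma ip_integrable_real:
  assumes "f \<in> X" "g \<in> X"
  shows "integrable (Leb a b) (\<lambda>\<zeta>. \<Sum>i\<in>UNIV. h \<zeta> $ i * (f \<zeta> $ i \<bullet> g \<zeta> $ i))"
  using integrable_Re[OF ip_integrable[OF assms], unfolded ip_integrand] .

text \<open>The energy norm is equivalent to the plain one, which transfers completeness and
  identifies the null vectors.\<close>

lemma ip_self_bounds:
  assumes f: "f \<in> X"
  shows "ip f f \<le> h_max / 2 * (\<integral>\<zeta>. (norm (f \<zeta>))\<^sup>2 \<partial>Leb a b)"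
    and "h_min / 2 * (\<integral>\<zeta>. (norm (f \<zeta>))\<^sup>2 \<partial>Leb a b) \<le> ip f f"
proof -
  have ae: "AE \<zeta> in Leb a b. h_min * (norm (f \<zeta>))\<^sup>2 \<le> (\<Sum>i\<in>UNIV. h \<zeta> $ i * (f \<zeta> $ i \<bullet> f \<zeta> $ i)) \<and>
      (\<Sum>i\<in>UNIV. h \<zeta> $ i * (f \<zeta> $ i \<bullet> f \<zeta> $ i)) \<le> h_max * (norm (f \<zeta>))\<^sup>2"
    using h_bounds
  proof eventually_elim
    case (elim \<zeta>)
    then show ?case
      by (auto simp: norm_sq_vec sum_distrib_left power2_norm_eq_inner intro!: sum_mono mult_right_mono)
  qed
  have "(\<integral>\<zeta>. (\<Sum>i\<in>UNIV. h \<zeta> $ i * (f \<zeta> $ i \<bullet> f \<zeta> $ i)) \<partial>Leb a b) \<le> (\<integral>\<zeta>. h_max * (norm (f \<zeta>))\<^sup>2 \<partial>Leb a b)"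
    using ae ip_integrable_real[OF f f] L2_sq_integrable[OF f] by (intro integral_mono_AE) auto
  then show "ip f f \<le> h_max / 2 * (\<integral>\<zeta>. (norm (f \<zeta>))\<^sup>2 \<partial>Leb a b)" by (simp add: ip_eq[OF f f])
  have "(\<integral>\<zeta>. h_min * (norm (f \<zeta>))\<^sup>2 \<partial>Leb a b) \<le> (\<integral>\<zeta>. (\<Sum>i\<in>UNIV. h \<zeta> $ i * (f \<zeta> $ i \<bullet> f \<zeta> $ i)) \<partial>Leb a b)"
    using ae ip_integrable_real[OF f f] L2_sq_integrable[OF f] by (intro integral_mono_AE) auto
  then show "h_min / 2 * (\<integral>\<zeta>. (norm (f \<zeta>))\<^sup>2 \<partial>Leb a b) \<le> ip f f" by (simp add: ip_eq[OF f f])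
qed

sublocale semi_hilbert X ip
proof
  show "subspace X"
    unfolding subspace_def fun_ops using L2_zero L2_add L2_scaleR by auto
  show "ip f g = ip g f" if "f \<in> X" "g \<in> X" for f g
    using that by (simp add: ip_eq inner_commute)
  show "ip (f + g) k = ip f k + ip g k" if X: "f \<in> X" "g \<in> X" "k \<in> X" for f g k
  proof -
    have "f + g \<in> X" using L2_add[OF X(1,2)] by (simp add: fun_ops)
    then show ?thesis
      using X ip_integrable_real[OF X(1,3)] ip_integrable_real[OF X(2,3)]
      by (simp add: ip_eq fun_ops inner_add_left distrib_left sum.distrib)
  qed
  show "ip (r *\<^sub>R f) k = r * ip f k" if X: "f \<in> X" "k \<in> X" for r f k
  proof -
    have "r *\<^sub>R f \<in> X" using L2_scaleR[OF X(1)] by (simp add: fun_ops)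
    then show ?thesis
      using X by (simp add: ip_eq fun_ops mult.left_commute[of _ r] flip: sum_distrib_left)
  qed
  show "0 \<le> ip f f" if "f \<in> X" for f
    using ip_self_bounds(2)[OF that] h_min by (intro order_trans[OF _ ip_self_bounds(2)[OF that]]) simp
  show "\<exists>l\<in>X. (\<lambda>n. ip (f n - l) (f n - l)) \<longlonglongrightarrow> 0"
    if f: "\<And>n. f n \<in> X" and cauchy: "\<And>e. 0 < e \<Longrightarrow> \<exists>N. \<forall>m\<ge>N. \<forall>n\<ge>N. ip (f m - f n) (f m - f n) < e" for f
  proof -
    have d: "f m - f n \<in> X" for m n using L2_diff[OF f f, of m n] by (simp add: fun_ops)
    have "\<exists>N. \<forall>m\<ge>N. \<forall>n\<ge>N. (\<integral>\<zeta>. (norm (f m \<zeta> - f n \<zeta>))\<^sup>2 \<partial>Leb a b) < e" if e: "0 < e" for e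
    proof -
      obtain N where "\<forall>m\<ge>N. \<forall>n\<ge>N. ip (f m - f n) (f m - f n) < h_min / 2 * e"
        using cauchy[of "h_min / 2 * e"] e h_min by auto
      then have "\<forall>m\<ge>N. \<forall>n\<ge>N. h_min / 2 * (\<integral>\<zeta>. (norm (f m \<zeta> - f n \<zeta>))\<^sup>2 \<partial>Leb a b) < h_min / 2 * e"
        using ip_self_bounds(2)[OF d] unfolding fun_ops by (meson le_less_trans)
      then show ?thesis using h_min by (simp del: times_divide_eq_left) blast
    qed
    from L2_complete[OF less_imp_le[OF ab] f this] obtain l where l: "l \<in> X"
      "(\<lambda>n. \<integral>\<zeta>. (norm (f n \<zeta> - l \<zeta>))\<^sup>2 \<partial>Leb a b) \<longlonglongrightarrow> 0" by blast
    have dl: "f n - l \<in> X" for n using L2_diff[OF f l(1), of n] by (simp add: fun_ops)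
    have "(\<lambda>n. ip (f n - l) (f n - l)) \<longlonglongrightarrow> 0"
    proof (rule Lim_null_comparison)
      show "(\<lambda>n. h_max / 2 * (\<integral>\<zeta>. (norm (f n \<zeta> - l \<zeta>))\<^sup>2 \<partial>Leb a b)) \<longlonglongrightarrow> 0"
        using tendsto_mult_left[OF l(2), of "h_max / 2"] by simp
      show "\<forall>\<^sub>F n in sequentially. norm (ip (f n - l) (f n - l)) \<le> h_max / 2 * (\<integral>\<zeta>. (norm (f n \<zeta> - l \<zeta>))\<^sup>2 \<partial>Leb a b)"
      proof (intro always_eventually allI)
        fix n
        have "0 \<le> ip (f n - l) (f n - l)"
          using h_min by (intro order_trans[OF _ ip_self_bounds(2)[OF dl]]) simp
        then show "norm (ip (f n - l) (f n - l)) \<le> h_max / 2 * (\<integral>\<zeta>. (norm (f n \<zeta> - l \<zeta>))\<^sup>2 \<partial>Leb a b)"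
          using ip_self_bounds(1)[OF dl, of n] by (simp add: fun_ops)
      qed
    qed
    with l(1) show ?thesis by blast
  qed
qed

lemma norm_H_eq: "norm_H a b H f = nrm f"
  by (simp add: norm_H_def nrm_def ip_def)

lemma nrm_eq_0_iff:
  assumes f: "f \<in> X"
  shows "nrm f = 0 \<longleftrightarrow> ae_eq a b f (\<lambda>\<zeta>. 0)"
proof -
  have "nrm f = 0 \<longleftrightarrow> ip f f = 0" by (simp add: nrm_def)
  also have "\<dots> \<longleftrightarrow> (\<integral>\<zeta>. (norm (f \<zeta>))\<^sup>2 \<partial>Leb a b) = 0"
  proof
    assume "ip f f = 0"
    then have "h_min / 2 * (\<integral>\<zeta>. (norm (f \<zeta>))\<^sup>2 \<partial>Leb a b) \<le> 0" using ip_self_bounds(2)[OF f] by simp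
    then have "(\<integral>\<zeta>. (norm (f \<zeta>))\<^sup>2 \<partial>Leb a b) \<le> 0" using h_min by (simp add: mult_le_0_iff)
    then show "(\<integral>\<zeta>. (norm (f \<zeta>))\<^sup>2 \<partial>Leb a b) = 0" by (intro antisym) auto
  next
    assume "(\<integral>\<zeta>. (norm (f \<zeta>))\<^sup>2 \<partial>Leb a b) = 0"
    then show "ip f f = 0" using ip_self_bounds(1)[OF f] ip_ge0[OF f] by simp
  qed
  also have "\<dots> \<longleftrightarrow> ae_eq a b f (\<lambda>\<zeta>. 0)"
    using integral_nonneg_eq_0_iff_AE[OF L2_sq_integrable[OF f]] by (simp add: ae_eq_def)
  finally show ?thesis .
qed

lemma nrm_diff_eq_0_iff:
  assumes "f \<in> X" "g \<in> X"
  shows "nrm (f - g) = 0 \<longleftrightarrow> ae_eq a b f g"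
proof -
  have "f - g \<in> X" using assms by simp
  from nrm_eq_0_iff[OF this] show ?thesis by (simp add: ae_eq_def)
qed

end

section \<open>Compactness and the semigroup\<close>

context string_network
begin

abbreviation D :: "(real \<Rightarrow> complex^6) set" where "D \<equiv> dom_A a b \<beta> H"

abbreviation A :: "(real \<Rightarrow> complex^6) \<Rightarrow> real \<Rightarrow> complex^6" where "A \<equiv> op_A a b H"

lemma P1_L2:
  assumes "g \<in> X"
  shows "(\<lambda>\<zeta>. P1 *v g \<zeta>) \<in> X"
proof (rule L2_I_bound[OF _ assms, where C = 1])
  note m = borel_measurable_vec_nth[OF L2_measurable[OF assms]]
  show "(\<lambda>\<zeta>. P1 *v g \<zeta>) \<in> borel_measurable (Leb a b)"
  proof (rule borel_measurable_vec)
    fix i :: 6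
    show "(\<lambda>\<zeta>. (P1 *v g \<zeta>) $ i) \<in> borel_measurable (Leb a b)"
      using exhaust_6[of i] m by (elim disjE) (simp_all add: P1_mult)
  qed
qed (simp add: norm_P1)

lemma H_mult_L2:
  assumes f: "f \<in> X"
  shows "(\<lambda>\<zeta>. H \<zeta> *v f \<zeta>) \<in> X"
  by (rule L2_I_bound[OF H_mult_measurable[OF L2_measurable[OF f]] f, of h_max])
     (use norm_H_mult_le in eventually_elim, simp)

lemma H_inv_L2:
  assumes f: "f \<in> X"
  shows "(\<lambda>\<zeta>. H_inv \<zeta> (f \<zeta>)) \<in> X"
  by (rule L2_I_bound[OF H_inv_measurable[OF L2_measurable[OF f]] f, of "1 / h_min"])
     (use norm_H_inv_le in eventually_elim, simp)

text \<open>\<open>g\<close> is the very derivative selected in \<open>op_A\<close>, so the formula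
  for \<open>A x\<close> is an equality of functions, and \<open>g\<close> is tied to the continuous
  representative \<open>w\<close> by the fundamental theorem.\<close>

lemma dom_A_E:
  assumes "x \<in> D"
  obtains w g where "x \<in> X" "continuous_on {a..b} w" "ae_eq a b w (\<lambda>\<zeta>. H \<zeta> *v x \<zeta>)"
    "W_B \<beta> *v stack (w b) (w a) = 0" "g \<in> X" "has_weak_deriv a b (\<lambda>\<zeta>. H \<zeta> *v x \<zeta>) g"
    "A x = (\<lambda>\<zeta>. P1 *v g \<zeta>)"
    "\<And>c d. a \<le> c \<Longrightarrow> c \<le> d \<Longrightarrow> d \<le> b \<Longrightarrow> (g has_integral (w d - w c)) {c..d}"
proof -
  obtain w where x: "x \<in> X" and H1: "(\<lambda>\<zeta>. H \<zeta> *v x \<zeta>) \<in> H1 a b"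
    and w: "continuous_on {a..b} w" "ae_eq a b w (\<lambda>\<zeta>. H \<zeta> *v x \<zeta>)" "W_B \<beta> *v stack (w b) (w a) = 0"
    using assms by (auto simp: dom_A_def)
  have "\<exists>g. g \<in> L2 a b \<and> has_weak_deriv a b (\<lambda>\<zeta>. H \<zeta> *v x \<zeta>) g"
    using H1 by (auto simp: H1_def)
  from someI_ex[OF this, folded weak_deriv_def]
  have g: "weak_deriv a b (\<lambda>\<zeta>. H \<zeta> *v x \<zeta>) \<in> X"
    "has_weak_deriv a b (\<lambda>\<zeta>. H \<zeta> *v x \<zeta>) (weak_deriv a b (\<lambda>\<zeta>. H \<zeta> *v x \<zeta>))" by auto
  show ?thesis
    by (rule that[OF x w g])
       (use has_weak_deriv_ftc[OF g(2) L2_measurable[OF H_mult_L2[OF x]] L2_integrable[OF g(1)] w(1,2)]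
         in \<open>simp_all add: op_A_def\<close>)
qed

lemma dom_A_L2: "x \<in> D \<Longrightarrow> x \<in> X"
  by (simp add: dom_A_def)

lemma op_A_L2:
  assumes "x \<in> D"
  shows "A x \<in> X"
  by (rule dom_A_E[OF assms]) (simp add: P1_L2)

lemma sq_integral_le:
  assumes "f \<in> X" "nrm f \<le> C"
  shows "(\<integral>\<zeta>. (norm (f \<zeta>))\<^sup>2 \<partial>Leb a b) \<le> 2 * C\<^sup>2 / h_min"
proof -
  have "h_min / 2 * (\<integral>\<zeta>. (norm (f \<zeta>))\<^sup>2 \<partial>Leb a b) \<le> (nrm f)\<^sup>2"
    using ip_self_bounds(2)[OF assms(1)] assms(1) by (simp add: nrm_sq)
  also have "\<dots> \<le> C\<^sup>2" using assms by (intro power_mono) auto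
  finally show ?thesis using h_min by (simp add: field_simps)
qed

lemma integral_const_Leb: "(\<integral>\<zeta>. c \<partial>Leb a b) = (b - a) * c" for c :: real
  using ab by (simp add: measure_restrict_space space_restrict_space)

lemma integral_add_const_Leb:
  assumes "integrable (Leb a b) u"
  shows "(\<integral>\<zeta>. u \<zeta> + c \<partial>Leb a b) = (\<integral>\<zeta>. u \<zeta> \<partial>Leb a b) + (b - a) * (c::real)"
    and "integrable (Leb a b) (\<lambda>\<zeta>. u \<zeta> + c)"
proof -
  interpret finite_measure "Leb a b" by (rule finite_measure_Leb)
  show "(\<integral>\<zeta>. u \<zeta> + c \<partial>Leb a b) = (\<integral>\<zeta>. u \<zeta> \<partial>Leb a b) + (b - a) * c"
    using assms by (subst Bochner_Integration.integral_add) (use ab in \<open>auto simp: measure_restrict_space space_restrict_space\<close>)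
  show "integrable (Leb a b) (\<lambda>\<zeta>. u \<zeta> + c)" using assms by simp
qed

text \<open>Takes the place of a square-root modulus of continuity: a large \<open>s\<close> makes
  the second term small, and then a short interval makes the first one small.\<close>

lemma primitive_increment_le:
  fixes g w :: "real \<Rightarrow> 'v::euclidean_space"
  assumes g: "g \<in> L2 a b" "(\<integral>\<zeta>. (norm (g \<zeta>))\<^sup>2 \<partial>Leb a b) \<le> K"
    and w: "\<And>c d. a \<le> c \<Longrightarrow> c \<le> d \<Longrightarrow> d \<le> b \<Longrightarrow> (g has_integral (w d - w c)) {c..d}"
    and xy: "x \<in> {a..b}" "y \<in> {a..b}" and s: "0 < s"
  shows "norm (w y - w x) \<le> s * \<bar>y - x\<bar> + K / s"
proof -
  have *: "norm (w y - w x) \<le> s * (y - x) + K / s" if xy: "a \<le> x" "x \<le> y" "y \<le> b" for x y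
  proof -
    note q = integrable_Leb_imp[OF L2_sq_integrable[OF g(1)]]
    have qi: "(\<lambda>\<zeta>. (norm (g \<zeta>))\<^sup>2) integrable_on {x..y}"
      by (rule integrable_on_subinterval[OF q(1)]) (use xy in auto)
    have "norm (integral {x..y} g) \<le> integral {x..y} (\<lambda>\<zeta>. s + (norm (g \<zeta>))\<^sup>2 / s)"
      using w[of x y] xy qi s
      by (intro Henstock_Kurzweil_Integration.integral_norm_bound_integral integrable_add integrable_on_divide le_add_sq_div)
         (auto simp: has_integral_integrable)
    also have "\<dots> = s * (y - x) + integral {x..y} (\<lambda>\<zeta>. (norm (g \<zeta>))\<^sup>2) / s"
      using qi xy by (subst Henstock_Kurzweil_Integration.integral_add) (auto intro: integrable_on_divide)
    also have "integral {x..y} (\<lambda>\<zeta>. (norm (g \<zeta>))\<^sup>2) \<le> K"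
      using integral_subset_le[OF _ qi q(1)] g(2) q(2) xy by auto
    then have "integral {x..y} (\<lambda>\<zeta>. (norm (g \<zeta>))\<^sup>2) / s \<le> K / s" using s by (intro divide_right_mono) auto
    finally show ?thesis using integral_unique[OF w[OF xy]] by simp
  qed
  show ?thesis using *[of x y] *[of y x] xy by (cases "x \<le> y") (auto simp: norm_minus_commute)
qed

text \<open>Arzela-Ascoli is applied to the continuous representatives of \<open>H\<close> times
  \<open>f n\<close>, not to \<open>f n\<close>, which may be discontinuous like the coefficients.
  The bound on \<open>A (f n)\<close> gives equicontinuity, together with the bound on
  \<open>f n\<close> it gives uniform boundedness, and \<open>H_inv\<close> leads back to the state
  space.\<close>

lemma graph_ball_precompact:
  assumes f: "\<And>n::nat. f n \<in> D" and C: "\<And>n. nrm (f n) \<le> C" "\<And>n. nrm (A (f n)) \<le> C"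
  shows "\<exists>l\<in>X. \<exists>r. strict_mono r \<and> (\<lambda>n::nat. nrm (f (r n) - l)) \<longlonglongrightarrow> 0"
proof -
  define P where "P n w g \<longleftrightarrow> continuous_on {a..b} w \<and> ae_eq a b w (\<lambda>\<zeta>. H \<zeta> *v f n \<zeta>) \<and> g \<in> X \<and>
    A (f n) = (\<lambda>\<zeta>. P1 *v g \<zeta>) \<and>
    (\<forall>c d. a \<le> c \<longrightarrow> c \<le> d \<longrightarrow> d \<le> b \<longrightarrow> (g has_integral (w d - w c)) {c..d})" for n w g
  have "\<exists>w g. P n w g" for n
    unfolding P_def by (rule dom_A_E[OF f[of n]]) blast
  then obtain w g where P: "\<And>n. P n (w n) (g n)" by metis
  have w: "continuous_on {a..b} (w n)" "ae_eq a b (w n) (\<lambda>\<zeta>. H \<zeta> *v f n \<zeta>)"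
    and g: "g n \<in> X" "A (f n) = (\<lambda>\<zeta>. P1 *v g n \<zeta>)" for n
    using P[of n] by (simp_all add: P_def)
  have int: "(g n has_integral (w n d - w n c)) {c..d}" if "a \<le> c" "c \<le> d" "d \<le> b" for n c d
    using P[of n] that by (simp add: P_def)
  have fX [simp]: "f n \<in> X" for n using f dom_A_L2 by blast
  define K where "K = 2 * C\<^sup>2 / h_min"
  have K0: "0 \<le> K" using h_min by (simp add: K_def)
  have fK: "(\<integral>\<zeta>. (norm (f n \<zeta>))\<^sup>2 \<partial>Leb a b) \<le> K" for n
    unfolding K_def by (rule sq_integral_le[OF fX C(1)])
  have gK: "(\<integral>\<zeta>. (norm (g n \<zeta>))\<^sup>2 \<partial>Leb a b) \<le> K" for n
    using sq_integral_le[OF op_A_L2[OF f[of n]] C(2)] unfolding K_def g(2) norm_P1 .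
  have inc: "norm (w n y - w n x) \<le> s * \<bar>y - x\<bar> + K / s" if "x \<in> {a..b}" "y \<in> {a..b}" "0 < s" for n x y s
    by (rule primitive_increment_le[OF g(1) gK _ that]) (rule int)
  \<comment> \<open>Bounds the oscillation of every \<open>w n\<close> on the whole interval:
    \<open>inc\<close> with \<open>s = 1\<close>.\<close>
  define c where "c = (b - a) + K"
  have wK: "(\<integral>\<zeta>. (norm (w n \<zeta>))\<^sup>2 \<partial>Leb a b) \<le> h_max\<^sup>2 * K" for n
  proof -
    have "(\<integral>\<zeta>. (norm (w n \<zeta>))\<^sup>2 \<partial>Leb a b) \<le> (\<integral>\<zeta>. h_max\<^sup>2 * (norm (f n \<zeta>))\<^sup>2 \<partial>Leb a b)"
    proof (rule integral_mono_AE)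
      show "AE \<zeta> in Leb a b. (norm (w n \<zeta>))\<^sup>2 \<le> h_max\<^sup>2 * (norm (f n \<zeta>))\<^sup>2"
        using w(2)[of n, unfolded ae_eq_def] norm_H_mult_le
      proof eventually_elim
        case (elim \<zeta>)
        then have "norm (w n \<zeta>) \<le> h_max * norm (f n \<zeta>)" by simp
        then show ?case using power_mono[of "norm (w n \<zeta>)" _ 2] by (simp flip: power_mult_distrib)
      qed
    qed (use L2_sq_integrable[OF fX, of n] L2_sq_integrable[OF continuous_L2[OF w(1)], of n] in auto)
    also have "\<dots> \<le> h_max\<^sup>2 * K" using fK[of n] by (simp add: mult_left_mono)
    finally show ?thesis .
  qed
  \<comment> \<open>Results from averaging over \<open>y\<close> the inequality that bounds the
    squared norm of \<open>w n x\<close> by twice that of \<open>w n y\<close> plus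
    \<open>2 * c\<^sup>2\<close>.\<close>
  define B where "B = sqrt (2 * (h_max\<^sup>2 * K) / (b - a) + 2 * c\<^sup>2)"
  have bound: "norm (w n x) \<le> B" if x: "x \<in> {a..b}" for n x
  proof -
    have le: "(norm (w n x))\<^sup>2 \<le> 2 * (norm (w n y))\<^sup>2 + 2 * c\<^sup>2" if y: "y \<in> {a..b}" for y
    proof -
      have "norm (w n x - w n y) \<le> c" using inc[OF y x, of 1 n] x y by (auto simp: c_def)
      then have "(norm (w n x - w n y))\<^sup>2 \<le> c\<^sup>2" by (intro power_mono) auto
      then show ?thesis using norm_add_sq_le[of "w n y" "w n x - w n y"] by simp
    qed
    have wi: "integrable (Leb a b) (\<lambda>\<zeta>. 2 * (norm (w n \<zeta>))\<^sup>2)"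
      using L2_sq_integrable[OF continuous_L2[OF w(1)], of n] by simp
    have "(b - a) * (norm (w n x))\<^sup>2 = (\<integral>y. (norm (w n x))\<^sup>2 \<partial>Leb a b)"
      by (rule integral_const_Leb[symmetric])
    also have "\<dots> \<le> (\<integral>y. 2 * (norm (w n y))\<^sup>2 + 2 * c\<^sup>2 \<partial>Leb a b)"
      using integral_add_const_Leb(2)[OF wi] finite_measure.integrable_const[OF finite_measure_Leb] le
      by (intro integral_mono) (auto simp: space_restrict_space)
    also have "\<dots> \<le> 2 * (h_max\<^sup>2 * K) + (b - a) * (2 * c\<^sup>2)"
      using wK[of n] by (simp add: integral_add_const_Leb(1)[OF wi])
    finally have "(norm (w n x))\<^sup>2 \<le> 2 * (h_max\<^sup>2 * K) / (b - a) + 2 * c\<^sup>2"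
      using ab by (simp add: field_simps)
    then show ?thesis unfolding B_def by (rule real_le_rsqrt)
  qed
  have equi: "\<exists>d>0. \<forall>n y. y \<in> {a..b} \<and> norm (x - y) < d \<longrightarrow> norm (w n x - w n y) < e"
    if x: "x \<in> {a..b}" and e: "0 < e" for x e
  proof -
    \<comment> \<open>Makes \<open>K / s\<close> less than \<open>e / 2\<close>; the radius
      \<open>e / (2 * s)\<close> then takes care of the other term of \<open>inc\<close>.\<close>
    define s where "s = 2 * (K + 1) / e"
    have s: "0 < s" using K0 e by (simp add: s_def)
    have Ks: "K / s < e / 2" using K0 e by (simp add: s_def field_simps)
    show ?thesis
    proof (intro exI[of _ "e / (2 * s)"] conjI allI impI)
      fix n y assume y: "y \<in> {a..b} \<and> norm (x - y) < e / (2 * s)"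
      then have "s * \<bar>x - y\<bar> < e / 2" using s by (simp add: field_simps)
      then show "norm (w n x - w n y) < e" using inc[OF conjunct1[OF y] x s, of n] Ks by linarith
    qed (use e s in simp)
  qed
  obtain G r where G: "continuous_on {a..b} G" and r: "strict_mono (r :: nat \<Rightarrow> nat)"
    and unif: "\<And>e. 0 < e \<Longrightarrow> \<exists>N. \<forall>n x. n \<ge> N \<and> x \<in> {a..b} \<longrightarrow> norm (w (r n) x - G x) < e"
    using Arzela_Ascoli[of "{a..b}" w B] bound equi by (metis compact_Icc)
  define l where "l \<zeta> = H_inv \<zeta> (G \<zeta>)" for \<zeta>
  have l [simp]: "l \<in> X" unfolding l_def by (rule H_inv_L2[OF continuous_L2[OF G]])
  \<comment> \<open>Converts a uniform error of the representatives into an energy error: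
    \<open>H_inv\<close> costs the factor \<open>1 / h_min\<close>, and integration over length
    \<open>b - a\<close> costs the square root.\<close>
  define Q where "Q = sqrt (h_max / 2 * (b - a)) / h_min"
  have Q0: "0 \<le> Q" using h_max h_min ab by (simp add: Q_def)
  have est: "nrm (f n - l) \<le> Q * e" if e: "0 < e" and le: "\<forall>x\<in>{a..b}. norm (w n x - G x) < e" for n e
  proof -
    have fl: "f n - l \<in> X" by simp
    have "(nrm (f n - l))\<^sup>2 \<le> h_max / 2 * (\<integral>\<zeta>. (norm (f n \<zeta> - l \<zeta>))\<^sup>2 \<partial>Leb a b)"
      using ip_self_bounds(1)[OF fl] by (simp add: nrm_sq[OF fl])
    also have "(\<integral>\<zeta>. (norm (f n \<zeta> - l \<zeta>))\<^sup>2 \<partial>Leb a b) \<le> (\<integral>\<zeta>. (e / h_min)\<^sup>2 \<partial>Leb a b)"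
    proof (rule integral_mono_AE)
      have "AE \<zeta> in Leb a b. a < \<zeta> \<and> \<zeta> < b" by (rule AE_LebI) simp
      with w(2)[of n, unfolded ae_eq_def] norm_H_inv_le H_H_inv
      show "AE \<zeta> in Leb a b. (norm (f n \<zeta> - l \<zeta>))\<^sup>2 \<le> (e / h_min)\<^sup>2"
      proof eventually_elim
        case (elim \<zeta>)
        have "f n \<zeta> - l \<zeta> = H_inv \<zeta> (w n \<zeta> - G \<zeta>)"
          using elim by (simp add: l_def) (simp add: H_inv_def vec_eq_iff algebra_simps)
        then have "norm (f n \<zeta> - l \<zeta>) \<le> (1 / h_min) * norm (w n \<zeta> - G \<zeta>)" using elim by simp
        also have "\<dots> \<le> (1 / h_min) * e"
        proof (rule mult_left_mono)
          have "\<zeta> \<in> {a..b}" using elim by simp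
          then show "norm (w n \<zeta> - G \<zeta>) \<le> e" using le by (simp add: less_imp_le)
        qed (use h_min in simp)
        finally show ?case by (intro power_mono) auto
      qed
      show "integrable (Leb a b) (\<lambda>\<zeta>. (norm (f n \<zeta> - l \<zeta>))\<^sup>2)" using L2_sq_integrable[OF fl] by simp
      show "integrable (Leb a b) (\<lambda>\<zeta>. (e / h_min)\<^sup>2)" by (rule finite_measure.integrable_const[OF finite_measure_Leb])
    qed
    also have "(\<integral>\<zeta>. (e / h_min)\<^sup>2 \<partial>Leb a b) = (b - a) * (e / h_min)\<^sup>2" by (rule integral_const_Leb)
    finally have "(nrm (f n - l))\<^sup>2 \<le> h_max / 2 * ((b - a) * (e / h_min)\<^sup>2)"
      using h_max by (simp add: fun_diff_def)
    also have "\<dots> = (Q * e)\<^sup>2"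
      using h_max ab by (simp add: Q_def power_mult_distrib power_divide)
    finally show ?thesis
      by (rule power2_le_imp_le) (use e Q0 in simp)
  qed
  have "(\<lambda>n. nrm (f (r n) - l)) \<longlonglongrightarrow> 0"
  proof (rule LIMSEQ_I)
    fix e :: real assume e: "0 < e"
    define e' where "e' = e / (Q + 1)"
    have e': "0 < e'" using e Q0 by (simp add: e'_def)
    have Qe: "Q * e' < e" using e Q0 by (simp add: e'_def field_simps)
    obtain N where "\<forall>n x. n \<ge> N \<and> x \<in> {a..b} \<longrightarrow> norm (w (r n) x - G x) < e'" using unif[OF e'] by blast
    then have "nrm (f (r n) - l) \<le> Q * e'" if "N \<le> n" for n using est[OF e', of "r n"] that by blast
    then show "\<exists>no. \<forall>n\<ge>no. norm (nrm (f (r n) - l) - 0) < e"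
      using Qe by (intro exI[of _ N]) (auto intro: le_less_trans)
  qed
  with l r show ?thesis by blast
qed

end

locale string_network_semigroup = string_network +
  fixes S :: "real \<Rightarrow> (real \<Rightarrow> complex^6) \<Rightarrow> real \<Rightarrow> complex^6"
  assumes contraction: "contraction_semigroup a b H S" and generates: "generates a b \<beta> H S"
begin

definition J :: "(real \<Rightarrow> complex^6) \<Rightarrow> real \<Rightarrow> complex^6" where "J x = (\<lambda>\<zeta>. \<i> *s x \<zeta>)"

lemma scaleR_vec: "r *\<^sub>R (u :: complex^6) = complex_of_real r *s u"
  by (simp add: vec_eq_iff scaleR_conv_of_real[where 'a = complex])

lemma norm_imaginary_scale: "norm (\<i> *s u) = norm u" for u :: "complex^6"
  by (rule power2_eq_imp_eq) (simp_all add: norm_sq_vec norm_mult)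

lemma J_L2: 
  assumes x: "x \<in> X"
  shows "J x \<in> X"
  unfolding J_def
proof (rule L2_I_bound[OF _ x, of _ 1])
  show "(\<lambda>\<zeta>. \<i> *s x \<zeta>) \<in> borel_measurable (Leb a b)"
    using borel_measurable_vec_nth[OF L2_measurable[OF x]] by (intro borel_measurable_vec) simp
qed (simp add: norm_imaginary_scale)

lemma S_L2: "0 \<le> t \<Longrightarrow> x \<in> X \<Longrightarrow> S t x \<in> X"
  using contraction by (simp add: contraction_semigroup_def)

lemma S_linear:
  assumes "0 \<le> t" "x \<in> X" "y \<in> X"
  shows "ae_eq a b (S t (\<lambda>\<zeta>. c *s x \<zeta> + d *s y \<zeta>)) (\<lambda>\<zeta>. c *s S t x \<zeta> + d *s S t y \<zeta>)"
  using contraction assms by (simp add: contraction_semigroup_def)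

text \<open>Each almost everywhere equality among the hypotheses becomes a vanishing norm through
  \<open>nrm_diff_eq_0_iff\<close>; commutation with \<open>J\<close> is linearity with the
  coefficients \<open>\<i>\<close> and 0.\<close>

sublocale complex_contraction_semigroup X ip S D A J
proof
  fix t s :: real and x y :: "real \<Rightarrow> complex^6" and c d :: real
  show St: "S t x \<in> X" if "0 \<le> t" "x \<in> X" for t x
    by (rule S_L2[OF that])
  show "nrm (S t (c *\<^sub>R x + d *\<^sub>R y) - (c *\<^sub>R S t x + d *\<^sub>R S t y)) = 0" if "0 \<le> t" "x \<in> X" "y \<in> X"
  proof -
    have eq: "c *\<^sub>R x + d *\<^sub>R y = (\<lambda>\<zeta>. complex_of_real c *s x \<zeta> + complex_of_real d *s y \<zeta>)"
      "c *\<^sub>R S t x + d *\<^sub>R S t y = (\<lambda>\<zeta>. complex_of_real c *s S t x \<zeta> + complex_of_real d *s S t y \<zeta>)"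
      by (simp_all add: fun_ops scaleR_vec)
    have "ae_eq a b (S t (c *\<^sub>R x + d *\<^sub>R y)) (c *\<^sub>R S t x + d *\<^sub>R S t y)"
      unfolding eq by (rule S_linear[OF that])
    then show ?thesis using that by (subst nrm_diff_eq_0_iff) (auto simp: S_L2)
  qed
  show "nrm (S t x) \<le> nrm x" if "0 \<le> t" "x \<in> X"
    using contraction that by (simp add: contraction_semigroup_def norm_H_eq)
  show "nrm (S 0 x - x) = 0" if "x \<in> X"
    using contraction that by (subst nrm_diff_eq_0_iff) (auto simp: contraction_semigroup_def)
  show "nrm (S (s + t) x - S s (S t x)) = 0" if "0 \<le> s" "0 \<le> t" "x \<in> X"
    using contraction that by (subst nrm_diff_eq_0_iff) (auto simp: contraction_semigroup_def)
  show "x \<in> X" if "x \<in> D" by (rule dom_A_L2[OF that])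
  show "A x \<in> X" if "x \<in> D" by (rule op_A_L2[OF that])
  show "x \<in> D \<and> nrm (A x - y) = 0 \<longleftrightarrow> ((\<lambda>t. nrm ((1 / t) *\<^sub>R (S t x - x) - y)) \<longlongrightarrow> 0) (at_right 0)"
    if "x \<in> X" "y \<in> X"
  proof -
    have "x \<in> D \<and> nrm (A x - y) = 0 \<longleftrightarrow> x \<in> D \<and> ae_eq a b (A x) y"
      using nrm_diff_eq_0_iff[OF op_A_L2 that(2)] by blast
    also have "\<dots> \<longleftrightarrow> ((\<lambda>t. norm_H a b H (\<lambda>\<zeta>. (1 / t) *\<^sub>R (S t x \<zeta> - x \<zeta>) - y \<zeta>)) \<longlongrightarrow> 0) (at_right 0)"
      using generates that unfolding generates_def by blast
    finally show ?thesis by (simp add: norm_H_eq fun_ops)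
  qed
  show "\<exists>l\<in>X. \<exists>r. strict_mono r \<and> (\<lambda>n::nat. nrm (f (r n) - l)) \<longlonglongrightarrow> 0"
    if "\<And>n::nat. f n \<in> D" "\<And>n. nrm (f n) \<le> C" "\<And>n. nrm (A (f n)) \<le> C" for f C
    by (rule graph_ball_precompact[OF that])
  show "J (u + v) = J u + J v" "J (r *\<^sub>R u) = r *\<^sub>R J u" for u v r
    by (auto simp: J_def fun_ops fun_eq_iff vec_eq_iff algebra_simps)
  show "J (J x) = - x" by (simp add: J_def fun_ops fun_eq_iff vec_eq_iff)
  show "J x \<in> X" if "x \<in> X" by (rule J_L2[OF that])
  show "nrm (J x) = nrm x" if "x \<in> X"
  proof -
    have "ip (J x) (J x) = ip x x"
      using that by (simp add: ip_eq J_L2) (simp add: J_def inner_complex_def add.commute)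
    then show ?thesis by (simp add: nrm_def)
  qed
  show "nrm (S t (J x) - J (S t x)) = 0" if "0 \<le> t" "x \<in> X"
    using S_linear[of t x x \<i> 0] that
    by (subst nrm_diff_eq_0_iff) (auto simp: S_L2 J_L2, simp add: J_def)
qed

end

section \<open>Imaginary eigenvalues\<close>

text \<open>\<open>Leb\<close> sees only the open interval, while \<open>c\<close> and
  \<open>d\<close> may be its end points; they are dropped before the exceptional null set is
  treated.\<close>

lemma has_integral_AE_Leb:
  fixes f g :: "real \<Rightarrow> 'v::euclidean_space"
  assumes ae: "AE x in Leb a b. f x = g x" and cd: "a \<le> c" "d \<le> b" and f: "(f has_integral I) {c..d}"
  shows "(g has_integral I) {c..d}"
proof -
  have "AE x in lborel. x \<in> {a<..<b} \<longrightarrow> f x = g x"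
    using ae by (simp add: AE_restrict_space_iff AE_completion_iff)
  then have "AE x in lborel. x \<in> {c<..<d} \<longrightarrow> f x = g x"
    by (rule eventually_mono) (use cd in auto)
  from has_integral_AE[OF this] show ?thesis
    using f by (simp add: has_integral_Icc_iff_Ioo)
qed

lemma test_function_deriv_continuous:
  assumes "\<phi> \<in> test_functions a b"
  shows "continuous_on A \<phi>" "continuous_on A (deriv \<phi>)"
proof -
  have "(deriv ^^ n) \<phi> differentiable (at x)" for n x using assms by (simp add: test_functions_def)
  from this[of 0] this[of 1] show "continuous_on A \<phi>" "continuous_on A (deriv \<phi>)"
    by (auto intro!: continuous_at_imp_continuous_on differentiable_imp_continuous_within)
qed

lemma continuous_scaleR_L2_integrable:
  fixes f :: "real \<Rightarrow> 'v::euclidean_space"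
  assumes \<phi>: "continuous_on {a..b} \<phi>" and f: "f \<in> L2 a b"
  shows "integrable (Leb a b) (\<lambda>x. \<phi> x *\<^sub>R f x)"
proof -
  obtain C where C: "\<And>x. x \<in> {a..b} \<Longrightarrow> norm (\<phi> x) \<le> C" using continuous_bounded_Icc[OF \<phi>] by blast
  show ?thesis
  proof (rule Bochner_Integration.integrable_bound)
    show "integrable (Leb a b) (\<lambda>x. C * norm (f x))" using L2_integrable[OF f] by simp
    show "AE x in Leb a b. norm (\<phi> x *\<^sub>R f x) \<le> norm (C * norm (f x))"
    proof (rule AE_LebI)
      fix x assume "a < x" "x < b"
      then have "norm (\<phi> x) \<le> C" using C[of x] by simp
      then have "norm (\<phi> x) * norm (f x) \<le> \<bar>C\<bar> * norm (f x)" by (intro mult_right_mono) auto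
      then show "norm (\<phi> x *\<^sub>R f x) \<le> norm (C * norm (f x))" by (simp add: abs_mult)
    qed
  qed (intro borel_measurable_scaleR continuous_measurable_Leb[OF \<phi>] L2_measurable[OF f])
qed

lemma has_weak_deriv_bounded_linear:
  assumes L: "bounded_linear L" and fg: "has_weak_deriv a b f g" "f \<in> L2 a b" "g \<in> L2 a b"
  shows "has_weak_deriv a b (\<lambda>x. L (f x)) (\<lambda>x. L (g x))"
  unfolding has_weak_deriv_def
proof
  fix \<phi> assume \<phi>: "\<phi> \<in> test_functions a b"
  note c = test_function_deriv_continuous[OF \<phi>, of "{a..b}"]
  have "(\<integral>x. deriv \<phi> x *\<^sub>R L (f x) \<partial>Leb a b) = L (\<integral>x. deriv \<phi> x *\<^sub>R f x \<partial>Leb a b)"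
    using integral_bounded_linear[OF L continuous_scaleR_L2_integrable[OF c(2) fg(2)]]
    by (simp add: linear_scale[OF bounded_linear.linear[OF L]])
  also have "\<dots> = L (- (\<integral>x. \<phi> x *\<^sub>R g x \<partial>Leb a b))" using fg(1) \<phi> by (simp add: has_weak_deriv_def)
  also have "\<dots> = - (\<integral>x. \<phi> x *\<^sub>R L (g x) \<partial>Leb a b)"
    using integral_bounded_linear[OF L continuous_scaleR_L2_integrable[OF c(1) fg(3)]]
    by (simp add: linear_scale[OF bounded_linear.linear[OF L]] linear_neg[OF bounded_linear.linear[OF L]])
  finally show "(\<integral>x. deriv \<phi> x *\<^sub>R L (f x) \<partial>Leb a b) = - (\<integral>x. \<phi> x *\<^sub>R L (g x) \<partial>Leb a b)" .
qed

lemma has_weak_deriv_add: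
  assumes "has_weak_deriv a b f g" "f \<in> L2 a b" "g \<in> L2 a b"
    and "has_weak_deriv a b f' g'" "f' \<in> L2 a b" "g' \<in> L2 a b"
  shows "has_weak_deriv a b (\<lambda>x. f x + f' x) (\<lambda>x. g x + g' x)"
  unfolding has_weak_deriv_def
proof
  fix \<phi> assume \<phi>: "\<phi> \<in> test_functions a b"
  note c = test_function_deriv_continuous[OF \<phi>, of "{a..b}"]
  show "(\<integral>x. deriv \<phi> x *\<^sub>R (f x + f' x) \<partial>Leb a b) = - (\<integral>x. \<phi> x *\<^sub>R (g x + g' x) \<partial>Leb a b)"
    using assms(1,4) \<phi> continuous_scaleR_L2_integrable[OF c(2) assms(2)] continuous_scaleR_L2_integrable[OF c(2) assms(5)]
      continuous_scaleR_L2_integrable[OF c(1) assms(3)] continuous_scaleR_L2_integrable[OF c(1) assms(6)]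
    by (simp add: has_weak_deriv_def scaleR_add_right)
qed

lemma has_weak_deriv_cong:
  assumes fg: "has_weak_deriv a b f g" and f: "f \<in> L2 a b" "f' \<in> L2 a b" and ae: "ae_eq a b f' f"
  shows "has_weak_deriv a b f' g"
  unfolding has_weak_deriv_def
proof
  fix \<phi> assume \<phi>: "\<phi> \<in> test_functions a b"
  note c = test_function_deriv_continuous[OF \<phi>, of "{a..b}"]
  have "(\<integral>x. deriv \<phi> x *\<^sub>R f' x \<partial>Leb a b) = (\<integral>x. deriv \<phi> x *\<^sub>R f x \<partial>Leb a b)"
  proof (rule integral_cong_AE)
    show "AE x in Leb a b. deriv \<phi> x *\<^sub>R f' x = deriv \<phi> x *\<^sub>R f x"
      using ae unfolding ae_eq_def by eventually_elim simp
  qed (intro borel_measurable_scaleR continuous_measurable_Leb[OF c(2)] L2_measurable f)+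
  then show "(\<integral>x. deriv \<phi> x *\<^sub>R f' x \<partial>Leb a b) = - (\<integral>x. \<phi> x *\<^sub>R g x \<partial>Leb a b)"
    using fg \<phi> by (simp add: has_weak_deriv_def)
qed

lemma continuous_AE_zero:
  fixes f :: "real \<Rightarrow> 'v::euclidean_space"
  assumes "a < b" and f: "continuous_on {a..b} f" and ae: "AE x in Leb a b. f x = 0" and x: "x \<in> {a..b}"
  shows "f x = 0"
proof -
  have c: "continuous_on {a..b} (\<lambda>x. norm (f x))" by (intro continuous_intros f)
  have "(\<integral>x. norm (f x) \<partial>Leb a b) = 0"
    by (rule integral_eq_zero_AE) (use ae in eventually_elim, simp)
  then have "integral {a..b} (\<lambda>x. norm (f x)) = 0"
    using integrable_Leb_imp(2)[OF continuous_integrable_Leb[OF c]] by simp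
  then show ?thesis using integral_eq_0_iff[OF c \<open>a < b\<close>] x by simp
qed

abbreviation boundary_minors :: "real \<Rightarrow> (string_label \<Rightarrow> real \<Rightarrow> complex^2^2) \<Rightarrow> real" where
  "boundary_minors b \<Psi> \<equiv> cmod (\<Psi> S_I b $ 1 $ 2 * \<Psi> S_II b $ 1 $ 1) +
     cmod (\<Psi> S_I b $ 1 $ 2 * \<Psi> S_III b $ 1 $ 1) + cmod (\<Psi> S_II b $ 1 $ 1 * \<Psi> S_III b $ 1 $ 1)"

text \<open>Within each pair of components, this is the one that \<open>W_B\<close> equates across
  the strings at \<open>b\<close>; the component given by \<open>force_index\<close> enters the
  balance there.\<close>

primrec displacement_index :: "string_label \<Rightarrow> 6" where
  "displacement_index S_I = 1" | "displacement_index S_II = 3" | "displacement_index S_III = 5"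

primrec force_index :: "string_label \<Rightarrow> 6" where
  "force_index S_I = 2" | "force_index S_II = 4" | "force_index S_III = 6"

section \<open>The string equations of an eigenfunction\<close>

context string_network
begin

text \<open>Fixed by \<open>SOME\<close> because the truncated coefficient \<open>\<gamma>\<close>
  and the bound \<open>B\<close> refer to it.\<close>

definition coeff_max :: real where
  "coeff_max = (SOME C. 0 < C \<and> C \<ge> \<epsilon>\<^sub>0 \<and>
    (AE \<zeta> in Leb a b. \<forall>k. \<epsilon>\<^sub>0 \<le> T k \<zeta> \<and> T k \<zeta> \<le> C \<and> \<epsilon>\<^sub>0 \<le> \<rho> k \<zeta> \<and> \<rho> k \<zeta> \<le> C))"

lemma coeff_max: "0 < coeff_max"
  and coeff_max_AE: "AE \<zeta> in Leb a b. \<forall>k. \<epsilon>\<^sub>0 \<le> T k \<zeta> \<and> T k \<zeta> \<le> coeff_max \<and> \<epsilon>\<^sub>0 \<le> \<rho> k \<zeta> \<and> \<rho> k \<zeta> \<le> coeff_max"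
proof -
  have "\<exists>C. 0 < C \<and> C \<ge> \<epsilon>\<^sub>0 \<and>
    (AE \<zeta> in Leb a b. \<forall>k. \<epsilon>\<^sub>0 \<le> T k \<zeta> \<and> T k \<zeta> \<le> C \<and> \<epsilon>\<^sub>0 \<le> \<rho> k \<zeta> \<and> \<rho> k \<zeta> \<le> C)"
    by (rule coefficient_bounds) blast
  from someI_ex[OF this, folded coeff_max_def]
  show "0 < coeff_max"
    "AE \<zeta> in Leb a b. \<forall>k. \<epsilon>\<^sub>0 \<le> T k \<zeta> \<and> T k \<zeta> \<le> coeff_max \<and> \<epsilon>\<^sub>0 \<le> \<rho> k \<zeta> \<and> \<rho> k \<zeta> \<le> coeff_max" by blast+
qed

text \<open>Truncated so that the bounds hold everywhere and not only almost everywhere.\<close>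

definition \<alpha> :: "real \<Rightarrow> string_label \<Rightarrow> real \<Rightarrow> complex" where
  "\<alpha> \<omega> k \<zeta> = \<i> * complex_of_real (\<omega> * (if \<epsilon>\<^sub>0 \<le> T k \<zeta> then inverse (T k \<zeta>) else 0))"

definition \<gamma> :: "real \<Rightarrow> string_label \<Rightarrow> real \<Rightarrow> complex" where
  "\<gamma> \<omega> k \<zeta> = \<i> * complex_of_real (\<omega> * (if \<bar>\<rho> k \<zeta>\<bar> \<le> coeff_max then \<rho> k \<zeta> else 0))"

definition B :: "real \<Rightarrow> real" where "B \<omega> = \<bar>\<omega>\<bar> * (1 / \<epsilon>\<^sub>0 + coeff_max)"

lemma coefficients_bounded: "cmod (\<alpha> \<omega> k \<zeta>) \<le> B \<omega>" "cmod (\<gamma> \<omega> k \<zeta>) \<le> B \<omega>" "0 \<le> B \<omega>"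
proof -
  have 1: "\<bar>if \<epsilon>\<^sub>0 \<le> T k \<zeta> then inverse (T k \<zeta>) else 0\<bar> \<le> 1 / \<epsilon>\<^sub>0 + coeff_max"
    using \<epsilon>\<^sub>0 coeff_max frac_le[of 1 1 \<epsilon>\<^sub>0 "T k \<zeta>"] by (auto simp: inverse_eq_divide intro: add_increasing2)
  have 2: "\<bar>if \<bar>\<rho> k \<zeta>\<bar> \<le> coeff_max then \<rho> k \<zeta> else 0\<bar> \<le> 1 / \<epsilon>\<^sub>0 + coeff_max"
    using \<epsilon>\<^sub>0 coeff_max by (auto intro: add_increasing)
  show "cmod (\<alpha> \<omega> k \<zeta>) \<le> B \<omega>" "cmod (\<gamma> \<omega> k \<zeta>) \<le> B \<omega>"
    using mult_left_mono[OF 1, of "\<bar>\<omega>\<bar>"] mult_left_mono[OF 2, of "\<bar>\<omega>\<bar>"]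
    unfolding \<alpha>_def \<gamma>_def B_def norm_mult norm_of_real abs_mult by simp_all
  show "0 \<le> B \<omega>" using \<epsilon>\<^sub>0 coeff_max by (simp add: B_def)
qed

lemma coefficients_AE:
  "AE \<zeta> in Leb a b. \<forall>k. T k \<zeta> \<noteq> 0 \<and> \<rho> k \<zeta> \<noteq> 0 \<and> \<alpha> \<omega> k \<zeta> = \<i> * complex_of_real \<omega> * complex_of_real (inverse (T k \<zeta>)) \<and>
     \<gamma> \<omega> k \<zeta> = \<i> * complex_of_real \<omega> * complex_of_real (\<rho> k \<zeta>)"
  using coeff_max_AE
proof eventually_elim
  case (elim \<zeta>)
  show ?case
  proof
    fix k
    have "\<epsilon>\<^sub>0 \<le> T k \<zeta>" "\<epsilon>\<^sub>0 \<le> \<rho> k \<zeta>" "\<rho> k \<zeta> \<le> coeff_max" using elim by auto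
    then show "T k \<zeta> \<noteq> 0 \<and> \<rho> k \<zeta> \<noteq> 0 \<and> \<alpha> \<omega> k \<zeta> = \<i> * complex_of_real \<omega> * complex_of_real (inverse (T k \<zeta>)) \<and>
     \<gamma> \<omega> k \<zeta> = \<i> * complex_of_real \<omega> * complex_of_real (\<rho> k \<zeta>)"
      using \<epsilon>\<^sub>0 by (simp add: \<alpha>_def \<gamma>_def)
  qed
qed

lemma coefficients_imaginary: "cnj (\<alpha> \<omega> k \<zeta>) = - \<alpha> \<omega> k \<zeta>" "cnj (\<gamma> \<omega> k \<zeta>) = - \<gamma> \<omega> k \<zeta>"
  by (simp_all add: \<alpha>_def \<gamma>_def)

lemmas network_wronskian = wronskian_constant[OF _ _ coefficients_bounded(1,2,3)]

lemmas network_energy = string_energy_flow_constant[OF _ coefficients_bounded(1,2) coefficients_imaginary coefficients_bounded(3)]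

text \<open>\<open>P1\<close> is an involution, so the eigenvalue equation can be solved for the
  derivative \<open>g\<close> of \<open>w\<close>. It then splits into one system per string, since
  \<open>P1\<close> merely swaps the two components of each pair.\<close>

lemma eigenvector_string_solution:
  assumes z: "z \<in> D" and eig: "ae_eq a b (A z) (\<lambda>\<zeta>. (\<i> * complex_of_real \<omega>) *s z \<zeta>)"
  obtains w where "continuous_on {a..b} w" "ae_eq a b w (\<lambda>\<zeta>. H \<zeta> *v z \<zeta>)" "W_B \<beta> *v stack (w b) (w a) = 0"
    "\<And>k. string_solution a b (\<alpha> \<omega> k) (\<gamma> \<omega> k) (\<lambda>\<zeta>. w \<zeta> $ displacement_index k) (\<lambda>\<zeta>. w \<zeta> $ force_index k)"
proof (rule dom_A_E[OF z])
  fix w g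
  assume w: "continuous_on {a..b} w" "ae_eq a b w (\<lambda>\<zeta>. H \<zeta> *v z \<zeta>)" "W_B \<beta> *v stack (w b) (w a) = 0"
    and Az: "A z = (\<lambda>\<zeta>. P1 *v g \<zeta>)"
    and int: "\<And>c d. a \<le> c \<Longrightarrow> c \<le> d \<Longrightarrow> d \<le> b \<Longrightarrow> (g has_integral (w d - w c)) {c..d}"
  have ae: "AE \<zeta> in Leb a b. \<forall>k. g \<zeta> $ displacement_index k = \<alpha> \<omega> k \<zeta> * w \<zeta> $ force_index k \<and>
      g \<zeta> $ force_index k = \<gamma> \<omega> k \<zeta> * w \<zeta> $ displacement_index k"
    using eig[unfolded ae_eq_def Az] w(2)[unfolded ae_eq_def] coefficients_AE[of \<omega>]
  proof eventually_elim
    case (elim \<zeta>)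
    have g: "g \<zeta> = P1 *v ((\<i> * complex_of_real \<omega>) *s z \<zeta>)" using elim(1) P1_P1[of "g \<zeta>"] by simp
    show ?case
    proof
      fix k
      show "g \<zeta> $ displacement_index k = \<alpha> \<omega> k \<zeta> * w \<zeta> $ force_index k \<and>
        g \<zeta> $ force_index k = \<gamma> \<omega> k \<zeta> * w \<zeta> $ displacement_index k"
        using elim(2) elim(3)[rule_format, of k] unfolding g
        by (cases k) (simp_all add: P1_mult hamiltonian_mult ham_diag_def)
    qed
  qed
  have "string_solution a b (\<alpha> \<omega> k) (\<gamma> \<omega> k) (\<lambda>\<zeta>. w \<zeta> $ displacement_index k) (\<lambda>\<zeta>. w \<zeta> $ force_index k)" for k
    unfolding string_solution_def
  proof (intro conjI allI impI continuous_intros w(1))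
    fix c d assume cd: "a \<le> c \<and> c \<le> d \<and> d \<le> b"
    have comp: "((\<lambda>\<zeta>. g \<zeta> $ i) has_integral (w d $ i - w c $ i)) {c..d}" for i
      using has_integral_linear[OF int[of c d] bounded_linear_vec_nth, of i] cd by (simp add: o_def)
    show "((\<lambda>\<zeta>. \<alpha> \<omega> k \<zeta> * w \<zeta> $ force_index k) has_integral (w d $ displacement_index k - w c $ displacement_index k)) {c..d}"
      by (rule has_integral_AE_Leb[OF _ _ _ comp]) (use ae cd in \<open>auto elim: eventually_mono\<close>)
    show "((\<lambda>\<zeta>. \<gamma> \<omega> k \<zeta> * w \<zeta> $ displacement_index k) has_integral (w d $ force_index k - w c $ force_index k)) {c..d}"
      by (rule has_integral_AE_Leb[OF _ _ _ comp]) (use ae cd in \<open>auto elim: eventually_mono\<close>)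
  qed
  then show thesis using that w by blast
qed

lemma fundamental_solution_E:
  assumes "fundamental_solution a b T \<rho> \<omega> k \<Psi>"
  obtains \<Psi>' where "continuous_on {a..b} \<Psi>" "\<Psi> \<in> L2 a b" "\<Psi>' \<in> L2 a b" "has_weak_deriv a b \<Psi> \<Psi>'" "\<Psi> a = mat 1"
    "AE \<zeta> in Leb a b. \<Psi>' \<zeta> = string_ode_matrix T \<rho> \<omega> k \<zeta> ** \<Psi> \<zeta>"
proof -
  have "\<exists>g. g \<in> L2 a b \<and> has_weak_deriv a b \<Psi> g"
    using assms by (auto simp: fundamental_solution_def H1_def)
  from someI_ex[OF this, folded weak_deriv_def] that[of "weak_deriv a b \<Psi>"] show ?thesis
    using assms by (simp add: fundamental_solution_def ae_eq_def continuous_L2)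
qed

lemma string_ode_matrix_mult:
  "(string_ode_matrix T \<rho> \<omega> k \<zeta> ** M) $ 1 $ j = \<i> * complex_of_real \<omega> * complex_of_real (inverse (T k \<zeta>)) * M $ 2 $ j"
  "(string_ode_matrix T \<rho> \<omega> k \<zeta> ** M) $ 2 $ j = \<i> * complex_of_real \<omega> * complex_of_real (\<rho> k \<zeta>) * M $ 1 $ j"
  by (simp_all add: string_ode_matrix_def matrix_matrix_mult_def sum_2 vector_2)

lemma fundamental_solution_columns:
  assumes "fundamental_solution a b T \<rho> \<omega> k \<Psi>"
  shows "string_solution a b (\<alpha> \<omega> k) (\<gamma> \<omega> k) (\<lambda>\<zeta>. \<Psi> \<zeta> $ 1 $ j) (\<lambda>\<zeta>. \<Psi> \<zeta> $ 2 $ j)"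
proof (rule fundamental_solution_E[OF assms])
  fix \<Psi>' assume \<Psi>: "continuous_on {a..b} \<Psi>" "\<Psi> \<in> L2 a b" "\<Psi>' \<in> L2 a b" "has_weak_deriv a b \<Psi> \<Psi>'"
    and ae: "AE \<zeta> in Leb a b. \<Psi>' \<zeta> = string_ode_matrix T \<rho> \<omega> k \<zeta> ** \<Psi> \<zeta>"
  have int: "(\<Psi>' has_integral (\<Psi> d - \<Psi> c)) {c..d}" if "a \<le> c" "c \<le> d" "d \<le> b" for c d
    by (rule has_weak_deriv_ftc[OF \<Psi>(4) L2_measurable[OF \<Psi>(2)] L2_integrable[OF \<Psi>(3)] \<Psi>(1) _ that])
       (simp add: ae_eq_def)
  have ae': "AE \<zeta> in Leb a b. \<Psi>' \<zeta> $ 1 $ j = \<alpha> \<omega> k \<zeta> * \<Psi> \<zeta> $ 2 $ j \<and> \<Psi>' \<zeta> $ 2 $ j = \<gamma> \<omega> k \<zeta> * \<Psi> \<zeta> $ 1 $ j"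
    using ae coefficients_AE[of \<omega>] by eventually_elim (simp add: string_ode_matrix_mult)
  show ?thesis
    unfolding string_solution_def
  proof (intro conjI allI impI continuous_intros \<Psi>(1))
    fix c d assume cd: "a \<le> c \<and> c \<le> d \<and> d \<le> b"
    have comp: "((\<lambda>\<zeta>. \<Psi>' \<zeta> $ i $ j) has_integral (\<Psi> d $ i $ j - \<Psi> c $ i $ j)) {c..d}" for i
      using has_integral_linear[OF has_integral_linear[OF int[of c d] bounded_linear_vec_nth, of i] bounded_linear_vec_nth, of j] cd
      by (simp add: o_def)
    show "((\<lambda>\<zeta>. \<alpha> \<omega> k \<zeta> * \<Psi> \<zeta> $ 2 $ j) has_integral (\<Psi> d $ 1 $ j - \<Psi> c $ 1 $ j)) {c..d}"
      by (rule has_integral_AE_Leb[OF _ _ _ comp]) (use ae' cd in \<open>auto elim: eventually_mono\<close>)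
    show "((\<lambda>\<zeta>. \<gamma> \<omega> k \<zeta> * \<Psi> \<zeta> $ 1 $ j) has_integral (\<Psi> d $ 2 $ j - \<Psi> c $ 2 $ j)) {c..d}"
      by (rule has_integral_AE_Leb[OF _ _ _ comp]) (use ae' cd in \<open>auto elim: eventually_mono\<close>)
  qed
qed

lemma fundamental_solution_initial:
  assumes "fundamental_solution a b T \<rho> \<omega> k \<Psi>"
  shows "\<Psi> a $ 1 $ 1 = 1" "\<Psi> a $ 1 $ 2 = 0" "\<Psi> a $ 2 $ 1 = 0" "\<Psi> a $ 2 $ 2 = 1"
  using assms by (simp_all add: fundamental_solution_def mat_def)

text \<open>Unique continuation from \<open>b\<close> by Wronskians alone: those of the solution
  with both columns of \<open>\<Psi>\<close> vanish throughout, and the determinant of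
  \<open>\<Psi>\<close> is 1.\<close>

lemma string_solution_zero:
  assumes \<Psi>: "fundamental_solution a b T \<rho> \<omega> k \<Psi>"
    and s: "string_solution a b (\<alpha> \<omega> k) (\<gamma> \<omega> k) u v" and zero: "u b = 0" "v b = 0" and x: "x \<in> {a..b}"
  shows "u x = 0 \<and> v x = 0"
proof -
  note col = fundamental_solution_columns[OF \<Psi>]
  have b: "b \<in> {a..b}" using ab by simp
  have W: "u x * \<Psi> x $ 2 $ j - v x * \<Psi> x $ 1 $ j = 0" for j
    using network_wronskian[OF s col x, of j] network_wronskian[OF s col b, of j] zero by simp
  have det: "\<Psi> x $ 1 $ 1 * \<Psi> x $ 2 $ 2 - \<Psi> x $ 2 $ 1 * \<Psi> x $ 1 $ 2 = 1"
    using network_wronskian[OF col[of 1] col[of 2] x] fundamental_solution_initial[OF \<Psi>] by simp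
  have "u x = u x * (\<Psi> x $ 1 $ 1 * \<Psi> x $ 2 $ 2 - \<Psi> x $ 2 $ 1 * \<Psi> x $ 1 $ 2)"
    "v x = v x * (\<Psi> x $ 1 $ 1 * \<Psi> x $ 2 $ 2 - \<Psi> x $ 2 $ 1 * \<Psi> x $ 1 $ 2)"
    using det by simp_all
  moreover have "u x * (\<Psi> x $ 1 $ 1 * \<Psi> x $ 2 $ 2 - \<Psi> x $ 2 $ 1 * \<Psi> x $ 1 $ 2) = 0"
    "v x * (\<Psi> x $ 1 $ 1 * \<Psi> x $ 2 $ 2 - \<Psi> x $ 2 $ 1 * \<Psi> x $ 1 $ 2) = 0"
    using W[of 1] W[of 2] by algebra+
  ultimately show ?thesis by simp
qed

text \<open>Dissipation at the common end point forces all displacements to vanish there.\<close>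

lemma no_imaginary_eigenvalue:
  assumes \<Psi>: "\<And>k. fundamental_solution a b T \<rho> \<omega> k (\<Psi> k)"
    and pos: "boundary_minors b \<Psi> > 0"
    and z: "z \<in> D" and eig: "ae_eq a b (A z) (\<lambda>\<zeta>. (\<i> * complex_of_real \<omega>) *s z \<zeta>)"
  shows "ae_eq a b z (\<lambda>\<zeta>. 0)"
proof (rule eigenvector_string_solution[OF z eig])
  fix w
  assume w: "continuous_on {a..b} w" "ae_eq a b w (\<lambda>\<zeta>. H \<zeta> *v z \<zeta>)" "W_B \<beta> *v stack (w b) (w a) = 0"
    and s: "\<And>k. string_solution a b (\<alpha> \<omega> k) (\<gamma> \<omega> k) (\<lambda>\<zeta>. w \<zeta> $ displacement_index k) (\<lambda>\<zeta>. w \<zeta> $ force_index k)"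
  have b: "b \<in> {a..b}" using ab by simp
  have bc: "w b $ 3 = w b $ 1" "w b $ 5 = w b $ 1" "complex_of_real \<beta> * w b $ 1 + w b $ 2 + w b $ 4 + w b $ 6 = 0"
    "w a $ 1 = 0" "w a $ 4 = 0" "w a $ 6 = 0"
    using w(3)[unfolded W_B_iff] by metis+
  have disp_b: "w b $ displacement_index k = w b $ 1" for k using bc by (cases k) simp_all
  \<comment> \<open>For each string one factor vanishes at \<open>a\<close>, and constancy of the
    energy flow carries the zero to \<open>b\<close>. Summing there and inserting the damped balance
    of forces leaves \<open>\<beta>\<close> times the squared modulus of
    \<open>w b $ 1\<close>.\<close>
  have "Re (cnj (w a $ displacement_index k) * w a $ force_index k) = 0" for k using bc by (cases k) simp_all
  then have "Re (cnj (w b $ 1) * w b $ force_index k) = 0" for k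
    using network_energy[OF s[of k] b] disp_b[of k] by simp
  from this[of S_I] this[of S_II] this[of S_III]
  have "Re (cnj (w b $ 1) * (w b $ 2 + w b $ 4 + w b $ 6)) = 0"
    by (simp add: distrib_left)
  moreover have "w b $ 2 + w b $ 4 + w b $ 6 = - (complex_of_real \<beta> * w b $ 1)"
    using bc(3) by algebra
  ultimately have "Re (cnj (w b $ 1) * (complex_of_real \<beta> * w b $ 1)) = 0" by simp
  moreover have "Re (cnj (w b $ 1) * (complex_of_real \<beta> * w b $ 1)) = \<beta> * ((Re (w b $ 1))\<^sup>2 + (Im (w b $ 1))\<^sup>2)"
    by (simp add: algebra_simps power2_eq_square)
  ultimately have "\<beta> * (cmod (w b $ 1))\<^sup>2 = 0" unfolding cmod_power2 by simp
  then have w1: "w b $ 1 = 0" using \<beta> by simp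
  then have disp: "w b $ displacement_index k = 0" for k using disp_b by simp
  have sum0: "w b $ 2 + w b $ 4 + w b $ 6 = 0" using bc w1 by simp
  note col = fundamental_solution_columns[OF \<Psi>]
  \<comment> \<open>The column \<open>j\<close> is then chosen to satisfy the same condition at
    \<open>a\<close> as the string, namely 2 for string I and 1 for the others, which makes the
    right-hand side 0.\<close>
  have W: "w b $ force_index k * \<Psi> k b $ 1 $ j = w a $ force_index k * \<Psi> k a $ 1 $ j - w a $ displacement_index k * \<Psi> k a $ 2 $ j" for k j
    using network_wronskian[OF s[of k] col[of k j] b] disp[of k] by (simp add: algebra_simps)
  have p: "w b $ 2 * \<Psi> S_I b $ 1 $ 2 = 0" "w b $ 4 * \<Psi> S_II b $ 1 $ 1 = 0" "w b $ 6 * \<Psi> S_III b $ 1 $ 1 = 0"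
    using W[of S_I 2] W[of S_II 1] W[of S_III 1] bc fundamental_solution_initial[OF \<Psi>] by simp_all
  \<comment> \<open>A nonzero product means two nonzero entries, so two of the forces vanish by
    \<open>p\<close>, and \<open>sum0\<close> removes the third.\<close>
  have "w b $ 2 = 0 \<and> w b $ 4 = 0 \<and> w b $ 6 = 0"
    using pos p sum0 by (auto simp: norm_mult)
  then have force: "w b $ force_index k = 0" for k by (cases k) auto
  have "w x $ displacement_index k = 0 \<and> w x $ force_index k = 0" if "x \<in> {a..b}" for x k
    by (rule string_solution_zero[OF \<Psi> s disp force that])
  from this[of _ S_I] this[of _ S_II] this[of _ S_III]
  have w0: "w x = 0" if "x \<in> {a..b}" for x
    using that by (simp add: vec_eq_iff forall_6)
  have "AE x in Leb a b. a < x \<and> x < b" by (rule AE_LebI) simp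
  with H_H_inv w(2)[unfolded ae_eq_def] show ?thesis
    unfolding ae_eq_def
  proof eventually_elim
    case (elim x)
    then have "z x = H_inv x (H x *v z x)" by simp
    also have "H x *v z x = 0" using elim w0[of x] by simp
    also have "H_inv x 0 = 0" by (simp add: H_inv_def vec_eq_iff)
    finally show ?case .
  qed
qed

text \<open>At frequency 0 the coefficients vanish, so \<open>\<Psi>\<close> keeps its initial value
  in this entry. This settles the one frequency about which the first hypothesis of the theorem is
  silent.\<close>

lemma fundamental_solution_frequency_zero:
  assumes \<Psi>: "fundamental_solution a b T \<rho> 0 k \<Psi>"
  shows "\<Psi> b $ 1 $ 1 = 1"
proof -
  have "((\<lambda>s. \<alpha> 0 k s * \<Psi> s $ 2 $ 1) has_integral (\<Psi> b $ 1 $ 1 - \<Psi> a $ 1 $ 1)) {a..b}"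
    using fundamental_solution_columns[OF \<Psi>, of 1] ab unfolding string_solution_def by auto
  then have "((\<lambda>s. 0) has_integral (\<Psi> b $ 1 $ 1 - \<Psi> a $ 1 $ 1)) {a..b}" by (simp add: \<alpha>_def)
  then show ?thesis using fundamental_solution_initial[OF \<Psi>] has_integral_0_eq by fastforce
qed

text \<open>When two of the three boundary entries vanish, two strings can be glued into an eigenfunction
  supported on them.\<close>

lemma imaginary_eigenvalue:
  assumes \<Psi>: "\<And>k. fundamental_solution a b T \<rho> \<omega> k (\<Psi> k)"
    and zero: "boundary_minors b \<Psi> = 0"
  shows "eigenvalue_A a b \<beta> H (\<i> * complex_of_real \<omega>)"
proof -
  \<comment> \<open>First component and force at \<open>b\<close> of the column that meets the
    condition at \<open>a\<close>.\<close>
  define p where "p = (\<lambda>k. \<Psi> k b $ 1 $ (case k of S_I \<Rightarrow> 2 | S_II \<Rightarrow> 1 | S_III \<Rightarrow> 1))"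
  define q where "q = (\<lambda>k. \<Psi> k b $ 2 $ (case k of S_I \<Rightarrow> 2 | S_II \<Rightarrow> 1 | S_III \<Rightarrow> 1))"
  have "p S_I * p S_II = 0 \<and> p S_I * p S_III = 0 \<and> p S_II * p S_III = 0"
    using zero unfolding p_def by (simp add: add_nonneg_eq_0_iff)
  then have two: "p S_I = 0 \<and> p S_II = 0 \<or> p S_I = 0 \<and> p S_III = 0 \<or> p S_II = 0 \<and> p S_III = 0" by auto
  have pair: "\<exists>c d. (c \<noteq> 0 \<or> d \<noteq> 0) \<and> c * u + d * v = 0" for u v :: complex
  proof (cases "u = 0")
    case True
    then show ?thesis by (intro exI[of _ 1] exI[of _ 0]) simp
  next
    case False
    then show ?thesis by (intro exI[of _ v] exI[of _ "- u"]) simp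
  qed
  \<comment> \<open>Any two forces have a nontrivial combination equal to 0; the string outside the
    vanishing pair gets the coefficient 0.\<close>
  have "\<exists>c1 c2 c3. (c1 \<noteq> 0 \<or> c2 \<noteq> 0 \<or> c3 \<noteq> 0) \<and> c1 * p S_I = 0 \<and> c2 * p S_II = 0 \<and> c3 * p S_III = 0 \<and>
      c1 * q S_I + c2 * q S_II + c3 * q S_III = 0"
    using two
  proof (elim disjE)
    assume "p S_I = 0 \<and> p S_II = 0"
    with pair[of "q S_I" "q S_II"] show ?thesis by (metis add_0_right mult_zero_left mult_zero_right)
  next
    assume "p S_I = 0 \<and> p S_III = 0"
    with pair[of "q S_I" "q S_III"] show ?thesis by (metis add_0_right mult_zero_left mult_zero_right)
  next
    assume "p S_II = 0 \<and> p S_III = 0"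
    with pair[of "q S_II" "q S_III"] show ?thesis by (metis add_0_left mult_zero_left mult_zero_right)
  qed
  then obtain c1 c2 c3 where ne: "c1 \<noteq> 0 \<or> c2 \<noteq> 0 \<or> c3 \<noteq> 0"
    and cp: "c1 * p S_I = 0" "c2 * p S_II = 0" "c3 * p S_III = 0"
    and cq: "c1 * q S_I + c2 * q S_II + c3 * q S_III = 0" by blast
  \<comment> \<open>Places the scaled column into the components of its string. Linearity in the
    whole matrix lets the weak derivative pass through.\<close>
  define L where "L = (\<lambda>k (M::complex^2^2). case k of
      S_I \<Rightarrow> vector [c1 * M $ 1 $ 2, c1 * M $ 2 $ 2, 0, 0, 0, 0] :: complex^6
    | S_II \<Rightarrow> vector [0, 0, c2 * M $ 1 $ 1, c2 * M $ 2 $ 1, 0, 0]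
    | S_III \<Rightarrow> vector [0, 0, 0, 0, c3 * M $ 1 $ 1, c3 * M $ 2 $ 1])"
  have L: "bounded_linear (L k)" for k
  proof -
    have "linear (L k)"
      by (rule linearI; cases k) (simp_all add: L_def vec_eq_iff forall_6 algebra_simps)
    then show ?thesis by (simp add: linear_conv_bounded_linear)
  qed
  define P where "P k \<Psi>' \<longleftrightarrow> continuous_on {a..b} (\<Psi> k) \<and> \<Psi> k \<in> L2 a b \<and> \<Psi>' \<in> L2 a b \<and>
      has_weak_deriv a b (\<Psi> k) \<Psi>' \<and> (AE \<zeta> in Leb a b. \<Psi>' \<zeta> = string_ode_matrix T \<rho> \<omega> k \<zeta> ** \<Psi> k \<zeta>)" for k \<Psi>'
  have "\<exists>\<Psi>'. P k \<Psi>'" for k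
    unfolding P_def by (rule fundamental_solution_E[OF \<Psi>[of k]]) blast
  then obtain \<Psi>' where P: "\<And>k. P k (\<Psi>' k)" by metis
  have cont: "continuous_on {a..b} (\<Psi> k)" and L2: "\<Psi> k \<in> L2 a b" "\<Psi>' k \<in> L2 a b"
    and wd: "has_weak_deriv a b (\<Psi> k) (\<Psi>' k)"
    and ode: "AE \<zeta> in Leb a b. \<Psi>' k \<zeta> = string_ode_matrix T \<rho> \<omega> k \<zeta> ** \<Psi> k \<zeta>" for k
    using P[of k] by (simp_all add: P_def)
  define v where "v \<zeta> = L S_I (\<Psi> S_I \<zeta>) + L S_II (\<Psi> S_II \<zeta>) + L S_III (\<Psi> S_III \<zeta>)" for \<zeta>
  define g where "g \<zeta> = L S_I (\<Psi>' S_I \<zeta>) + L S_II (\<Psi>' S_II \<zeta>) + L S_III (\<Psi>' S_III \<zeta>)" for \<zeta>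
  have v_nth: "v \<zeta> $ 1 = c1 * \<Psi> S_I \<zeta> $ 1 $ 2" "v \<zeta> $ 2 = c1 * \<Psi> S_I \<zeta> $ 2 $ 2"
    "v \<zeta> $ 3 = c2 * \<Psi> S_II \<zeta> $ 1 $ 1" "v \<zeta> $ 4 = c2 * \<Psi> S_II \<zeta> $ 2 $ 1"
    "v \<zeta> $ 5 = c3 * \<Psi> S_III \<zeta> $ 1 $ 1" "v \<zeta> $ 6 = c3 * \<Psi> S_III \<zeta> $ 2 $ 1" for \<zeta>
    by (simp_all add: v_def L_def)
  have g_nth: "g \<zeta> $ 1 = c1 * \<Psi>' S_I \<zeta> $ 1 $ 2" "g \<zeta> $ 2 = c1 * \<Psi>' S_I \<zeta> $ 2 $ 2"
    "g \<zeta> $ 3 = c2 * \<Psi>' S_II \<zeta> $ 1 $ 1" "g \<zeta> $ 4 = c2 * \<Psi>' S_II \<zeta> $ 2 $ 1"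
    "g \<zeta> $ 5 = c3 * \<Psi>' S_III \<zeta> $ 1 $ 1" "g \<zeta> $ 6 = c3 * \<Psi>' S_III \<zeta> $ 2 $ 1" for \<zeta>
    by (simp_all add: g_def L_def)
  have v_cont: "continuous_on {a..b} v"
    unfolding v_def by (intro continuous_on_add bounded_linear.continuous_on[OF L] cont)
  have gX: "g \<in> X" unfolding g_def by (intro L2_add L2_bounded_linear[OF L] L2)
  have vX: "v \<in> X" by (rule continuous_L2[OF v_cont])
  have v_wd: "has_weak_deriv a b v g"
    unfolding v_def g_def
    by (intro has_weak_deriv_add has_weak_deriv_bounded_linear[OF L] wd L2 L2_add L2_bounded_linear[OF L])
  define x where "x \<zeta> = H_inv \<zeta> (v \<zeta>)" for \<zeta>
  have xX: "x \<in> X" unfolding x_def by (rule H_inv_L2[OF vX])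
  have Hx: "ae_eq a b (\<lambda>\<zeta>. H \<zeta> *v x \<zeta>) v"
    unfolding ae_eq_def x_def using H_H_inv by eventually_elim simp
  have vH: "ae_eq a b v (\<lambda>\<zeta>. H \<zeta> *v x \<zeta>)"
    using Hx unfolding ae_eq_def by eventually_elim simp
  have HxX: "(\<lambda>\<zeta>. H \<zeta> *v x \<zeta>) \<in> X" by (rule H_mult_L2[OF xX])
  have Hx_wd: "has_weak_deriv a b (\<lambda>\<zeta>. H \<zeta> *v x \<zeta>) g"
    by (rule has_weak_deriv_cong[OF v_wd vX HxX Hx])
  note init = fundamental_solution_initial[OF \<Psi>]
  have "W_B \<beta> *v stack (v b) (v a) = 0"
    using cq unfolding W_B_iff v_nth init cp[unfolded p_def string_label.case] by (simp add: q_def)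
  then have xD: "x \<in> D"
    using xX HxX Hx_wd gX v_cont vH by (auto simp: dom_A_def H1_def)
  have "AE \<zeta> in Leb a b. P1 *v g \<zeta> = (\<i> * complex_of_real \<omega>) *s x \<zeta>"
    using ode[of S_I] ode[of S_II] ode[of S_III] coefficients_AE[of \<omega>]
  proof eventually_elim
    case (elim \<zeta>)
    then show ?case
      by (simp add: vec_eq_iff forall_6 P1_mult g_nth string_ode_matrix_mult x_def H_inv_def ham_diag_def v_nth field_simps)
  qed
  moreover have "ae_eq a b (weak_deriv a b (\<lambda>\<zeta>. H \<zeta> *v x \<zeta>)) g"
  proof -
    have "\<exists>g. g \<in> L2 a b \<and> has_weak_deriv a b (\<lambda>\<zeta>. H \<zeta> *v x \<zeta>) g" using gX Hx_wd by blast
    from someI_ex[OF this, folded weak_deriv_def] show ?thesis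
      using has_weak_deriv_unique[OF _ Hx_wd L2_measurable[OF HxX] _ L2_integrable[OF gX] v_cont vH] L2_integrable by blast
  qed
  ultimately have "ae_eq a b (A x) (\<lambda>\<zeta>. (\<i> * complex_of_real \<omega>) *s x \<zeta>)"
    unfolding ae_eq_def op_A_def by eventually_elim simp
  moreover have "\<not> ae_eq a b x (\<lambda>\<zeta>. 0)"
  proof
    assume "ae_eq a b x (\<lambda>\<zeta>. 0)"
    with vH have "AE \<zeta> in Leb a b. v \<zeta> = 0"
      unfolding ae_eq_def by eventually_elim (simp add: matrix_vector_mult_0_right)
    from continuous_AE_zero[OF ab v_cont this, of a] have "v a = 0" using ab by simp
    \<comment> \<open>The columns start from the identity matrix, so these components of
      \<open>v a\<close> are \<open>c1\<close>, \<open>c2\<close> and \<open>c3\<close>.\<close>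
    then have "v a $ 2 = 0" "v a $ 3 = 0" "v a $ 5 = 0" by simp_all
    then show False using ne unfolding v_nth init by simp
  qed
  ultimately show ?thesis using xD unfolding eigenvalue_A_def by blast
qed

end

section \<open>Stability and instability of the network semigroup\<close>

context string_network_semigroup
begin

lemma nrm_diff_J:
  assumes "z \<in> D"
  shows "nrm (A z - \<omega> *\<^sub>R J z) = 0 \<longleftrightarrow> ae_eq a b (A z) (\<lambda>\<zeta>. (\<i> * complex_of_real \<omega>) *s z \<zeta>)"
proof -
  have "\<omega> *\<^sub>R J z = (\<lambda>\<zeta>. (\<i> * complex_of_real \<omega>) *s z \<zeta>)"
    by (simp add: J_def fun_ops scaleR_vec fun_eq_iff vec_eq_iff)
  moreover have "\<omega> *\<^sub>R J z \<in> X" using assms by simp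
  ultimately show ?thesis using nrm_diff_eq_0_iff[of "A z" "\<omega> *\<^sub>R J z"] assms by simp
qed

lemma graph_norm_eq: "graph_norm a b H x = sqrt ((nrm x)\<^sup>2 + (nrm (A x))\<^sup>2)"
  by (simp add: graph_norm_def norm_H_eq)

lemma semi_uniformly_stableI:
  assumes \<Psi>: "\<And>\<omega> k. fundamental_solution a b T \<rho> \<omega> k (\<Psi> \<omega> k)"
    and pos: "\<And>\<omega>. \<omega> \<noteq> 0 \<Longrightarrow> boundary_minors b (\<Psi> \<omega>) > 0"
  shows "semi_uniformly_stable a b \<beta> H S"
proof -
  have pos': "boundary_minors b (\<Psi> \<omega>) > 0" for \<omega>
  proof (cases "\<omega> = 0")
    case True
    then show ?thesis
      using fundamental_solution_frequency_zero[OF \<Psi>, of S_II] fundamental_solution_frequency_zero[OF \<Psi>, of S_III]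
      by (simp add: add_nonneg_pos)
  qed (rule pos)
  have "((\<lambda>t. nrm (S t x)) \<longlongrightarrow> 0) at_top" if x: "x \<in> D" for x
  proof (rule ccontr)
    assume "\<not> ((\<lambda>t. nrm (S t x)) \<longlongrightarrow> 0) at_top"
    from stable_or_imaginary_eigenvalue[OF x this] obtain z \<omega>
      where z: "z \<in> D" "nrm z \<noteq> 0" "nrm (A z - \<omega> *\<^sub>R J z) = 0" by blast
    then show False
      using no_imaginary_eigenvalue[OF \<Psi> pos' z(1), of \<omega>] nrm_diff_J[OF z(1)] nrm_eq_0_iff[of z] by simp
  qed
  from uniformly_stable[OF this] obtain f :: "real \<Rightarrow> real" where f: "\<And>t. 0 \<le> t \<Longrightarrow> 0 \<le> f t" "(f \<longlongrightarrow> 0) at_top"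
    "\<And>x t. x \<in> D \<Longrightarrow> 0 \<le> t \<Longrightarrow> nrm (S t x) \<le> f t * sqrt ((nrm x)\<^sup>2 + (nrm (A x))\<^sup>2)" by blast
  show ?thesis
    unfolding semi_uniformly_stable_def norm_H_eq graph_norm_eq
    by (intro exI[of _ f] conjI allI impI ballI f)
qed

text \<open>The orbit of an eigenvector keeps its norm, whereas \<open>f t\<close> times its fixed
  graph norm tends to 0.\<close>

lemma not_semi_uniformly_stableI:
  assumes "eigenvalue_A a b \<beta> H (\<i> * complex_of_real \<omega>)"
  shows "\<not> semi_uniformly_stable a b \<beta> H S"
proof
  assume "semi_uniformly_stable a b \<beta> H S"
  then obtain f :: "real \<Rightarrow> real" where f: "(f \<longlongrightarrow> 0) at_top"
    "\<And>x t. x \<in> D \<Longrightarrow> 0 \<le> t \<Longrightarrow> nrm (S t x) \<le> f t * graph_norm a b H x"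
    unfolding semi_uniformly_stable_def norm_H_eq by blast
  obtain z where z: "z \<in> D" "\<not> ae_eq a b z (\<lambda>\<zeta>. 0)" "ae_eq a b (A z) (\<lambda>\<zeta>. (\<i> * complex_of_real \<omega>) *s z \<zeta>)"
    using assms unfolding eigenvalue_A_def by blast
  have "nrm z \<le> f t * graph_norm a b H z" if "0 < t" for t
    using nrm_T_eigenvector[OF z(1) nrm_diff_J[OF z(1), THEN iffD2, OF z(3)] that] f(2)[OF z(1), of t] that by simp
  then have "\<forall>\<^sub>F t in at_top. nrm z \<le> f t * graph_norm a b H z"
    by (intro eventually_mono[OF eventually_gt_at_top[of 0]])
  moreover have "((\<lambda>t. f t * graph_norm a b H z) \<longlongrightarrow> 0 * graph_norm a b H z) at_top"
    by (intro tendsto_intros f)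
  ultimately have "nrm z \<le> 0 * graph_norm a b H z"
    by (intro tendsto_le[OF _ _ tendsto_const]) auto
  then have "nrm z = 0" using z(1) by (simp add: antisym)
  then show False using z(1,2) nrm_eq_0_iff[of z] by simp
qed

end

theorem theorem4p6:
  fixes a b \<beta> \<epsilon>\<^sub>0 :: real
    and T \<rho> :: "string_label \<Rightarrow> real \<Rightarrow> real"
    and S :: "real \<Rightarrow> (real \<Rightarrow> complex^6) \<Rightarrow> real \<Rightarrow> complex^6"
    and \<Psi> :: "real \<Rightarrow> string_label \<Rightarrow> real \<Rightarrow> complex^2^2"
  assumes "a < b" and "\<beta> > 0"
    and "\<And>k. T k \<in> L_infty a b" and "\<And>k. \<rho> k \<in> L_infty a b"
    and "\<epsilon>\<^sub>0 > 0"
    and "\<And>k. AE \<zeta> in lebesgue_on {a<..<b}. T k \<zeta> \<ge> \<epsilon>\<^sub>0 \<and> \<rho> k \<zeta> \<ge> \<epsilon>\<^sub>0"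
    and "contraction_semigroup a b (hamiltonian T \<rho>) S"
    and "generates a b \<beta> (hamiltonian T \<rho>) S"
    and "\<And>\<omega> k. fundamental_solution a b T \<rho> \<omega> k (\<Psi> \<omega> k)"
  shows "((\<forall>\<omega>. \<omega> \<noteq> 0 \<longrightarrow>
              cmod (\<Psi> \<omega> S_I b $ 1 $ 2 * \<Psi> \<omega> S_II b $ 1 $ 1) +
              cmod (\<Psi> \<omega> S_I b $ 1 $ 2 * \<Psi> \<omega> S_III b $ 1 $ 1) +
              cmod (\<Psi> \<omega> S_II b $ 1 $ 1 * \<Psi> \<omega> S_III b $ 1 $ 1) > 0) \<longrightarrow>
            semi_uniformly_stable a b \<beta> (hamiltonian T \<rho>) S) \<and>
         (\<forall>\<omega>.
              cmod (\<Psi> \<omega> S_I b $ 1 $ 2 * \<Psi> \<omega> S_II b $ 1 $ 1) +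
              cmod (\<Psi> \<omega> S_I b $ 1 $ 2 * \<Psi> \<omega> S_III b $ 1 $ 1) +
              cmod (\<Psi> \<omega> S_II b $ 1 $ 1 * \<Psi> \<omega> S_III b $ 1 $ 1) = 0 \<longrightarrow>
            eigenvalue_A a b \<beta> (hamiltonian T \<rho>) (\<i> * complex_of_real \<omega>) \<and>
            \<not> semi_uniformly_stable a b \<beta> (hamiltonian T \<rho>) S)"
proof -
  interpret string_network_semigroup a b \<beta> \<epsilon>\<^sub>0 T \<rho> S
    by unfold_locales (fact assms)+
  show ?thesis
    using semi_uniformly_stableI[OF assms(9)] imaginary_eigenvalue[OF assms(9)] not_semi_uniformly_stableI
    by blast
qed

end
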